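(* Every sharp theory with purification and unrestricted reversibility satisfies the entanglement-thermodynamics duality: for every pair of systems $A,B$ and every pair of normalised pure states $\Phi,\Psi$ of $AB$, the following are equivalent: (1) $\Psi$ can be converted into $\Phi$ by local operations and classical communication (LOCC); (2) the marginal of $\Phi$ on $A$ can be converted into the marginal of $\Psi$ on $A$ by a RaRe channel; (3) the marginal of $\Phi$ on $B$ can be converted into the marginal of $\Psi$ on $B$ by a RaRe channel.
   Context: Framework. A causal operational probabilistic theory (OPT) has systems $A,B,\dots$ (including a trivial system $I$), with associative composites $AB$ ($AI=IA=A$; $AB$ and $BA$ related by a reversible swap), and tests. A test from $A$ to $B$ is a finite family $\{\mathcal C_i\}_{i\in X}$ of transformations from $A$ to $B$. Tests are closed under sequential composition, parallel composition $\otimes$ and coarse-graining (summing transformations over the blocks of a partition of $X$); identities $\mathcal I_A$ and swaps are one-outcome tests; systems and transformations form a strict symmetric monoidal category. Tests on $I$ are probability distributions, numbers compose by multiplication, and all probabilities in $[0,1]$ are available. A state of $A$ is a transformation $I\to A$, an effect is a transformation $A\to I$, $(a|\rho)\in[0,1]$ is their composition; tests $A\to I$ are observation-tests. States (effects) are equal iff they have the same pairing with all effects (states); transformations $\mathcal C,\mathcal C'$ from $A$ to $B$ are equal iff $(\mathcal C\otimes\mathcal I_S)\rho=(\mathcal C'\otimes\mathcal I_S)\rho$ for every system $S$ and state $\rho$ of $AS$. The spanned real vector spaces are finite-dimensional; the sets of states, effects and transformations are closed (hence compact). Every test $\{\mathcal A_i\}$ from $A$ to $B$ has the form $\mathcal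 A_i=(\mathcal I_B\otimes e_i)\mathcal A$ with $\mathcal A$ a deterministic transformation from $A$ to some $BX$ and $\{e_i\}$ an observation-test on $X$. A channel is a deterministic (one-outcome-test) transformation; it is reversible if it has an inverse channel. A transformation $\mathcal T$ is pure if whenever $\mathcal T=\sum_{i\in X_0}\mathcal D_i$ with $X_0\subseteq X$ and $\{\mathcal D_i\}_{i\in X}$ a test, every $\mathcal D_i$, $i\in X_0$, is a multiple of $\mathcal T$. Causality: every system has a unique deterministic effect $u_A$; the marginal on $A$ of a state of $AB$ is obtained by applying $u_B$. A state is normalised if $(u|\rho)=1$. Tests may be chosen conditionally on earlier outcomes and randomised, so normalised states form a convex set; every nonzero state is a multiple of a normalised one. A sharp theory with purification is a causal OPT satisfying: Purity Preservation (sequential and parallel compositions of pure transformations are pure); Pure Sharpness (for every system there is a pure effect $a$ and a state $\rho$ with $(a|\rho)=1$); Purification (every normalised state $\rho$ of $A$ is the marginal of a normalised pure state of some composite $AB$, and if two normalised pure states $\Psi,\Psi'$ of $AB$ have the same marginal on $A$ then $\Psi'=(\mathcal I_A\otimes\mathcal U)\Psi$ for a reversible channel $\mathcal U$ on $B$). Normalised states $\{\rho_i\}$ are perfectly distinguishable if there is an observation-test $\{a_i\}$ with $(a_i|\rho_j)=\delta_{ij}$. A pure maximal set is a set of perfectly distinguishable normalised pure states to which no state can be added keeping perfect distinguishability; in sharp theories with purification all pure maximal sets of a system have the same cardinality $d$. Unrestricted reversibility: the theory satisfies one (equivalently, in sharp theories with purification, all) of: Permutability (every permutation of every pure maximal set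 can be implemented by a reversible channel); Strong Symmetry (for every two pure maximal sets $\{\varphi_i\}_{i=1}^d$, $\{\psi_i\}_{i=1}^d$ of a system there is a reversible channel $\mathcal U$ with $\mathcal U\varphi_i=\psi_i$ for all $i$); Reversible Controllability (for all systems $A,B$, every pure maximal set $\{\alpha_i\}_{i=1}^d$ of $A$ and all reversible channels $\{\mathcal U_i\}_{i=1}^d$ on $B$ there is a reversible channel $\mathcal U$ on $AB$ with $\mathcal U(\alpha_i\otimes\mathcal I_B)=\alpha_i\otimes\mathcal U_i$ for every $i$). A RaRe channel on a system is a channel $\sum_ip_i\,\mathcal U_i$ with $\{p_i\}$ a probability distribution and $\mathcal U_i$ reversible channels on that system. An LOCC channel on $AB$ is obtained from finitely many rounds in which one party performs a test on its own system (possibly changing its local system), the test being chosen depending on the outcomes of all previous rounds, followed by coarse-graining over all outcomes, e.g. $\sum_{j_1,j_2,j_3}\mathcal A^{(j_1,j_2)}_{j_3}\mathcal A_{j_1}\otimes\mathcal B^{(j_1)}_{j_2}$. *)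

theory Defs
  imports "HOL-Analysis.Analysis"
begin

text \<open>
  Systems are the elements of a monoid: \<open>A * B\<close> is the composite system and \<open>1\<close> the trivial one.

  The real vector spaces spanned by the transformations from \<open>A\<close> to \<open>B\<close>, for all \<open>A\<close> and \<open>B\<close>, are
  taken inside one ambient space \<open>'t\<close>; their direct sum can always serve as \<open>'t\<close>. A sum of
  transformations (coarse-graining) is then a sum in \<open>'t\<close>. In the direct sum, sequential and
  parallel composition extend to bilinear operations (with value 0 on components that cannot be
  composed). The norm of \<open>'t\<close> only provides a topology: on each finite-dimensional subspace it
  induces the usual one.

  A family indexed by a finite set of outcomes is a list, the outcomes being its positions.
  \<open>C \<cdot> D\<close> is \<open>C\<close> after \<open>D\<close>.
\<close>

record ('s, 't) op_theory =
  tests :: "'s \<Rightarrow> 's \<Rightarrow> 't list set"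
  ident :: "'s \<Rightarrow> 't"  ("\<I>\<index>")
  swap :: "'s \<Rightarrow> 's \<Rightarrow> 't"
  seq :: "'t \<Rightarrow> 't \<Rightarrow> 't"  (infixl "\<cdot>\<index>" 70)
  par :: "'t \<Rightarrow> 't \<Rightarrow> 't"  (infixl "\<otimes>\<index>" 75)

context
  fixes T :: "('s::monoid_mult, 't::real_normed_vector) op_theory" (structure)
begin

definition transf :: "'s \<Rightarrow> 's \<Rightarrow> 't set" where
  "transf A B = (\<Union>cs\<in>tests T A B. set cs)"

definition states :: "'s \<Rightarrow> 't set" where
  "states A = transf 1 A"

definition effects :: "'s \<Rightarrow> 't set" where
  "effects A = transf A 1"

text \<open>The pairing \<open>(a|\<rho>)\<close>; transformations of the trivial system are multiples of its identity.\<close>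

definition prob :: "'t \<Rightarrow> 't \<Rightarrow> real" where
  "prob a \<rho> = (THE p. a \<cdot> \<rho> = p *\<^sub>R \<I> 1)"

definition channels :: "'s \<Rightarrow> 's \<Rightarrow> 't set" where
  "channels A B = {C. [C] \<in> tests T A B}"

definition reversible :: "'s \<Rightarrow> 's \<Rightarrow> 't set" where
  "reversible A B =
     {U \<in> channels A B. \<exists>V \<in> channels B A. V \<cdot> U = \<I> A \<and> U \<cdot> V = \<I> B}"

definition discard :: "'s \<Rightarrow> 't" where
  "discard A = (THE u. u \<in> channels A 1)"

definition normalised :: "'s \<Rightarrow> 't set" where
  "normalised A = {\<rho> \<in> states A. prob (discard A) \<rho> = 1}"

definition marginal1 :: "'s \<Rightarrow> 's \<Rightarrow> 't \<Rightarrow> 't" where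
  "marginal1 A B \<Psi> = (\<I> A \<otimes> discard B) \<cdot> \<Psi>"

definition marginal2 :: "'s \<Rightarrow> 's \<Rightarrow> 't \<Rightarrow> 't" where
  "marginal2 A B \<Psi> = (discard A \<otimes> \<I> B) \<cdot> \<Psi>"

definition pure :: "'s \<Rightarrow> 's \<Rightarrow> 't set" where
  "pure A B = {C \<in> transf A B.
     \<forall>cs \<in> tests T A B. \<forall>X\<^sub>0 \<subseteq> {..<length cs}.
       C = (\<Sum>i\<in>X\<^sub>0. cs ! i) \<longrightarrow> (\<forall>i\<in>X\<^sub>0. \<exists>c. cs ! i = c *\<^sub>R C)}"

definition pure_states :: "'s \<Rightarrow> 't set" where
  "pure_states A = pure 1 A \<inter> normalised A"

definition perfectly_distinguishable :: "'s \<Rightarrow> 't list \<Rightarrow> bool" where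
  "perfectly_distinguishable A \<rho>s \<longleftrightarrow>
     set \<rho>s \<subseteq> normalised A \<and>
     (\<exists>as \<in> tests T A 1. length as = length \<rho>s \<and>
        (\<forall>i<length \<rho>s. \<forall>j<length \<rho>s. prob (as ! i) (\<rho>s ! j) = (if i = j then 1 else 0)))"

definition pure_maximal :: "'s \<Rightarrow> 't list \<Rightarrow> bool" where
  "pure_maximal A \<phi>s \<longleftrightarrow>
     set \<phi>s \<subseteq> pure_states A \<and> perfectly_distinguishable A \<phi>s \<and>
     \<not> (\<exists>\<sigma>. perfectly_distinguishable A (\<phi>s @ [\<sigma>]))"

definition permutability :: bool where
  "permutability \<longleftrightarrow>
     (\<forall>A \<phi>s \<pi>. pure_maximal A \<phi>s \<and> \<pi> permutes {..<length \<phi>s} \<longrightarrow>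
        (\<exists>U \<in> reversible A A. \<forall>i<length \<phi>s. U \<cdot> \<phi>s ! i = \<phi>s ! \<pi> i))"

definition strong_symmetry :: bool where
  "strong_symmetry \<longleftrightarrow>
     (\<forall>A \<phi>s \<psi>s. pure_maximal A \<phi>s \<and> pure_maximal A \<psi>s \<and> length \<phi>s = length \<psi>s \<longrightarrow>
        (\<exists>U \<in> reversible A A. \<forall>i<length \<phi>s. U \<cdot> \<phi>s ! i = \<psi>s ! i))"

definition reversible_controllability :: bool where
  "reversible_controllability \<longleftrightarrow>
     (\<forall>A B \<alpha>s Us. pure_maximal A \<alpha>s \<and> length Us = length \<alpha>s \<and> set Us \<subseteq> reversible B B \<longrightarrow>
        (\<exists>U \<in> reversible (A * B) (A * B).
           \<forall>i<length \<alpha>s. U \<cdot> (\<alpha>s ! i \<otimes> \<I> B) = \<alpha>s ! i \<otimes> Us ! i))"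

definition unrestricted_reversibility :: bool where
  "unrestricted_reversibility \<longleftrightarrow>
     permutability \<or> strong_symmetry \<or> reversible_controllability"

definition rare_channels :: "'s \<Rightarrow> 't set" where
  "rare_channels A = {R \<in> channels A A.
     \<exists>ps Us. length ps = length Us \<and> (\<forall>p\<in>set ps. 0 \<le> p) \<and> sum_list ps = 1 \<and>
       set Us \<subseteq> reversible A A \<and> R = (\<Sum>i<length Us. ps ! i *\<^sub>R Us ! i)}"

text \<open>
  \<open>locc_test A B A' B' ts\<close>: \<open>ts\<close> lists the transformations from \<open>A * B\<close> to \<open>A' * B'\<close> attached to the
  outcome histories of a protocol. In the last two rules \<open>cs\<close> is the test of the first round and
  \<open>ls ! i\<close> the rest of the protocol after outcome \<open>i\<close>.
\<close>

inductive locc_test :: "'s \<Rightarrow> 's \<Rightarrow> 's \<Rightarrow> 's \<Rightarrow> 't list \<Rightarrow> bool" where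
  stop: "locc_test A B A B [\<I> (A * B)]"
| round1: "\<lbrakk>cs \<in> tests T A A\<^sub>1; length ls = length cs; \<forall>ts\<in>set ls. locc_test A\<^sub>1 B A' B' ts\<rbrakk>
    \<Longrightarrow> locc_test A B A' B' (concat (map2 (\<lambda>c. map (\<lambda>t. t \<cdot> (c \<otimes> \<I> B))) cs ls))"
| round2: "\<lbrakk>cs \<in> tests T B B\<^sub>1; length ls = length cs; \<forall>ts\<in>set ls. locc_test A B\<^sub>1 A' B' ts\<rbrakk>
    \<Longrightarrow> locc_test A B A' B' (concat (map2 (\<lambda>c. map (\<lambda>t. t \<cdot> (\<I> A \<otimes> c))) cs ls))"

definition locc_channels :: "'s \<Rightarrow> 's \<Rightarrow> 't set" where
  "locc_channels A B = {sum_list ts | ts. locc_test A B A B ts}"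

end

locale opt =
  fixes T :: "('s::monoid_mult, 't::real_normed_vector) op_theory" (structure)
  assumes bilinear_seq: "bilinear (seq T)"
    and bilinear_par: "bilinear (par T)"
    \<comment> \<open>strict symmetric monoidal category\<close>
    and ident_test: "[\<I> A] \<in> tests T A A"
    and swap_test: "[swap T A B] \<in> tests T (A * B) (B * A)"
    and seq_ident_right: "C \<in> transf T A B \<Longrightarrow> C \<cdot> \<I> A = C"
    and seq_ident_left: "C \<in> transf T A B \<Longrightarrow> \<I> B \<cdot> C = C"
    and seq_assoc: "\<lbrakk>C \<in> transf T A A'; D \<in> transf T A' A''; E \<in> transf T A'' A'''\<rbrakk>
          \<Longrightarrow> (E \<cdot> D) \<cdot> C = E \<cdot> (D \<cdot> C)"
    and par_unit_right: "C \<in> transf T A B \<Longrightarrow> C \<otimes> \<I> 1 = C"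
    and par_unit_left: "C \<in> transf T A B \<Longrightarrow> \<I> 1 \<otimes> C = C"
    and par_assoc: "\<lbrakk>C \<in> transf T A B; D \<in> transf T A' B'; E \<in> transf T A'' B''\<rbrakk>
          \<Longrightarrow> (C \<otimes> D) \<otimes> E = C \<otimes> (D \<otimes> E)"
    and par_ident: "\<I> A \<otimes> \<I> B = \<I> (A * B)"
    and interchange: "\<lbrakk>C \<in> transf T A\<^sub>1 A\<^sub>2; D \<in> transf T A\<^sub>2 A\<^sub>3; E \<in> transf T B\<^sub>1 B\<^sub>2; F \<in> transf T B\<^sub>2 B\<^sub>3\<rbrakk>
          \<Longrightarrow> (D \<otimes> F) \<cdot> (C \<otimes> E) = (D \<cdot> C) \<otimes> (F \<cdot> E)"
    and swap_natural: "\<lbrakk>C \<in> transf T A B; D \<in> transf T A' B'\<rbrakk>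
          \<Longrightarrow> swap T B B' \<cdot> (C \<otimes> D) = (D \<otimes> C) \<cdot> swap T A A'"
    and swap_swap: "swap T B A \<cdot> swap T A B = \<I> (A * B)"
    and swap_hexagon: "swap T A (B * B') = (\<I> B \<otimes> swap T A B') \<cdot> (swap T A B \<otimes> \<I> B')"
    \<comment> \<open>closure of tests; the second test of a sequence may depend on the outcome of the first\<close>
    and seq_test: "\<lbrakk>cs \<in> tests T A A'; length dss = length cs; set dss \<subseteq> tests T A' A''\<rbrakk>
          \<Longrightarrow> concat (map2 (\<lambda>c. map (\<lambda>d. d \<cdot> c)) cs dss) \<in> tests T A A''"
    and par_test: "\<lbrakk>cs \<in> tests T A B; ds \<in> tests T A' B'\<rbrakk>
          \<Longrightarrow> [c \<otimes> d. c \<leftarrow> cs, d \<leftarrow> ds] \<in> tests T (A * A') (B * B')"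
    \<comment> \<open>the blocks of the partition are the fibres of \<open>f\<close>\<close>
    and coarse_graining: "\<lbrakk>cs \<in> tests T A B; f ` {..<length cs} = {..<m}\<rbrakk>
          \<Longrightarrow> map (\<lambda>k. \<Sum>i | i < length cs \<and> f i = k. cs ! i) [0..<m] \<in> tests T A B"
    \<comment> \<open>numbers\<close>
    and ident_unit_nonzero: "\<I> 1 \<noteq> 0"
    and unit_tests: "tests T 1 1 =
          {map (\<lambda>p. p *\<^sub>R \<I> 1) ps | ps. (\<forall>p\<in>set ps. 0 \<le> p) \<and> sum_list ps = 1}"
    \<comment> \<open>operational equality\<close>
    and state_eqI: "\<lbrakk>\<rho> \<in> states T A; \<sigma> \<in> states T A; \<forall>a \<in> effects T A. prob T a \<rho> = prob T a \<sigma>\<rbrakk>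
          \<Longrightarrow> \<rho> = \<sigma>"
    and effect_eqI: "\<lbrakk>a \<in> effects T A; b \<in> effects T A; \<forall>\<rho> \<in> states T A. prob T a \<rho> = prob T b \<rho>\<rbrakk>
          \<Longrightarrow> a = b"
    and transf_eqI: "\<lbrakk>C \<in> transf T A B; C' \<in> transf T A B;
            \<forall>S. \<forall>\<rho> \<in> states T (A * S). (C \<otimes> \<I> S) \<cdot> \<rho> = (C' \<otimes> \<I> S) \<cdot> \<rho>\<rbrakk>
          \<Longrightarrow> C = C'"
    and finite_dimensional: "\<exists>F. finite F \<and> transf T A B \<subseteq> span F"
    and closed_transf: "closed (transf T A B)"
    and test_dilation: "cs \<in> tests T A B \<Longrightarrow>
          \<exists>X. \<exists>D \<in> channels T A (B * X). \<exists>es \<in> tests T X 1. length es = length cs \<and>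
            (\<forall>i<length cs. cs ! i = (\<I> B \<otimes> es ! i) \<cdot> D)"

locale causal_opt = opt +
  assumes causality: "\<exists>!u. u \<in> channels T A 1"
    and state_rescaling: "\<lbrakk>\<rho> \<in> states T A; \<rho> \<noteq> 0\<rbrakk> \<Longrightarrow> \<exists>c. \<exists>\<sigma> \<in> normalised T A. \<rho> = c *\<^sub>R \<sigma>"

locale sharp_theory_with_purification = causal_opt +
  assumes purity_seq: "\<lbrakk>C \<in> pure T A A'; D \<in> pure T A' A''\<rbrakk> \<Longrightarrow> D \<cdot> C \<in> pure T A A''"
    and purity_par: "\<lbrakk>C \<in> pure T A A'; D \<in> pure T B B'\<rbrakk> \<Longrightarrow> C \<otimes> D \<in> pure T (A * B) (A' * B')"
    and pure_sharpness: "\<exists>a \<in> pure T A 1. \<exists>\<rho> \<in> states T A. prob T a \<rho> = 1"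
    and purification: "\<rho> \<in> normalised T A \<Longrightarrow>
          \<exists>B. \<exists>\<Psi> \<in> pure_states T (A * B). marginal1 T A B \<Psi> = \<rho>"
    and purification_unique: "\<lbrakk>\<Psi> \<in> pure_states T (A * B); \<Psi>' \<in> pure_states T (A * B);
            marginal1 T A B \<Psi> = marginal1 T A B \<Psi>'\<rbrakk>
          \<Longrightarrow> \<exists>U \<in> reversible T B B. \<Psi>' = (\<I> A \<otimes> U) \<cdot> \<Psi>"

end

theory Submission
  imports Defs
begin

text \<open>
  Steering: since a pure state determines its purifications up to reversible channels, every ensemble
  with the marginal of a pure state \<open>\<Psi>\<close> of \<open>A * B\<close> is prepared by a test on \<open>B\<close>. With a
  full-rank marginal, \<open>\<Psi>\<close> even determines transformations.

  Schmidt decomposition: by compactness of the group of reversible channels each marginal has a pure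
  component of maximal weight; by sharpness the two marginals then share this weight, and
  removing the two components leaves the marginals of another pure state. Hence both marginals are
  mixtures of perfectly distinguishable pure states \<open>\<alpha>\<^sub>i\<close>, \<open>\<beta>\<^sub>i\<close> with the same weights.
  Permuting the products \<open>\<alpha>\<^sub>i \<otimes> \<beta>\<^sub>j\<close> by a reversible channel yields local channels that exchange
  the two parts of \<open>\<Psi>\<close>.

  Local exchange lets the second party simulate every action of the first, so an LOCC conversion
  of \<open>\<Psi>\<close> into \<open>\<Phi>\<close> becomes a test on \<open>B\<close> followed by channels on \<open>A\<close>. Each channel maps a pure
  state to \<open>\<Phi>\<close> without changing the marginal on \<open>B\<close>, hence acts on it as a reversible one, and
  inverting these exhibits the marginal of \<open>\<Psi>\<close> on \<open>A\<close> as a RaRe image of that of \<open>\<Phi>\<close>. Steering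
  gives the converse.
\<close>

section \<open>Composition of tests\<close>

text \<open>Exchanging the local states works for pure states only, whereas a test in the middle of
  a protocol may leave mixed ones. Every round is therefore refined into pure components. This does
  not spoil the conversion: the target \<open>\<Phi>\<close> is pure, so whatever is sent to a
  multiple of \<open>\<Phi>\<close> has only components with the same property. The invariant
  carried through a protocol is \<open>one_way\<close>.

  Unrestricted reversibility enters through \<open>local_exchange\<close> alone: for replacing the
  actions of the first party, and for interchanging the two parties when the criterion on
  \<open>A\<close> is carried over to \<open>B\<close>. The hypothesis is a disjunction; strong
  symmetry is reduced to permutability, and \<open>product_exchange\<close> treats permutability and
  controllability separately.

  Composition is only assumed bilinear on the ambient space, not continuous, so limits are taken in
  coordinates; the functionals that bound the coordinates are outcome probabilities. Sums over
  blocks of outcomes need some care too, because the labelling of a coarse-graining has to be onto;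
  outcomes that never occur are added for the empty blocks.\<close>

context opt
begin

lemmas seq_add_left = bilinear_ladd[OF bilinear_seq]
  and seq_add_right = bilinear_radd[OF bilinear_seq]
  and seq_scale_left = bilinear_lmul[OF bilinear_seq]
  and seq_scale_right = bilinear_rmul[OF bilinear_seq]
  and seq_zero_left = bilinear_lzero[OF bilinear_seq]
  and seq_zero_right = bilinear_rzero[OF bilinear_seq]
  and seq_diff_left = bilinear_lsub[OF bilinear_seq]
  and seq_diff_right = bilinear_rsub[OF bilinear_seq]
  and par_add_left = bilinear_ladd[OF bilinear_par]
  and par_add_right = bilinear_radd[OF bilinear_par]
  and par_scale_left = bilinear_lmul[OF bilinear_par]
  and par_scale_right = bilinear_rmul[OF bilinear_par]
  and par_zero_left = bilinear_lzero[OF bilinear_par]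
  and par_zero_right = bilinear_rzero[OF bilinear_par]
  and par_diff_left = bilinear_lsub[OF bilinear_par]
  and par_diff_right = bilinear_rsub[OF bilinear_par]

lemmas lin_simps = seq_add_left seq_add_right seq_scale_left seq_scale_right seq_zero_left
  seq_zero_right seq_diff_left seq_diff_right par_add_left par_add_right par_scale_left
  par_scale_right par_zero_left par_zero_right par_diff_left par_diff_right

lemma linear_seq_right: "linear (\<lambda>x. C \<cdot> x)" and linear_seq_left: "linear (\<lambda>x. x \<cdot> C)"
  and linear_par_right: "linear (\<lambda>x. C \<otimes> x)" and linear_par_left: "linear (\<lambda>x. x \<otimes> C)"
  using bilinear_seq bilinear_par by (auto simp: bilinear_def)

lemma seq_sum_right: "C \<cdot> (\<Sum>i\<in>S. x i) = (\<Sum>i\<in>S. C \<cdot> x i)"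
  and seq_sum_left: "(\<Sum>i\<in>S. x i) \<cdot> C = (\<Sum>i\<in>S. x i \<cdot> C)"
  and par_sum_right: "C \<otimes> (\<Sum>i\<in>S. x i) = (\<Sum>i\<in>S. C \<otimes> x i)"
  and par_sum_left: "(\<Sum>i\<in>S. x i) \<otimes> C = (\<Sum>i\<in>S. x i \<otimes> C)"
  using linear_sum[OF linear_seq_right] linear_sum[OF linear_seq_left]
    linear_sum[OF linear_par_right] linear_sum[OF linear_par_left] by auto

lemma seq_sum_list_right: "C \<cdot> sum_list xs = (\<Sum>x\<leftarrow>xs. C \<cdot> x)"
  and seq_sum_list_left: "sum_list xs \<cdot> C = (\<Sum>x\<leftarrow>xs. x \<cdot> C)"
  and par_sum_list_left: "sum_list xs \<otimes> C = (\<Sum>x\<leftarrow>xs. x \<otimes> C)"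
  and par_sum_list_right: "C \<otimes> sum_list xs = (\<Sum>x\<leftarrow>xs. C \<otimes> x)"
  by (induction xs) (auto simp: lin_simps)

lemma transf_I: "\<lbrakk>cs \<in> tests T A B; c \<in> set cs\<rbrakk> \<Longrightarrow> c \<in> transf T A B"
  by (auto simp: transf_def)

lemma transf_nth: "\<lbrakk>cs \<in> tests T A B; i < length cs\<rbrakk> \<Longrightarrow> cs ! i \<in> transf T A B"
  by (rule transf_I) auto

lemma channels_iff: "C \<in> channels T A B \<longleftrightarrow> [C] \<in> tests T A B"
  by (simp add: channels_def)

lemma channel_transf: "C \<in> channels T A B \<Longrightarrow> C \<in> transf T A B"
  unfolding channels_iff by (rule transf_I[of "[C]"]) auto

lemma ident_channel: "\<I> A \<in> channels T A A"
  and swap_channel: "swap T A B \<in> channels T (A * B) (B * A)"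
  using ident_test swap_test by (auto simp: channels_iff)

lemmas ident_transf = channel_transf[OF ident_channel]
  and swap_transf = channel_transf[OF swap_channel]

lemma test_seq: "\<lbrakk>cs \<in> tests T A B; ds \<in> tests T B C\<rbrakk>
    \<Longrightarrow> concat (map (\<lambda>c. map (\<lambda>d. d \<cdot> c) ds) cs) \<in> tests T A C"
proof -
  assume a: "cs \<in> tests T A B" "ds \<in> tests T B C"
  have "concat (map2 (\<lambda>c. map (\<lambda>d. d \<cdot> c)) cs (replicate (length cs) ds)) \<in> tests T A C"
    by (rule seq_test[OF a(1)]) (use a in auto)
  moreover have "map2 (\<lambda>c. map (\<lambda>d. d \<cdot> c)) cs (replicate (length cs) ds)
      = map (\<lambda>c. map (\<lambda>d. d \<cdot> c) ds) cs"
    by (induction cs) auto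
  ultimately show ?thesis by simp
qed

lemma test_post: "\<lbrakk>cs \<in> tests T A B; D \<in> channels T B C\<rbrakk> \<Longrightarrow> map (\<lambda>c. D \<cdot> c) cs \<in> tests T A C"
  using test_seq[of cs A B "[D]" C] by (simp add: channels_iff)

lemma test_pre: "\<lbrakk>C \<in> channels T A A'; ds \<in> tests T A' B\<rbrakk> \<Longrightarrow> map (\<lambda>d. d \<cdot> C) ds \<in> tests T A B"
  using test_seq[of "[C]" A A' ds B] by (simp add: channels_iff)

lemma test_par_left: "\<lbrakk>cs \<in> tests T A B; D \<in> channels T A' B'\<rbrakk>
    \<Longrightarrow> map (\<lambda>c. c \<otimes> D) cs \<in> tests T (A * A') (B * B')"
  using par_test[of cs A B "[D]" A' B'] by (simp add: channels_iff)

lemma test_par_right: "\<lbrakk>C \<in> channels T A B; ds \<in> tests T A' B'\<rbrakk>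
    \<Longrightarrow> map (\<lambda>d. C \<otimes> d) ds \<in> tests T (A * A') (B * B')"
  using par_test[of "[C]" A B ds A' B'] by (simp add: channels_iff)

lemma seq_channel: "\<lbrakk>C \<in> channels T A B; D \<in> channels T B B'\<rbrakk> \<Longrightarrow> D \<cdot> C \<in> channels T A B'"
  using test_pre[of C A B "[D]" B'] by (simp add: channels_iff)

lemma par_channel: "\<lbrakk>C \<in> channels T A B; D \<in> channels T A' B'\<rbrakk> \<Longrightarrow> C \<otimes> D \<in> channels T (A * A') (B * B')"
  using test_par_left[of "[C]" A B D A' B'] by (simp add: channels_iff)

lemma seq_transf: "\<lbrakk>C \<in> transf T A B; D \<in> transf T B B'\<rbrakk> \<Longrightarrow> D \<cdot> C \<in> transf T A B'"
proof -
  assume "C \<in> transf T A B" "D \<in> transf T B B'"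
  then obtain cs ds where "cs \<in> tests T A B" "C \<in> set cs" "ds \<in> tests T B B'" "D \<in> set ds"
    by (auto simp: transf_def)
  with test_seq[of cs A B ds B'] show ?thesis
    by (intro transf_I) (auto intro!: bexI[of _ C])
qed

lemma par_transf: "\<lbrakk>C \<in> transf T A B; D \<in> transf T A' B'\<rbrakk> \<Longrightarrow> C \<otimes> D \<in> transf T (A * A') (B * B')"
proof -
  assume "C \<in> transf T A B" "D \<in> transf T A' B'"
  then obtain cs ds where "cs \<in> tests T A B" "C \<in> set cs" "ds \<in> tests T A' B'" "D \<in> set ds"
    by (auto simp: transf_def)
  with par_test[of cs A B ds A' B'] show ?thesis
    by (intro transf_I) (auto intro!: bexI[of _ C])
qed

lemma par_seq:
  assumes "C \<in> transf T A A'" "E \<in> transf T A' A''" "D \<in> transf T B B'" "F \<in> transf T B' B''"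
    and "\<Psi> \<in> transf T Z (A * B)"
  shows "(E \<otimes> F) \<cdot> ((C \<otimes> D) \<cdot> \<Psi>) = ((E \<cdot> C) \<otimes> (F \<cdot> D)) \<cdot> \<Psi>"
proof -
  have "(E \<otimes> F) \<cdot> ((C \<otimes> D) \<cdot> \<Psi>) = ((E \<otimes> F) \<cdot> (C \<otimes> D)) \<cdot> \<Psi>"
    by (rule seq_assoc[symmetric]) (use assms par_transf in blast)+
  also have "(E \<otimes> F) \<cdot> (C \<otimes> D) = (E \<cdot> C) \<otimes> (F \<cdot> D)"
    by (rule interchange) (use assms in blast)+
  finally show ?thesis .
qed

text \<open>The hexagon with both right-hand factors trivial makes \<open>swap T A 1\<close>
  idempotent, and \<open>swap_swap\<close> gives it a left inverse; an idempotent with a left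
  inverse is the identity.\<close>

lemma swap_unit_right: "swap T A 1 = \<I> A" and swap_unit_left: "swap T 1 A = \<I> A"
proof -
  have t: "swap T A 1 \<in> transf T A A" "swap T 1 A \<in> transf T A A"
    using swap_transf[of A 1] swap_transf[of 1 A] by simp_all
  have "swap T A 1 = (\<I> 1 \<otimes> swap T A 1) \<cdot> (swap T A 1 \<otimes> \<I> 1)"
    using swap_hexagon[of A 1 1] by simp
  also have "\<dots> = swap T A 1 \<cdot> swap T A 1"
    using par_unit_left[OF t(1)] par_unit_right[OF t(1)] by simp
  finally have idem: "swap T A 1 \<cdot> swap T A 1 = swap T A 1" by simp
  have inv: "swap T 1 A \<cdot> swap T A 1 = \<I> A" using swap_swap[of 1 A] by simp
  have "swap T 1 A \<cdot> (swap T A 1 \<cdot> swap T A 1) = (swap T 1 A \<cdot> swap T A 1) \<cdot> swap T A 1"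
    using seq_assoc[OF t(1) t(1) t(2)] by simp
  then show "swap T A 1 = \<I> A" using idem inv seq_ident_left[OF t(1)] by simp
  then show "swap T 1 A = \<I> A" using inv seq_ident_right[OF t(2)] by simp
qed

lemma swap_states:
  assumes "\<rho> \<in> transf T 1 A" "\<sigma> \<in> transf T 1 B"
  shows "swap T A B \<cdot> (\<rho> \<otimes> \<sigma>) = \<sigma> \<otimes> \<rho>"
proof -
  have "\<sigma> \<otimes> \<rho> \<in> transf T 1 (B * A)" using par_transf[OF assms(2,1)] by simp
  then show ?thesis
    using swap_natural[OF assms] seq_ident_right[of "\<sigma> \<otimes> \<rho>" 1 "B * A"] swap_unit_left[of 1] by simp
qed

text \<open>A linear functional extending the pairing: unlike \<open>prob\<close>, it is additive on all of the ambient
  space.\<close>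

definition scal :: "'t \<Rightarrow> real" where
  "scal = (SOME f. linear f \<and> f (\<I> 1) = 1)"

lemma linear_scal: "linear scal" and scal_ident: "scal (\<I> 1) = 1"
proof -
  have "\<exists>f. linear f \<and> (\<forall>x\<in>{\<I> 1}. f x = (1::real))"
    by (rule linear_independent_extend) (simp add: ident_unit_nonzero)
  then have "\<exists>f::'t \<Rightarrow> real. linear f \<and> f (\<I> 1) = 1" by auto
  from someI_ex[OF this] show "linear scal" "scal (\<I> 1) = 1" by (auto simp: scal_def)
qed

lemmas scal_simps = linear_add[OF linear_scal] linear_scale[OF linear_scal] linear_0[OF linear_scal]
  linear_diff[OF linear_scal] scal_ident

lemma transf_unit: "transf T 1 1 = {p *\<^sub>R \<I> 1 | p. 0 \<le> p \<and> p \<le> 1}"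
proof -
  have *: "p \<le> sum_list ps" if "p \<in> set ps" "\<forall>p\<in>set ps. 0 \<le> p" for p :: real and ps
    using that by (induction ps) (auto simp: sum_list_nonneg add_increasing add_increasing2)
  have "p *\<^sub>R \<I> 1 \<in> transf T 1 1" if "0 \<le> p" "p \<le> 1" for p
  proof (rule transf_I)
    have "map (\<lambda>p. p *\<^sub>R \<I> 1) [p, 1 - p] \<in> tests T 1 1"
      unfolding unit_tests using that by (intro CollectI exI[of _ "[p, 1 - p]"]) auto
    then show "[p *\<^sub>R \<I> 1, (1 - p) *\<^sub>R \<I> 1] \<in> tests T 1 1" by simp
  qed auto
  moreover have "\<exists>p. x = p *\<^sub>R \<I> 1 \<and> 0 \<le> p \<and> p \<le> 1" if x: "x \<in> transf T 1 1" for x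
  proof -
    obtain ps p where "x = p *\<^sub>R \<I> 1" "p \<in> set ps" "\<forall>p\<in>set ps. 0 \<le> p" "sum_list ps = 1"
      using x unfolding transf_def unit_tests by (auto simp del: scaleR_cancel_right)
    then show ?thesis using *[of p ps] by auto
  qed
  ultimately show ?thesis by blast
qed

lemma unit_eq_scal: "x \<in> transf T 1 1 \<Longrightarrow> x = scal x *\<^sub>R \<I> 1"
  and scal_nonneg: "x \<in> transf T 1 1 \<Longrightarrow> 0 \<le> scal x"
  and scal_le_1: "x \<in> transf T 1 1 \<Longrightarrow> scal x \<le> 1"
  by (auto simp: transf_unit scal_simps)

lemma prob_eq_scal: "a \<cdot> \<rho> \<in> transf T 1 1 \<Longrightarrow> prob T a \<rho> = scal (a \<cdot> \<rho>)"
  unfolding prob_def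
  by (rule the_equality, erule unit_eq_scal) (simp add: scal_simps)

lemma prob_scal: "\<lbrakk>a \<in> effects T A; \<rho> \<in> states T A\<rbrakk> \<Longrightarrow> prob T a \<rho> = scal (a \<cdot> \<rho>)"
  by (rule prob_eq_scal) (auto simp: effects_def states_def intro: seq_transf)

lemma seq_effect_state:
  "\<lbrakk>a \<in> transf T A 1; \<rho> \<in> transf T 1 A\<rbrakk> \<Longrightarrow> a \<cdot> \<rho> = scal (a \<cdot> \<rho>) *\<^sub>R \<I> 1"
  by (rule unit_eq_scal) (rule seq_transf)

text \<open>A probability distribution is a test of the trivial system; tensored with the identity
  it becomes a coin tossed beside \<open>A\<close>.\<close>

lemma random_test:
  assumes "\<forall>p\<in>set ps. 0 \<le> p" "sum_list ps = 1"
  shows "map (\<lambda>p. p *\<^sub>R \<I> A) ps \<in> tests T A A"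
proof -
  have "map (\<lambda>p. p *\<^sub>R \<I> 1) ps \<in> tests T 1 1" using assms by (auto simp: unit_tests)
  from test_par_right[OF ident_channel this, of A]
  show ?thesis by (simp add: lin_simps par_unit_right[OF ident_transf] comp_def)
qed

text \<open>The outcome of the coin in \<open>random_test\<close> selects the channel, by the
  conditional composition \<open>seq_test\<close>.\<close>

lemma random_channels:
  assumes "length ps = length Cs" "\<forall>p\<in>set ps. 0 \<le> p" "sum_list ps = 1" "set Cs \<subseteq> channels T A B"
  shows "map2 (\<lambda>p C. p *\<^sub>R C) ps Cs \<in> tests T A B"
proof -
  let ?ps = "map (\<lambda>p. p *\<^sub>R \<I> A) ps" and ?Cs = "map (\<lambda>C. [C]) Cs"
  have "concat (map2 (\<lambda>c. map (\<lambda>d. d \<cdot> c)) ?ps ?Cs) \<in> tests T A B"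
    by (rule seq_test[OF random_test]) (use assms in \<open>auto simp: channels_iff\<close>)
  also have "concat (map2 (\<lambda>c. map (\<lambda>d. d \<cdot> c)) ?ps ?Cs) = map2 (\<lambda>p C. p *\<^sub>R C) ps Cs"
    using assms(1,4)
  proof (induction ps Cs rule: list_induct2)
    case (Cons p ps C Cs)
    then have "C \<cdot> \<I> A = C" using seq_ident_right[OF channel_transf, of C A B] by simp
    with Cons show ?case by (simp add: lin_simps)
  qed simp
  finally show ?thesis .
qed

lemma scale_transf:
  assumes "C \<in> transf T A B" "0 \<le> p" "p \<le> 1"
  shows "p *\<^sub>R C \<in> transf T A B"
proof -
  have "map (\<lambda>p. p *\<^sub>R \<I> A) [p, 1 - p] \<in> tests T A A"
    by (rule random_test) (use assms in auto)
  then have "p *\<^sub>R \<I> A \<in> transf T A A" by (rule transf_I) simp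
  from seq_transf[OF this assms(1)] show ?thesis
    by (simp add: lin_simps seq_ident_right[OF assms(1)])
qed

text \<open>Splitting the last outcome with probabilities 1 and 0 adds an outcome that never occurs.
  Such outcomes stand for empty blocks, which \<open>coarse_graining\<close> excludes.\<close>

lemma append_zero_test:
  assumes "cs \<in> tests T A B" "cs \<noteq> []"
  shows "cs @ [0] \<in> tests T A B"
proof -
  obtain cs' c where cs: "cs = cs' @ [c]" using assms(2) by (metis rev_exhaust)
  let ?dss = "replicate (length cs') [\<I> B] @ [map (\<lambda>p. p *\<^sub>R \<I> B) [1, 0]]"
  have "concat (map2 (\<lambda>c. map (\<lambda>d. d \<cdot> c)) cs ?dss) \<in> tests T A B"
    by (rule seq_test[OF assms(1)]) (use ident_test random_test[of "[1,0]" B] in \<open>auto simp: cs\<close>)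
  also have "concat (map2 (\<lambda>c. map (\<lambda>d. d \<cdot> c)) cs ?dss) = cs @ [0]"
  proof -
    have *: "concat (map2 (\<lambda>c. map (\<lambda>d. d \<cdot> c)) cs' (replicate (length cs') [\<I> B])) = cs'"
      if "set cs' \<subseteq> transf T A B" for cs'
      using that by (induction cs') (auto simp: seq_ident_left)
    have **: "set cs' \<subseteq> transf T A B" "c \<in> transf T A B"
      using transf_I[OF assms(1)] by (auto simp: cs)
    show ?thesis using *[OF **(1)] **(2) by (simp add: cs lin_simps seq_ident_left)
  qed
  finally show ?thesis .
qed

end

section \<open>Causality and preparation tests\<close>

context sharp_theory_with_purification
begin

abbreviation unit_effect :: "'a \<Rightarrow> 'b" ("\<u>") where "\<u> \<equiv> discard T"

lemma discard_channel: "\<u> A \<in> channels T A 1"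
  unfolding discard_def using causality by (rule theI')

lemmas discard_transf = channel_transf[OF discard_channel]

lemma discard_unique: "C \<in> channels T A 1 \<Longrightarrow> C = \<u> A"
  using causality discard_channel by blast

lemma discard_unit: "\<u> 1 = \<I> 1"
  using discard_unique[OF ident_channel] by simp

lemma discard_seq: "C \<in> channels T A B \<Longrightarrow> \<u> B \<cdot> C = \<u> A"
  by (rule discard_unique, rule seq_channel[OF _ discard_channel])

lemma discard_par: "\<u> (A * B) = \<u> A \<otimes> \<u> B"
  using discard_unique[of "\<u> A \<otimes> \<u> B" "A * B"] par_channel[OF discard_channel[of A] discard_channel[of B]]
  by simp

lemma sum_channel_nonempty:
  assumes "cs \<in> tests T A B" "cs \<noteq> []"
  shows "sum_list cs \<in> channels T A B"
proof -
  have "map (\<lambda>k. \<Sum>i | i < length cs \<and> 0 = k. cs ! i) [0..<1] \<in> tests T A B"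
    by (rule coarse_graining[OF assms(1)]) (use assms(2) in auto)
  moreover have "{i. i < length cs} = {0..<length cs}" by auto
  ultimately show ?thesis by (simp add: channels_iff sum_list_sum_nth)
qed

lemma ex_channel_state: "\<exists>\<rho>. \<rho> \<in> channels T 1 A"
proof -
  obtain cs where "cs \<in> tests T 1 A" "cs \<noteq> []"
    using pure_sharpness[of A] by (fastforce simp: states_def transf_def)
  then show ?thesis using sum_channel_nonempty by blast
qed

text \<open>Preceded by a deterministic state and followed by discarding, an empty test would become
  an empty test of the trivial system, whose probabilities must add up to 1.\<close>

lemma test_nonempty: "cs \<in> tests T A B \<Longrightarrow> cs \<noteq> []"
proof
  assume "cs \<in> tests T A B" "cs = []"
  moreover obtain \<rho> where "\<rho> \<in> channels T 1 A" using ex_channel_state by blast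
  ultimately have "[] \<in> tests T 1 B" using test_pre[of \<rho> 1 A "[]" B] by simp
  then have "[] \<in> tests T 1 1" using test_post[of "[]" 1 B "\<u> B" 1] discard_channel by simp
  then show False by (simp add: unit_tests)
qed

lemma sum_channel: "cs \<in> tests T A B \<Longrightarrow> sum_list cs \<in> channels T A B"
  using sum_channel_nonempty test_nonempty by blast

text \<open>Frees \<open>coarse_graining\<close> from the condition that the labelling be onto, by
  appending \<open>m\<close> zero outcomes.\<close>

lemma coarse_grain:
  assumes cs: "cs \<in> tests T A B" and m: "0 < m" and f: "\<forall>i<length cs. f i < m"
  shows "map (\<lambda>k. \<Sum>i | i < length cs \<and> f i = k. cs ! i) [0..<m] \<in> tests T A B"
proof -
  define n where "n = length cs"
  have app: "cs @ replicate k 0 \<in> tests T A B" for k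
  proof (induction k)
    case (Suc k)
    from append_zero_test[OF Suc test_nonempty[OF Suc]]
    show ?case by (simp add: replicate_append_same)
  qed (simp add: cs)
  \<comment> \<open>Zero number \<open>k\<close> is put into block \<open>k\<close>: no sum changes,
    and every block becomes nonempty.\<close>
  define g where "g i = (if i < n then f i else i - n)" for i
  have img: "g ` {..<length (cs @ replicate m 0)} = {..<m}"
  proof
    show "g ` {..<length (cs @ replicate m 0)} \<subseteq> {..<m}"
      using f m by (auto simp: g_def n_def)
    show "{..<m} \<subseteq> g ` {..<length (cs @ replicate m 0)}"
    proof
      fix k assume "k \<in> {..<m}"
      then show "k \<in> g ` {..<length (cs @ replicate m 0)}"
        by (intro image_eqI[of _ _ "n + k"]) (auto simp: g_def n_def)
    qed
  qed
  have sums: "(\<Sum>i | i < length (cs @ replicate m 0) \<and> g i = k. (cs @ replicate m 0) ! i)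
      = (\<Sum>i | i < length cs \<and> f i = k. cs ! i)" if "k < m" for k
  proof -
    have "{i. i < length (cs @ replicate m 0) \<and> g i = k}
        = insert (n + k) {i. i < n \<and> f i = k}"
      using that by (auto simp: g_def n_def)
    then show ?thesis using that
      by (simp add: n_def nth_append)
  qed
  show ?thesis
  proof -
    have "map (\<lambda>k. \<Sum>i | i < length (cs @ replicate m 0) \<and> g i = k. (cs @ replicate m 0) ! i) [0..<m]
        = map (\<lambda>k. \<Sum>i | i < length cs \<and> f i = k. cs ! i) [0..<m]"
      by (rule map_cong[OF refl], rule sums) simp
    with coarse_graining[OF app img] show ?thesis by (simp only:)
  qed
qed

text \<open>All other outcomes of a test that contains \<open>C\<close> are merged into one. Their
  block may be empty, which is why the labelling is not always onto.\<close>

lemma test_complement: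
  assumes "C \<in> transf T A B"
  shows "\<exists>C'. [C, C'] \<in> tests T A B"
proof -
  obtain cs where cs: "cs \<in> tests T A B" "C \<in> set cs" using assms by (auto simp: transf_def)
  then obtain j where j: "j < length cs" "cs ! j = C" by (auto simp: in_set_conv_nth)
  define f :: "nat \<Rightarrow> nat" where "f i = (if i = j then 0 else 1)" for i
  have "map (\<lambda>k. \<Sum>i | i < length cs \<and> f i = k. cs ! i) [0..<2] \<in> tests T A B"
    by (rule coarse_grain[OF cs(1)]) (auto simp: f_def)
  moreover have "{i. i < length cs \<and> f i = 0} = {j}" using j by (auto simp: f_def)
  ultimately show ?thesis using j by (auto simp: upt_rec[of 0 2] upt_rec[of 1 2] numeral_2_eq_2)
qed

lemma test_pair_sum: "[C, C'] \<in> tests T A B \<Longrightarrow> C + C' \<in> channels T A B"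
  using sum_channel[of "[C, C']"] by simp

lemma test_swap: assumes "[C, C'] \<in> tests T A B" shows "[C', C] \<in> tests T A B"
proof -
  have "map (\<lambda>k. \<Sum>i | i < length [C, C'] \<and> 1 - i = k. [C, C'] ! i) [0..<2] \<in> tests T A B"
    by (rule coarse_grain[OF assms]) auto
  moreover have "{i. i < Suc (Suc 0) \<and> Suc 0 - i = 0} = {1}" "{i. i < Suc (Suc 0) \<and> Suc 0 - i = 1} = {0}"
    by auto
  ultimately show ?thesis by (simp add: upt_rec[of 0 2] upt_rec[of 1 2] numeral_2_eq_2)
qed

section \<open>Weights, normalisation and preparation tests\<close>

definition weight :: "'a \<Rightarrow> 'b \<Rightarrow> real" where
  "weight A x = scal (\<u> A \<cdot> x)"

lemma linear_weight: "linear (weight A)"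
  unfolding weight_def by (intro linearI) (auto simp: lin_simps scal_simps)

lemmas weight_simps = linear_add[OF linear_weight] linear_scale[OF linear_weight]
  linear_0[OF linear_weight] linear_diff[OF linear_weight]

lemma states_eq: "states T A = transf T 1 A" and effects_eq: "effects T A = transf T A 1"
  by (simp_all add: states_def effects_def)

lemma weight_nonneg: "\<rho> \<in> states T A \<Longrightarrow> 0 \<le> weight A \<rho>"
  and weight_le_1: "\<rho> \<in> states T A \<Longrightarrow> weight A \<rho> \<le> 1"
  unfolding weight_def states_eq
  by (auto intro!: scal_nonneg scal_le_1 seq_transf[OF _ discard_transf])

lemma pairing_nonneg: "\<lbrakk>a \<in> effects T A; \<rho> \<in> states T A\<rbrakk> \<Longrightarrow> 0 \<le> scal (a \<cdot> \<rho>)"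
  unfolding effects_eq states_eq by (auto intro!: scal_nonneg seq_transf)

lemma pairing_complement:
  assumes "[a, a'] \<in> tests T A 1"
  shows "a + a' = \<u> A"
  by (rule discard_unique[OF test_pair_sum[OF assms]])

lemma pairing_le_weight:
  assumes "a \<in> effects T A" "\<rho> \<in> states T A"
  shows "scal (a \<cdot> \<rho>) \<le> weight A \<rho>"
proof -
  obtain a' where a': "[a, a'] \<in> tests T A 1" using assms test_complement effects_eq by blast
  then have "a' \<in> effects T A" unfolding effects_eq by (rule transf_I) simp
  from pairing_nonneg[OF this assms(2)] show ?thesis
    by (simp add: weight_def pairing_complement[OF a', symmetric] lin_simps scal_simps)
qed

lemma zero_transf: "0 \<in> transf T A B" if "C \<in> transf T A B" for C
  using scale_transf[OF that, of 0] by simp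

lemma state_eq: "\<lbrakk>\<rho> \<in> states T A; \<sigma> \<in> states T A; \<And>a. a \<in> effects T A \<Longrightarrow> scal (a \<cdot> \<rho>) = scal (a \<cdot> \<sigma>)\<rbrakk>
    \<Longrightarrow> \<rho> = \<sigma>"
  by (rule state_eqI) (auto simp: prob_scal)

text \<open>The value of every effect lies between 0 and the weight; if the weight vanishes, no
  effect tells the state from 0.\<close>

lemma weight_zero: "\<lbrakk>\<rho> \<in> states T A; weight A \<rho> = 0\<rbrakk> \<Longrightarrow> \<rho> = 0"
  by (rule state_eq[of _ A])
    (use pairing_le_weight pairing_nonneg in \<open>force simp: lin_simps scal_simps states_eq intro: zero_transf\<close>)+

lemma normalised_weight: "\<rho> \<in> normalised T A \<longleftrightarrow> \<rho> \<in> states T A \<and> weight A \<rho> = 1"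
  unfolding normalised_def weight_def using prob_scal[of "\<u> A" A \<rho>] discard_transf effects_eq by auto

text \<open>A state of weight 1 leaves weight 0 for its complement in a two-outcome test, so the
  complement vanishes and the state is prepared deterministically. Normalised states can thus be
  composed as channels.\<close>

lemma normalised_channel: "\<rho> \<in> normalised T A \<longleftrightarrow> \<rho> \<in> channels T 1 A"
proof
  assume \<rho>: "\<rho> \<in> normalised T A"
  then obtain \<rho>' where \<rho>': "[\<rho>, \<rho>'] \<in> tests T 1 A"
    using test_complement normalised_weight states_eq by blast
  then have s: "\<rho> + \<rho>' \<in> channels T 1 A" "\<rho>' \<in> states T A"
    using test_pair_sum states_eq by (auto intro: transf_I)
  have "\<u> A \<cdot> (\<rho> + \<rho>') = \<I> 1" using discard_seq[OF s(1)] discard_unit by simp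
  then have "weight A (\<rho> + \<rho>') = 1" by (simp add: weight_def scal_simps)
  then have "\<rho>' = 0" using \<rho> s(2) weight_zero by (auto simp: normalised_weight weight_simps)
  then show "\<rho> \<in> channels T 1 A" using s by simp
next
  assume "\<rho> \<in> channels T 1 A"
  then show "\<rho> \<in> normalised T A"
    using channel_transf discard_seq[of \<rho> 1 A] by (auto simp: normalised_weight states_eq weight_def discard_unit scal_simps)
qed

lemma normalised_state: "\<rho> \<in> normalised T A \<Longrightarrow> \<rho> \<in> states T A"
  by (simp add: normalised_weight)

lemma state_seq: "\<lbrakk>C \<in> transf T A B; \<rho> \<in> states T A\<rbrakk> \<Longrightarrow> C \<cdot> \<rho> \<in> states T B"
  by (auto simp: states_eq intro: seq_transf)

lemma state_par: "\<lbrakk>\<rho> \<in> states T A; \<sigma> \<in> states T B\<rbrakk> \<Longrightarrow> \<rho> \<otimes> \<sigma> \<in> states T (A * B)"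
  using par_transf[of \<rho> 1 A \<sigma> 1 B] by (simp add: states_eq)

lemma weight_channel: "\<lbrakk>C \<in> channels T A B; \<rho> \<in> states T A\<rbrakk> \<Longrightarrow> weight B (C \<cdot> \<rho>) = weight A \<rho>"
  unfolding weight_def states_eq
  using seq_assoc[of \<rho> 1 A C B "\<u> B" 1] discard_seq[of C A B] by (simp add: channel_transf discard_transf)

lemma normalised_seq: "\<lbrakk>C \<in> channels T A B; \<rho> \<in> normalised T A\<rbrakk> \<Longrightarrow> C \<cdot> \<rho> \<in> normalised T B"
  by (auto simp: normalised_channel intro: seq_channel)

lemma normalised_par: "\<lbrakk>\<rho> \<in> normalised T A; \<sigma> \<in> normalised T B\<rbrakk> \<Longrightarrow> \<rho> \<otimes> \<sigma> \<in> normalised T (A * B)"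
  using par_channel[of \<rho> 1 A \<sigma> 1 B] by (simp add: normalised_channel)

lemma ex_normalised: "\<exists>\<rho>. \<rho> \<in> normalised T A"
  using ex_channel_state by (simp add: normalised_channel)

lemma zero_state: "0 \<in> states T A"
  using ex_normalised normalised_state zero_transf states_eq by metis

lemma scale_state: "\<lbrakk>\<rho> \<in> states T A; 0 \<le> p; p \<le> 1\<rbrakk> \<Longrightarrow> p *\<^sub>R \<rho> \<in> states T A"
  unfolding states_eq by (rule scale_transf)

lemma state_rescale:
  assumes "\<rho> \<in> states T A"
  shows "\<exists>\<sigma> \<in> normalised T A. \<rho> = weight A \<rho> *\<^sub>R \<sigma>"
proof (cases "\<rho> = 0")
  case True
  then show ?thesis using ex_normalised by (auto simp: weight_simps)
next
  case False
  then obtain c \<sigma> where "\<sigma> \<in> normalised T A" "\<rho> = c *\<^sub>R \<sigma>"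
    using state_rescaling assms by blast
  then show ?thesis by (auto simp: weight_simps normalised_weight)
qed

lemma weight_pos: "\<lbrakk>\<rho> \<in> states T A; \<rho> \<noteq> 0\<rbrakk> \<Longrightarrow> 0 < weight A \<rho>"
  using weight_nonneg[of \<rho> A] weight_zero[of \<rho> A] by (cases "weight A \<rho> = 0") auto

text \<open>Each state is its weight times a normalised state, and normalised states are channels;
  randomising over these with the weights as probabilities gives the list.\<close>

lemma prep_testI:
  assumes "set xs \<subseteq> states T A" "(\<Sum>x\<leftarrow>xs. weight A x) = 1"
  shows "xs \<in> tests T 1 A"
proof -
  define f where "f x = (SOME \<sigma>. \<sigma> \<in> normalised T A \<and> x = weight A x *\<^sub>R \<sigma>)" for x
  have f: "f x \<in> normalised T A" "x = weight A x *\<^sub>R f x" if "x \<in> states T A" for x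
    using someI_ex[of "\<lambda>\<sigma>. \<sigma> \<in> normalised T A \<and> x = weight A x *\<^sub>R \<sigma>"] state_rescale[OF that]
    by (auto simp: f_def)
  have "map2 (\<lambda>p C. p *\<^sub>R C) (map (weight A) xs) (map f xs) \<in> tests T 1 A"
    by (rule random_channels) (use assms f weight_nonneg in \<open>auto simp: normalised_channel[symmetric]\<close>)
  also have "map2 (\<lambda>p C. p *\<^sub>R C) (map (weight A) xs) (map f xs) = xs"
    using assms(1) f(2) by (induction xs) auto
  finally show ?thesis .
qed

lemma weight_test:
  assumes "xs \<in> tests T 1 A"
  shows "(\<Sum>x\<leftarrow>xs. weight A x) = 1"
proof -
  have "weight A (sum_list xs) = (\<Sum>x\<leftarrow>xs. weight A x)"
    by (induction xs) (auto simp: weight_simps)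
  then show ?thesis using sum_channel[OF assms] by (simp add: normalised_channel[symmetric] normalised_weight)
qed

lemma weight_sum_list: "weight A (sum_list xs) = (\<Sum>x\<leftarrow>xs. weight A x)"
  by (induction xs) (auto simp: weight_simps)

text \<open>The missing weight is supplied by a multiple of some normalised state; coarse-graining
  the original entries of the resulting preparation test gives the sum.\<close>

lemma sum_states:
  assumes "set xs \<subseteq> states T A" "(\<Sum>x\<leftarrow>xs. weight A x) \<le> 1"
  shows "sum_list xs \<in> states T A"
proof -
  obtain \<sigma> where \<sigma>: "\<sigma> \<in> normalised T A" using ex_normalised by blast
  let ?r = "1 - (\<Sum>x\<leftarrow>xs. weight A x)"
  have nn: "0 \<le> (\<Sum>x\<leftarrow>xs. weight A x)" by (rule sum_list_nonneg) (use assms(1) weight_nonneg in auto)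
  let ?ys = "xs @ [?r *\<^sub>R \<sigma>]"
  have t: "?ys \<in> tests T 1 A"
    by (rule prep_testI) (use assms \<sigma> nn in \<open>auto simp: weight_simps normalised_weight intro: scale_state\<close>)
  define f :: "nat \<Rightarrow> nat" where "f i = (if i < length xs then 0 else 1)" for i
  have "map (\<lambda>k. \<Sum>i | i < length ?ys \<and> f i = k. ?ys ! i) [0..<2] \<in> tests T 1 A"
    by (rule coarse_grain[OF t]) (auto simp: f_def)
  then have "(\<Sum>i | i < length ?ys \<and> f i = 0. ?ys ! i) \<in> transf T 1 A"
    by (rule transf_I) (force simp: image_iff)
  moreover have "{i. i < length ?ys \<and> f i = 0} = {0..<length xs}" by (auto simp: f_def)
  ultimately have "(\<Sum>i\<in>{0..<length xs}. ?ys ! i) \<in> transf T 1 A" by simp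
  then show ?thesis by (simp add: states_eq sum_list_sum_nth nth_append)
qed

lemma add_states: "\<lbrakk>x \<in> states T A; y \<in> states T A; weight A x + weight A y \<le> 1\<rbrakk> \<Longrightarrow> x + y \<in> states T A"
  using sum_states[of "[x, y]" A] by simp

text \<open>The complement \<open>C'\<close> is annihilated by the deterministic effect, also beside
  an arbitrary ancilla, so all its output states have weight 0 and \<open>C'\<close> vanishes. This
  is how limits of channels are recognised as channels.\<close>

lemma channel_criterion:
  assumes C: "C \<in> transf T A B" and "\<u> B \<cdot> C = \<u> A"
  shows "C \<in> channels T A B"
proof -
  obtain C' where C': "[C, C'] \<in> tests T A B" using test_complement[OF C] by blast
  then have t: "C' \<in> transf T A B" by (rule transf_I) simp
  have "\<u> B \<cdot> (C + C') = \<u> A" by (rule discard_seq[OF test_pair_sum[OF C']])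
  then have z: "\<u> B \<cdot> C' = 0" using assms(2) by (simp add: lin_simps)
  have "C' = 0"
  proof (rule transf_eqI[OF t zero_transf[OF t]], intro allI ballI)
    fix S \<rho> assume \<rho>: "\<rho> \<in> states T (A * S)"
    have st: "(C' \<otimes> \<I> S) \<cdot> \<rho> \<in> states T (B * S)"
      by (rule state_seq[OF par_transf[OF t ident_transf] \<rho>])
    have "\<u> (B * S) \<cdot> ((C' \<otimes> \<I> S) \<cdot> \<rho>) = ((\<u> B \<cdot> C') \<otimes> (\<u> S \<cdot> \<I> S)) \<cdot> \<rho>"
      unfolding discard_par
      by (rule par_seq[OF t discard_transf ident_transf discard_transf]) (use \<rho> states_eq in auto)
    then have "weight (B * S) ((C' \<otimes> \<I> S) \<cdot> \<rho>) = 0"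
      by (simp add: weight_def z lin_simps scal_simps)
    then show "(C' \<otimes> \<I> S) \<cdot> \<rho> = (0 \<otimes> \<I> S) \<cdot> \<rho>"
      using weight_zero[OF st] by (simp add: lin_simps)
  qed
  then show ?thesis using test_pair_sum[OF C'] by simp
qed

end

section \<open>Compactness\<close>

text \<open>A Gram-Schmidt process for functionals. The coordinates have to come from the class
  \<open>\<F>\<close>, later the linear functionals bounded on a given set, because these keep the
  coordinates of a sequence bounded.\<close>

lemma dual_basis:
  fixes B :: "'v::real_vector set" and \<F> :: "('v \<Rightarrow> real) set"
  assumes add: "\<And>f g. \<lbrakk>f \<in> \<F>; g \<in> \<F>\<rbrakk> \<Longrightarrow> (\<lambda>x. f x + g x) \<in> \<F>"
    and scale: "\<And>c f. f \<in> \<F> \<Longrightarrow> (\<lambda>x. c * f x) \<in> \<F>"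
    and lin: "\<And>f. f \<in> \<F> \<Longrightarrow> linear f"
    and "finite B" "independent B"
    and "\<And>x. \<lbrakk>x \<in> span B; x \<noteq> 0\<rbrakk> \<Longrightarrow> \<exists>f\<in>\<F>. f x \<noteq> 0"
  shows "\<exists>g. \<forall>b\<in>B. g b \<in> \<F> \<and> (\<forall>b'\<in>B. g b b' = (if b = b' then 1 else 0))"
  using assms(4-)
proof (induction B rule: finite_induct)
  case (insert b B)
  have ind: "independent B" "b \<notin> span B"
    using insert.prems(1) insert.hyps(2) by (auto simp: independent_insert)
  have sep: "\<exists>f\<in>\<F>. f x \<noteq> 0" if "x \<in> span B" "x \<noteq> 0" for x
    using insert.prems(2) that span_mono[of B "insert b B"] by blast
  obtain g where g: "\<And>b. b \<in> B \<Longrightarrow> g b \<in> \<F>"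
    and gd: "\<And>b b'. \<lbrakk>b \<in> B; b' \<in> B\<rbrakk> \<Longrightarrow> g b b' = (if b = b' then 1 else 0)"
    using insert.IH[OF ind(1) sep] by blast
  \<comment> \<open>What remains of \<open>b\<close> after its coordinates along \<open>B\<close>
    are removed. It is nonzero by independence, so some \<open>h\<close> in \<open>\<F>\<close>
    detects it.\<close>
  let ?y = "b - (\<Sum>c\<in>B. g c b *\<^sub>R c)"
  have sB: "(\<Sum>c\<in>B. g c b *\<^sub>R c) \<in> span B" by (intro span_sum span_scale span_base)
  have "?y \<noteq> 0" using ind(2) sB by auto
  moreover have "?y \<in> span (insert b B)"
    using sB span_mono[of B "insert b B"] by (intro span_diff) (auto intro: span_base)
  ultimately obtain h where h: "h \<in> \<F>" "h ?y \<noteq> 0" using insert.prems(2) by blast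
  have sum\<F>: "(\<lambda>x. f x + (\<Sum>c\<in>C. k c * g c x)) \<in> \<F>" if "finite C" "C \<subseteq> B" "f \<in> \<F>" for C k f
    using that
  proof (induction C rule: finite_induct)
    case (insert c C)
    have "(\<lambda>x. (f x + (\<Sum>c\<in>C. k c * g c x)) + k c * g c x) \<in> \<F>"
      by (rule add[OF insert.IH scale[OF g]]) (use insert.prems in auto)
    then show ?case using insert.hyps by (simp add: algebra_simps)
  qed simp
  \<comment> \<open>Corrected so as to vanish on \<open>B\<close>; its value at \<open>b\<close> is
    \<open>h ?y\<close>, which is nonzero and can be scaled to 1.\<close>
  define h' where "h' x = h x + (\<Sum>c\<in>B. - h c * g c x)" for x
  have h'\<F>: "h' \<in> \<F>" unfolding h'_def by (rule sum\<F>[OF insert.hyps(1) _ h(1)]) simp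
  have h'B: "h' c = 0" if "c \<in> B" for c
  proof -
    have "(\<Sum>a\<in>B. h a * g a c) = (\<Sum>a\<in>B. if a = c then h a else 0)"
      by (rule sum.cong) (use gd that in auto)
    then show ?thesis using that insert.hyps(1) by (simp add: h'_def sum_negf)
  qed
  have h'b: "h' b = h ?y"
    using lin[OF h(1)] by (simp add: h'_def linear_diff linear_sum linear_scale sum_negf mult.commute)
  define gb where "gb x = (1 / h ?y) * h' x" for x
  have gb: "gb \<in> \<F>" "gb b = 1" "\<And>c. c \<in> B \<Longrightarrow> gb c = 0"
    subgoal unfolding gb_def[abs_def] by (rule scale[OF h'\<F>])
    using h'B h'b h(2) by (auto simp: gb_def)
  define g' where "g' c = (if c = b then gb else (\<lambda>x. g c x + (- g c b) * gb x))" for c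
  have "g' c \<in> \<F>" if "c \<in> insert b B" for c
  proof (cases "c = b")
    case False
    then have "(\<lambda>x. g c x + (- g c b) * gb x) \<in> \<F>" using that by (intro add g scale gb(1)) auto
    with False show ?thesis unfolding g'_def by (simp only: if_False)
  qed (use gb(1) in \<open>simp add: g'_def\<close>)
  moreover have "g' c c' = (if c = c' then 1 else 0)" if "c \<in> insert b B" "c' \<in> insert b B" for c c'
    using that gb gd insert.hyps(2) by (auto simp: g'_def)
  ultimately show ?case by blast
qed simp

text \<open>Bolzano-Weierstrass, one coordinate after another.\<close>

lemma bounded_families_subseq:
  fixes c :: "nat \<Rightarrow> 'a \<Rightarrow> real"
  assumes "finite B" "\<And>n b. b \<in> B \<Longrightarrow> \<bar>c n b\<bar> \<le> M b"
  shows "\<exists>r d. strict_mono (r :: nat \<Rightarrow> nat) \<and> (\<forall>b\<in>B. (\<lambda>n. c (r n) b) \<longlonglongrightarrow> d b)"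
  using assms
proof (induction B rule: finite_induct)
  case empty
  show ?case by (intro exI[of _ id]) (auto simp: strict_mono_def)
next
  case (insert b B)
  then obtain r d where r: "strict_mono (r :: nat \<Rightarrow> nat)" "\<forall>b\<in>B. (\<lambda>n. c (r n) b) \<longlonglongrightarrow> d b" by auto
  have "\<forall>n. c (r n) b \<in> {- M b .. M b}" using insert.prems by (auto simp: abs_le_iff minus_le_iff)
  moreover have "seq_compact {- M b .. M b}" by (simp add: compact_imp_seq_compact)
  ultimately obtain l s where s: "strict_mono (s :: nat \<Rightarrow> nat)" "((\<lambda>n. c (r n) b) \<circ> s) \<longlonglongrightarrow> l"
    unfolding seq_compact_def by metis
  have "(\<lambda>n. c (r (s n)) a) \<longlonglongrightarrow> (d(b := l)) a" if "a \<in> insert b B" for a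
  proof (cases "a = b")
    case False
    then show ?thesis using that r(2) LIMSEQ_subseq_LIMSEQ[OF _ s(1), of "\<lambda>n. c (r n) a"] by (auto simp: comp_def)
  qed (use s(2) in \<open>simp add: comp_def\<close>)
  then show ?case using strict_mono_o[OF r(1) s(1)]
    by (intro exI[of _ "r \<circ> s"] exI[of _ "d(b := l)"]) (auto simp: comp_def)
qed

text \<open>Coordinatewise convergence inside a finite-dimensional subspace: every linear or multilinear
  map is continuous for it, without any appeal to the norm.\<close>

definition fin_lim :: "(nat \<Rightarrow> 'v::real_vector) \<Rightarrow> 'v \<Rightarrow> bool" where
  "fin_lim x l \<longleftrightarrow> (\<exists>B c d. finite B \<and> (\<forall>n. x n = (\<Sum>b\<in>B. c n b *\<^sub>R b)) \<and>
     (\<forall>b\<in>B. (\<lambda>n. c n b) \<longlonglongrightarrow> (d b :: real)) \<and> l = (\<Sum>b\<in>B. d b *\<^sub>R b))"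

lemma fin_lim_linear:
  fixes L :: "'v::real_vector \<Rightarrow> 'w::real_normed_vector"
  assumes "fin_lim x l" "linear L"
  shows "(\<lambda>n. L (x n)) \<longlonglongrightarrow> L l"
proof -
  obtain B c d where *: "\<forall>n. x n = (\<Sum>b\<in>B. c n b *\<^sub>R b)" "\<forall>b\<in>B. (\<lambda>n. c n b) \<longlonglongrightarrow> d b"
    "l = (\<Sum>b\<in>B. d b *\<^sub>R b)" using assms(1) by (auto simp: fin_lim_def)
  have "(\<lambda>n. \<Sum>b\<in>B. c n b *\<^sub>R L b) \<longlonglongrightarrow> (\<Sum>b\<in>B. d b *\<^sub>R L b)"
    using *(2) by (intro tendsto_intros) auto
  then show ?thesis using * assms(2) by (simp add: linear_sum linear_scale)
qed

lemma fin_lim_bilinear: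
  fixes h :: "'v::real_normed_vector \<Rightarrow> 'v \<Rightarrow> 'v"
  assumes "fin_lim x l" "fin_lim y m" "bilinear h"
  shows "(\<lambda>n. h (x n) (y n)) \<longlonglongrightarrow> h l m"
proof -
  obtain B c d where *: "\<forall>n. x n = (\<Sum>b\<in>B. c n b *\<^sub>R b)" "\<forall>b\<in>B. (\<lambda>n. c n b) \<longlonglongrightarrow> d b"
    "l = (\<Sum>b\<in>B. d b *\<^sub>R b)" using assms(1) by (auto simp: fin_lim_def)
  have lin: "linear (\<lambda>x. h x z)" for z using assms(3) by (simp add: bilinear_def)
  have "(\<lambda>n. h b (y n)) \<longlonglongrightarrow> h b m" for b
    by (rule fin_lim_linear[OF assms(2)]) (use assms(3) in \<open>simp add: bilinear_def\<close>)
  then have "(\<lambda>n. \<Sum>b\<in>B. c n b *\<^sub>R h b (y n)) \<longlonglongrightarrow> (\<Sum>b\<in>B. d b *\<^sub>R h b m)"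
    using *(2) by (intro tendsto_intros) auto
  moreover have "(\<Sum>b\<in>B. c n b *\<^sub>R h b (y n)) = h (x n) (y n)" for n
    using linear_sum[OF lin, of _ B] linear_scale[OF lin] * by simp
  moreover have "(\<Sum>b\<in>B. d b *\<^sub>R h b m) = h l m"
    using linear_sum[OF lin, of _ B] linear_scale[OF lin] * by simp
  ultimately show ?thesis by simp
qed

lemma fin_lim_subseq:
  assumes "fin_lim x l" "strict_mono r"
  shows "fin_lim (\<lambda>n. x (r n)) l"
proof -
  obtain B c d where *: "finite B" "\<forall>n. x n = (\<Sum>b\<in>B. c n b *\<^sub>R b)" "\<forall>b\<in>B. (\<lambda>n. c n b) \<longlonglongrightarrow> d b"
    "l = (\<Sum>b\<in>B. d b *\<^sub>R b)" using assms(1) by (auto simp: fin_lim_def)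
  have "\<forall>b\<in>B. (\<lambda>n. c (r n) b) \<longlonglongrightarrow> d b"
    using *(3) LIMSEQ_subseq_LIMSEQ[OF _ assms(2)] by (fastforce simp: comp_def)
  with * show ?thesis
    unfolding fin_lim_def by (intro exI[of _ B] exI[of _ "\<lambda>n. c (r n)"] exI[of _ d]) simp
qed

text \<open>A basis chosen inside \<open>S\<close> has a dual basis of functionals bounded on
  \<open>S\<close>, so the coordinates of the sequence are bounded and a subsequence converges
  coordinatewise. The limit is also a limit for the norm, hence lies in the closed set
  \<open>S\<close>.\<close>

lemma fin_lim_compact:
  fixes S :: "'v::real_normed_vector set" and x :: "nat \<Rightarrow> 'v"
  assumes "closed S" "finite F" "S \<subseteq> span F"
    and sep: "\<And>x. \<lbrakk>x \<in> span S; x \<noteq> 0\<rbrakk> \<Longrightarrow> \<exists>f::'v \<Rightarrow> real. linear f \<and> (\<exists>M. \<forall>y\<in>S. \<bar>f y\<bar> \<le> M) \<and> f x \<noteq> 0"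
    and x: "\<And>n. x n \<in> S"
  shows "\<exists>l\<in>S. \<exists>r. strict_mono r \<and> fin_lim (\<lambda>n. x (r n)) l"
proof -
  obtain B where B: "B \<subseteq> S" "independent B" "S \<subseteq> span B"
    using maximal_independent_subset[of S] by blast
  have fin: "finite B"
    using independent_span_bound[OF assms(2) B(2)] B(1) assms(3) by blast
  define \<F> where "\<F> = {f::'v \<Rightarrow> real. linear f \<and> (\<exists>M. \<forall>y\<in>S. \<bar>f y\<bar> \<le> M)}"
  have "\<exists>g. \<forall>b\<in>B. g b \<in> \<F> \<and> (\<forall>b'\<in>B. g b b' = (if b = b' then 1 else 0))"
  proof (rule dual_basis[OF _ _ _ fin B(2)])
    fix f g :: "'v \<Rightarrow> real" assume "f \<in> \<F>" "g \<in> \<F>"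
    then obtain M N where M: "\<forall>y\<in>S. \<bar>f y\<bar> \<le> M" "\<forall>y\<in>S. \<bar>g y\<bar> \<le> N" by (auto simp: \<F>_def)
    have "\<forall>y\<in>S. \<bar>f y + g y\<bar> \<le> M + N"
      using M by (meson abs_triangle_ineq add_mono order_trans)
    then show "(\<lambda>x. f x + g x) \<in> \<F>"
      using \<open>f \<in> \<F>\<close> \<open>g \<in> \<F>\<close> by (auto simp: \<F>_def intro: linear_compose_add)
  next
    fix c and f :: "'v \<Rightarrow> real" assume "f \<in> \<F>"
    then obtain M where M: "\<forall>y\<in>S. \<bar>f y\<bar> \<le> M" by (auto simp: \<F>_def)
    have "\<forall>y\<in>S. \<bar>c * f y\<bar> \<le> \<bar>c\<bar> * M" using M by (simp add: abs_mult mult_left_mono)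
    then show "(\<lambda>x. c * f x) \<in> \<F>"
      using \<open>f \<in> \<F>\<close> linear_compose_scale_right[of f c] by (auto simp: \<F>_def)
  next
    fix x assume "x \<in> span B" "x \<noteq> 0"
    then show "\<exists>f\<in>\<F>. f x \<noteq> 0" using sep[of x] span_mono[OF B(1)] by (auto simp: \<F>_def)
  qed (simp add: \<F>_def)
  then obtain g where g: "\<And>b. b \<in> B \<Longrightarrow> g b \<in> \<F>"
    and gd: "\<And>b b'. \<lbrakk>b \<in> B; b' \<in> B\<rbrakk> \<Longrightarrow> g b b' = (if b = b' then 1 else 0)" by blast
  have expand: "y = (\<Sum>b\<in>B. g b y *\<^sub>R b)" if y: "y \<in> S" for y
  proof -
    obtain u where u: "y = (\<Sum>b\<in>B. u b *\<^sub>R b)"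
      using y B(3) fin span_finite[OF fin] by auto
    have "g b y = u b" if b: "b \<in> B" for b
    proof -
      have "linear (g b)" using g[OF b] by (simp add: \<F>_def)
      then have "g b y = (\<Sum>b'\<in>B. u b' * g b b')" by (simp add: u linear_sum linear_scale)
      also have "\<dots> = (\<Sum>b'\<in>B. if b = b' then u b' else 0)" by (rule sum.cong) (use gd b in auto)
      finally show ?thesis using b fin by simp
    qed
    then show ?thesis using u by simp
  qed
  have "\<forall>b\<in>B. \<exists>M. \<forall>y\<in>S. \<bar>g b y\<bar> \<le> M" using g by (auto simp: \<F>_def)
  then obtain M where M: "\<And>b y. \<lbrakk>b \<in> B; y \<in> S\<rbrakk> \<Longrightarrow> \<bar>g b y\<bar> \<le> M b" by metis
  obtain r d where r: "strict_mono (r :: nat \<Rightarrow> nat)" "\<forall>b\<in>B. (\<lambda>n. g b (x (r n))) \<longlonglongrightarrow> d b"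
    using bounded_families_subseq[OF fin, of "\<lambda>n b. g b (x n)" M] M x by blast
  have lim: "fin_lim (\<lambda>n. x (r n)) (\<Sum>b\<in>B. d b *\<^sub>R b)"
    unfolding fin_lim_def using fin r(2) expand[OF x]
    by (intro exI[of _ B] exI[of _ "\<lambda>n b. g b (x (r n))"] exI[of _ d]) auto
  have "(\<lambda>n. x (r n)) \<longlonglongrightarrow> (\<Sum>b\<in>B. d b *\<^sub>R b)"
    using fin_lim_linear[OF lim linear_id] by simp
  then have "(\<Sum>b\<in>B. d b *\<^sub>R b) \<in> S"
    by (rule closed_sequentially[OF assms(1), rotated]) (rule x)
  then show ?thesis using r(1) lim by blast
qed

context sharp_theory_with_purification
begin

section \<open>Sequential compactness of transformations and of reversible channels\<close>

lemma transf_nonempty: "\<exists>C. C \<in> transf T A B"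
proof -
  obtain \<rho> where "\<rho> \<in> channels T 1 B" using ex_channel_state by blast
  then show ?thesis using seq_transf[OF discard_transf channel_transf] by blast
qed

lemma subconvex_transf:
  assumes "C \<in> transf T A B" "D \<in> transf T A B" "0 \<le> p" "0 \<le> q" "p + q \<le> 1"
  shows "p *\<^sub>R C + q *\<^sub>R D \<in> transf T A B"
proof -
  obtain C' D' where CD: "[C, C'] \<in> tests T A B" "[D, D'] \<in> tests T A B"
    using assms test_complement by blast
  then have t: "C' \<in> transf T A B" "D' \<in> transf T A B" by (auto intro: transf_I)
  \<comment> \<open>The third branch only absorbs the remaining probability. The outcomes 0 and 2,
    which are \<open>C\<close> with weight \<open>p\<close> and \<open>D\<close> with weight
    \<open>q\<close>, form the block that is kept.\<close>
  let ?ps = "map (\<lambda>p. p *\<^sub>R \<I> A) [p, q, 1 - p - q]" and ?dss = "[[C, C'], [D, D'], [C', C]]"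
  have "?ps \<in> tests T A A" by (rule random_test) (use assms in auto)
  from seq_test[OF this, of ?dss B]
  have "concat (map2 (\<lambda>c. map (\<lambda>d. d \<cdot> c)) ?ps ?dss) \<in> tests T A B"
    using CD test_swap[OF CD(1)] by simp
  also have "concat (map2 (\<lambda>c. map (\<lambda>d. d \<cdot> c)) ?ps ?dss)
      = [p *\<^sub>R C, p *\<^sub>R C', q *\<^sub>R D, q *\<^sub>R D', (1 - p - q) *\<^sub>R C', (1 - p - q) *\<^sub>R C]" (is "_ = ?xs")
    using assms t by (simp add: lin_simps seq_ident_right)
  finally have xs: "?xs \<in> tests T A B" .
  define f :: "nat \<Rightarrow> nat" where "f i = (if i = 0 \<or> i = 2 then 0 else 1)" for i
  have "map (\<lambda>k. \<Sum>i | i < length ?xs \<and> f i = k. ?xs ! i) [0..<2] \<in> tests T A B"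
    by (rule coarse_grain[OF xs]) (auto simp: f_def)
  then have "(\<Sum>i | i < length ?xs \<and> f i = 0. ?xs ! i) \<in> transf T A B"
    by (rule transf_I) (force simp: image_iff)
  moreover have "{i. i < length ?xs \<and> f i = 0} = {0, 2}" by (auto simp: f_def)
  ultimately show ?thesis by simp
qed

text \<open>Up to positive factors the span consists of differences of transformations, so
  functionals that separate transformations also separate the span.\<close>

lemma span_transf:
  assumes "x \<in> span (transf T A B)"
  shows "\<exists>r>0. \<exists>C\<in>transf T A B. \<exists>D\<in>transf T A B. r *\<^sub>R x = C - D"
  using assms
proof (induction rule: span_induct_alt)
  case base
  obtain C where "C \<in> transf T A B" using transf_nonempty by blast
  then show ?case by (intro exI[of _ 1]) auto
next
  case (step c x y)
  then obtain r C D where r: "r > 0" "C \<in> transf T A B" "D \<in> transf T A B" "r *\<^sub>R y = C - D"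
    by blast
  \<comment> \<open>Chosen with \<open>s * \<bar>c\<bar> + s / r = 1\<close>, so that
    \<open>subconvex_transf\<close> applies to \<open>x\<close> with weight
    \<open>s * \<bar>c\<bar>\<close> and to \<open>C\<close> or \<open>D\<close> with weight
    \<open>s / r\<close>.\<close>
  define s where "s = 1 / (\<bar>c\<bar> + 1 / r)"
  have p: "\<bar>c\<bar> + 1 / r > 0" using r(1) by (simp add: add_nonneg_pos)
  then have s: "s > 0" by (simp add: s_def)
  have le: "s * \<bar>c\<bar> + s / r \<le> 1" using p r(1) by (simp add: s_def field_simps)
  have y: "y = (1 / r) *\<^sub>R (C - D)" using r(1) r(4)[symmetric] by simp
  have sr: "s / r \<le> 1" using le mult_nonneg_nonneg[of s "\<bar>c\<bar>"] s by linarith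
  have D1: "(s * \<bar>c\<bar>) *\<^sub>R x + (s / r) *\<^sub>R E \<in> transf T A B" if "E \<in> transf T A B" for E
    by (rule subconvex_transf) (use step(1) that s r(1) le in auto)
  have D2: "(s / r) *\<^sub>R E \<in> transf T A B" if "E \<in> transf T A B" for E
    by (rule scale_transf[OF that _ sr]) (use s r(1) in simp)
  show ?case
  proof (cases "c \<ge> 0")
    case True
    then have "s *\<^sub>R (c *\<^sub>R x + y) = ((s * \<bar>c\<bar>) *\<^sub>R x + (s / r) *\<^sub>R C) - (s / r) *\<^sub>R D"
      by (simp add: y algebra_simps)
    then show ?thesis using s D1[OF r(2)] D2[OF r(3)] by blast
  next
    case False
    then have "s *\<^sub>R (c *\<^sub>R x + y) = (s / r) *\<^sub>R C - ((s * \<bar>c\<bar>) *\<^sub>R x + (s / r) *\<^sub>R D)"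
      by (simp add: y algebra_simps)
    then show ?thesis using s D1[OF r(3)] D2[OF r(2)] by blast
  qed
qed

text \<open>The functionals required by \<open>fin_lim_compact\<close> are outcome probabilities:
  apply the transformation to one part of a bipartite state and evaluate an effect. They lie between
  0 and 1 on transformations, and operational equality makes them separating.\<close>

lemma transf_subseq:
  fixes x :: "nat \<Rightarrow> 'b"
  assumes "\<And>n. x n \<in> transf T A B"
  shows "\<exists>l\<in>transf T A B. \<exists>r. strict_mono r \<and> fin_lim (\<lambda>n. x (r n)) l"
proof -
  obtain F where F: "finite F" "transf T A B \<subseteq> span F" using finite_dimensional by blast
  show ?thesis
  proof (rule fin_lim_compact[where S = "transf T A B" and F = F])
    fix x assume x: "x \<in> span (transf T A B)" "x \<noteq> 0"
    obtain r C D where r: "r > 0" "C \<in> transf T A B" "D \<in> transf T A B" "r *\<^sub>R x = C - D"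
      using span_transf[OF x(1)] by blast
    have ev: "(E \<otimes> \<I> S) \<cdot> \<sigma> \<in> states T (B * S)" if "E \<in> transf T A B" "\<sigma> \<in> states T (A * S)" for E S \<sigma>
      by (rule state_seq[OF par_transf[OF that(1) ident_transf] that(2)])
    have "C \<noteq> D" using r x(2) by auto
    then obtain S \<sigma> where \<sigma>: "\<sigma> \<in> states T (A * S)" "(C \<otimes> \<I> S) \<cdot> \<sigma> \<noteq> (D \<otimes> \<I> S) \<cdot> \<sigma>"
      using transf_eqI[OF r(2,3)] by blast
    then obtain e where e: "e \<in> effects T (B * S)" "scal (e \<cdot> ((C \<otimes> \<I> S) \<cdot> \<sigma>)) \<noteq> scal (e \<cdot> ((D \<otimes> \<I> S) \<cdot> \<sigma>))"
      using state_eq[OF ev[OF r(2)] ev[OF r(3)]] by blast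
    define f where "f x = scal (e \<cdot> ((x \<otimes> \<I> S) \<cdot> \<sigma>))" for x
    have lin: "linear f" unfolding f_def by (rule linearI) (auto simp: lin_simps scal_simps)
    have "f C - f D = r * f x"
      using linear_diff[OF lin, of C D] linear_scale[OF lin, of r x] r(4) by simp
    then have "f x \<noteq> 0" using e(2) r(1) by (auto simp: f_def)
    moreover have "\<forall>y\<in>transf T A B. \<bar>f y\<bar> \<le> 1"
    proof
      fix y assume y: "y \<in> transf T A B"
      show "\<bar>f y\<bar> \<le> 1"
        unfolding f_def using pairing_nonneg[OF e(1) ev[OF y \<sigma>(1)]] pairing_le_weight[OF e(1) ev[OF y \<sigma>(1)]]
          weight_le_1[OF ev[OF y \<sigma>(1)]] by simp
    qed
    ultimately show "\<exists>f::'b \<Rightarrow> real. linear f \<and> (\<exists>M. \<forall>y\<in>transf T A B. \<bar>f y\<bar> \<le> M) \<and> f x \<noteq> 0"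
      using lin by blast
  qed (rule closed_transf F assms)+
qed

lemma reversible_transf: "U \<in> reversible T A B \<Longrightarrow> U \<in> transf T A B"
  by (auto simp: reversible_def intro: channel_transf)

text \<open>Limits are extracted for the channels and then for their inverses along a common
  subsequence. Bilinearity carries both inverse equations to the limit, and
  \<open>channel_criterion\<close> shows that the limits are deterministic.\<close>

lemma reversible_subseq:
  fixes U :: "nat \<Rightarrow> 'b"
  assumes "\<And>n. U n \<in> reversible T A A"
  shows "\<exists>W\<in>reversible T A A. \<exists>r. strict_mono r \<and> fin_lim (\<lambda>n. U (r n)) W"
proof -
  have "\<forall>n. \<exists>V. V \<in> channels T A A \<and> V \<cdot> U n = \<I> A \<and> U n \<cdot> V = \<I> A"
    using assms by (auto simp: reversible_def)
  then obtain V where V: "\<And>n. V n \<in> channels T A A" "\<And>n. V n \<cdot> U n = \<I> A" "\<And>n. U n \<cdot> V n = \<I> A"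
    by metis
  have U: "U n \<in> channels T A A" for n using assms by (simp add: reversible_def)
  obtain W r where W: "W \<in> transf T A A" "strict_mono r" "fin_lim (\<lambda>n. U (r n)) W"
    using transf_subseq[of U A A] U channel_transf by blast
  obtain X s where X: "X \<in> transf T A A" "strict_mono s" "fin_lim (\<lambda>n. V (r (s n))) X"
    using transf_subseq[of "\<lambda>n. V (r n)" A A] V(1) channel_transf by blast
  have W': "fin_lim (\<lambda>n. U (r (s n))) W" by (rule fin_lim_subseq[OF W(3) X(2)])
  have "(\<lambda>n. V (r (s n)) \<cdot> U (r (s n))) \<longlonglongrightarrow> X \<cdot> W" "(\<lambda>n. U (r (s n)) \<cdot> V (r (s n))) \<longlonglongrightarrow> W \<cdot> X"
    using fin_lim_bilinear[OF X(3) W' bilinear_seq] fin_lim_bilinear[OF W' X(3) bilinear_seq] .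
  then have inv: "X \<cdot> W = \<I> A" "W \<cdot> X = \<I> A" by (simp_all add: V(2,3) LIMSEQ_const_iff)
  have "(\<lambda>n. \<u> A \<cdot> U (r (s n))) \<longlonglongrightarrow> \<u> A \<cdot> W" "(\<lambda>n. \<u> A \<cdot> V (r (s n))) \<longlonglongrightarrow> \<u> A \<cdot> X"
    using fin_lim_linear[OF W' linear_seq_right] fin_lim_linear[OF X(3) linear_seq_right] .
  then have "\<u> A \<cdot> W = \<u> A" "\<u> A \<cdot> X = \<u> A"
    by (simp_all add: discard_seq[OF U] discard_seq[OF V(1)] LIMSEQ_const_iff)
  then have "W \<in> channels T A A" "X \<in> channels T A A" using channel_criterion W(1) X(1) by auto
  then have "W \<in> reversible T A A" using inv by (auto simp: reversible_def)
  then show ?thesis using W' strict_mono_o[OF W(2) X(2)]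
    by (intro bexI[of _ W] exI[of _ "r \<circ> s"]) (auto simp: comp_def)
qed

section \<open>Pure states\<close>

lemma weight_scale: "weight A (c *\<^sub>R x) = c * weight A x"
  by (simp add: weight_simps)

lemma pure_transf: "C \<in> pure T A B \<Longrightarrow> C \<in> transf T A B"
  by (simp add: pure_def)

lemma pure_split:
  assumes "C \<in> pure T A B" "[D, E, F] \<in> tests T A B" "C = D + E"
  shows "\<exists>c. D = c *\<^sub>R C"
proof -
  have "C = (\<Sum>i\<in>{0, 1}. [D, E, F] ! i)" using assms(3) by simp
  with assms(1,2) have "\<forall>i\<in>{0, 1}. \<exists>c. [D, E, F] ! i = c *\<^sub>R C"
    unfolding pure_def by (elim CollectE conjE ballE[of _ _ "[D, E, F]"] allE[of _ "{0, 1}"]) auto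
  then show ?thesis by simp
qed

text \<open>Any test reduces to three outcomes: the one under scrutiny, the rest of the block
  \<open>X0\<close>, and everything else.\<close>

lemma pureI:
  assumes "C \<in> transf T A B" "\<And>D E F. \<lbrakk>[D, E, F] \<in> tests T A B; C = D + E\<rbrakk> \<Longrightarrow> \<exists>c. D = c *\<^sub>R C"
  shows "C \<in> pure T A B"
  unfolding pure_def
proof (intro CollectI conjI assms(1) ballI allI impI)
  fix cs X0 i
  assume cs: "cs \<in> tests T A B" and X0: "X0 \<subseteq> {..<length cs}" and C: "C = (\<Sum>i\<in>X0. cs ! i)" and i: "i \<in> X0"
  define f :: "nat \<Rightarrow> nat" where "f j = (if j = i then 0 else if j \<in> X0 then 1 else 2)" for j
  have "map (\<lambda>k. \<Sum>j | j < length cs \<and> f j = k. cs ! j) [0..<3] \<in> tests T A B"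
    by (rule coarse_grain[OF cs]) (auto simp: f_def)
  moreover have "{j. j < length cs \<and> f j = 0} = {i}" "{j. j < length cs \<and> f j = 1} = X0 - {i}"
    using i X0 by (auto simp: f_def)
  ultimately have "[cs ! i, \<Sum>j\<in>X0 - {i}. cs ! j, \<Sum>j | j < length cs \<and> f j = 2. cs ! j] \<in> tests T A B"
    by (simp add: upt_rec[of 0 3] upt_rec[of 1 3] upt_rec[of 2 3] numeral_3_eq_3 numeral_2_eq_2)
  moreover have "C = cs ! i + (\<Sum>j\<in>X0 - {i}. cs ! j)"
    using i X0 finite_subset[OF X0] by (simp add: C sum.remove)
  ultimately show "\<exists>c. cs ! i = c *\<^sub>R C" by (rule assms(2))
qed

text \<open>Here no test containing the summands is given; a multiple of a normalised state
  completes them to one. Comparing weights bounds the factor.\<close>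

lemma pure_state_split:
  assumes "x \<in> pure T 1 A" "y \<in> states T A" "z \<in> states T A" "x = y + z"
  shows "\<exists>c. 0 \<le> c \<and> c \<le> 1 \<and> y = c *\<^sub>R x"
proof -
  obtain \<sigma> where \<sigma>: "\<sigma> \<in> normalised T A" using ex_normalised by blast
  have w: "weight A x \<le> 1" using pure_transf[OF assms(1)] weight_le_1 by (simp add: states_eq)
  have "[y, z, (1 - weight A x) *\<^sub>R \<sigma>] \<in> tests T 1 A"
    by (rule prep_testI)
      (use assms \<sigma> w weight_nonneg[OF assms(2)] weight_nonneg[OF assms(3)] in
        \<open>auto simp: weight_simps normalised_weight intro!: scale_state\<close>)
  then obtain c where c: "y = c *\<^sub>R x" using pure_split[OF assms(1)] assms(4) by blast
  show ?thesis
  proof (cases "x = 0")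
    case True
    then show ?thesis using c by (intro exI[of _ 0]) auto
  next
    case False
    then have w: "0 < weight A x" using weight_pos pure_transf[OF assms(1)] by (simp add: states_eq)
    have "weight A y = c * weight A x" using c weight_scale by metis
    moreover have "weight A y \<le> weight A x"
      using assms(4) weight_nonneg[OF assms(3)] by (simp add: weight_simps)
    ultimately
    have "0 \<le> c" "c \<le> 1" using w weight_nonneg[OF assms(2)] by (auto simp: zero_le_mult_iff)
    then show ?thesis using c by blast
  qed
qed

lemma pure_stateI:
  assumes "x \<in> states T A" "\<And>y z. \<lbrakk>y \<in> states T A; z \<in> states T A; x = y + z\<rbrakk> \<Longrightarrow> \<exists>c. y = c *\<^sub>R x"
  shows "x \<in> pure T 1 A"
proof (rule pureI)
  show "x \<in> transf T 1 A" using assms(1) by (simp add: states_eq)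
  fix D E F assume "[D, E, F] \<in> tests T 1 A" "x = D + E"
  then show "\<exists>c. D = c *\<^sub>R x" using assms(2)[of D E] transf_I[of "[D, E, F]" 1 A] by (auto simp: states_eq)
qed

lemma pure_states_iff: "\<phi> \<in> pure_states T A \<longleftrightarrow> \<phi> \<in> pure T 1 A \<and> \<phi> \<in> normalised T A"
  by (simp add: pure_states_def)

lemma pure_states_normalised: "\<phi> \<in> pure_states T A \<Longrightarrow> \<phi> \<in> normalised T A"
  and pure_states_state: "\<phi> \<in> pure_states T A \<Longrightarrow> \<phi> \<in> states T A"
  and pure_states_pure: "\<phi> \<in> pure_states T A \<Longrightarrow> \<phi> \<in> pure T 1 A"
  by (auto simp: pure_states_def normalised_state)

lemma pure_states_I:
  assumes "x \<in> normalised T A" "\<And>y z. \<lbrakk>y \<in> states T A; z \<in> states T A; x = y + z\<rbrakk> \<Longrightarrow> \<exists>c. y = c *\<^sub>R x"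
  shows "x \<in> pure_states T A"
  unfolding pure_states_iff using assms pure_stateI[of x A] normalised_state by blast

lemma pure_rescale:
  assumes "x \<in> pure T 1 A" "x \<noteq> 0"
  shows "\<exists>\<phi> \<in> pure_states T A. x = weight A x *\<^sub>R \<phi>"
proof -
  have x: "x \<in> states T A" using pure_transf[OF assms(1)] by (simp add: states_eq)
  obtain \<phi> where \<phi>: "\<phi> \<in> normalised T A" "x = weight A x *\<^sub>R \<phi>" using state_rescale[OF x] by blast
  have w: "0 < weight A x" "weight A x \<le> 1" using weight_pos[OF x assms(2)] weight_le_1[OF x] by auto
  have "\<phi> \<in> pure_states T A"
  proof (rule pure_states_I[OF \<phi>(1)])
    fix y z assume yz: "y \<in> states T A" "z \<in> states T A" "\<phi> = y + z"
    have "x = weight A x *\<^sub>R y + weight A x *\<^sub>R z" using \<phi>(2) yz(3) by (metis scaleR_add_right)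
    then obtain c where "weight A x *\<^sub>R y = c *\<^sub>R x"
      using pure_state_split[OF assms(1) scale_state scale_state] yz w by (metis less_imp_le)
    then have "weight A x *\<^sub>R y = weight A x *\<^sub>R (c *\<^sub>R \<phi>)" using \<phi>(2) by (metis scaleR_left_commute)
    then have "y = c *\<^sub>R \<phi>" using w(1) by (simp del: scaleR_scaleR)
    then show "\<exists>c. y = c *\<^sub>R \<phi>" by blast
  qed
  with \<phi>(2) show ?thesis by blast
qed

lemma reversible_channel: "U \<in> reversible T A B \<Longrightarrow> U \<in> channels T A B"
  by (simp add: reversible_def)

lemma reversible_inverse:
  "U \<in> reversible T A B \<Longrightarrow> \<exists>V \<in> reversible T B A. V \<cdot> U = \<I> A \<and> U \<cdot> V = \<I> B"
  by (auto simp: reversible_def)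

lemma reversible_ident: "\<I> A \<in> reversible T A A"
  using ident_channel seq_ident_left[OF ident_transf] by (auto simp: reversible_def)

lemma reversible_swap: "swap T A B \<in> reversible T (A * B) (B * A)"
  unfolding reversible_def using swap_channel swap_swap by (intro CollectI conjI bexI[of _ "swap T B A"])

lemma reversible_seq:
  assumes "U \<in> reversible T A B" "V \<in> reversible T B C"
  shows "V \<cdot> U \<in> reversible T A C"
proof -
  obtain U' V' where *: "U' \<in> reversible T B A" "U' \<cdot> U = \<I> A" "U \<cdot> U' = \<I> B"
    "V' \<in> reversible T C B" "V' \<cdot> V = \<I> B" "V \<cdot> V' = \<I> C"
    using assms reversible_inverse by meson
  note t = reversible_transf[OF assms(1)] reversible_transf[OF assms(2)] reversible_transf[OF *(1)]
    reversible_transf[OF *(4)]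
  have "(U' \<cdot> V') \<cdot> (V \<cdot> U) = U' \<cdot> ((V' \<cdot> V) \<cdot> U)"
    using seq_assoc[OF seq_transf[OF t(1,2)] t(4,3)] seq_assoc[OF t(1,2,4)] by simp
  then have 1: "(U' \<cdot> V') \<cdot> (V \<cdot> U) = \<I> A" using * seq_ident_left[OF t(1)] by simp
  have "(V \<cdot> U) \<cdot> (U' \<cdot> V') = V \<cdot> ((U \<cdot> U') \<cdot> V')"
    using seq_assoc[OF seq_transf[OF t(4,3)] t(1,2)] seq_assoc[OF t(4,3,1)] by simp
  then have "(V \<cdot> U) \<cdot> (U' \<cdot> V') = \<I> C" using * seq_ident_left[OF t(4)] by simp
  with 1 show ?thesis
    unfolding reversible_def using assms *(1,4) seq_channel reversible_channel by blast
qed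

lemma reversible_par:
  assumes "U \<in> reversible T A B" "V \<in> reversible T C D"
  shows "U \<otimes> V \<in> reversible T (A * C) (B * D)"
proof -
  obtain U' V' where *: "U' \<in> reversible T B A" "U' \<cdot> U = \<I> A" "U \<cdot> U' = \<I> B"
    "V' \<in> reversible T D C" "V' \<cdot> V = \<I> C" "V \<cdot> V' = \<I> D"
    using assms reversible_inverse by meson
  note t = reversible_transf[OF assms(1)] reversible_transf[OF assms(2)] reversible_transf[OF *(1)]
    reversible_transf[OF *(4)]
  have "(U' \<otimes> V') \<cdot> (U \<otimes> V) = \<I> (A * C)" "(U \<otimes> V) \<cdot> (U' \<otimes> V') = \<I> (B * D)"
    using interchange[OF t(1,3,2,4)] interchange[OF t(3,1,4,2)] * par_ident by auto
  then show ?thesis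
    unfolding reversible_def using assms *(1,4) par_channel reversible_channel by blast
qed

lemma state_assoc: "\<lbrakk>C \<in> transf T A B; D \<in> transf T B E; \<rho> \<in> states T A\<rbrakk> \<Longrightarrow> (D \<cdot> C) \<cdot> \<rho> = D \<cdot> (C \<cdot> \<rho>)"
  unfolding states_eq by (rule seq_assoc)

lemma ident_state: "\<rho> \<in> states T A \<Longrightarrow> \<I> A \<cdot> \<rho> = \<rho>"
  unfolding states_eq by (rule seq_ident_left)

lemma reversible_cancel:
  assumes "V \<cdot> U = \<I> A" "U \<in> transf T A B" "V \<in> transf T B A" "\<rho> \<in> states T A"
  shows "V \<cdot> (U \<cdot> \<rho>) = \<rho>"
  using state_assoc[OF assms(2,3,4)] assms ident_state by simp

lemma reversible_pure_states:
  assumes "U \<in> reversible T A B" "\<phi> \<in> pure_states T A"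
  shows "U \<cdot> \<phi> \<in> pure_states T B"
proof (rule pure_states_I)
  show "U \<cdot> \<phi> \<in> normalised T B"
    using normalised_seq reversible_channel assms pure_states_normalised by blast
  fix y z assume yz: "y \<in> states T B" "z \<in> states T B" "U \<cdot> \<phi> = y + z"
  obtain V where V: "V \<in> reversible T B A" "V \<cdot> U = \<I> A" "U \<cdot> V = \<I> B" using reversible_inverse[OF assms(1)] by blast
  note t = reversible_transf[OF assms(1)] reversible_transf[OF V(1)] pure_states_state[OF assms(2)]
  have "\<phi> = V \<cdot> (U \<cdot> \<phi>)" using reversible_cancel[OF V(2) t] by simp
  also have "\<dots> = V \<cdot> y + V \<cdot> z" using yz(3) by (simp add: lin_simps)
  finally obtain c where c: "V \<cdot> y = c *\<^sub>R \<phi>"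
    using pure_state_split[OF pure_states_pure[OF assms(2)] state_seq[OF t(2) yz(1)] state_seq[OF t(2) yz(2)]] by blast
  have "U \<cdot> (V \<cdot> y) = y" by (rule reversible_cancel[OF V(3) t(2,1) yz(1)])
  then show "\<exists>c. y = c *\<^sub>R (U \<cdot> \<phi>)" using c by (auto simp: lin_simps)
qed

lemma pure_states_par: "\<lbrakk>\<phi> \<in> pure_states T A; \<psi> \<in> pure_states T B\<rbrakk> \<Longrightarrow> \<phi> \<otimes> \<psi> \<in> pure_states T (A * B)"
  using purity_par[of \<phi> 1 A \<psi> 1 B] normalised_par by (simp add: pure_states_iff)

section \<open>The cone of states, its faces, and pure components\<close>

definition state_cone :: "'a \<Rightarrow> 'b set" where
  "state_cone A = {c *\<^sub>R \<rho> | c \<rho>. 0 \<le> c \<and> \<rho> \<in> states T A}"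

lemma cone_weight: "x \<in> state_cone A \<Longrightarrow> 0 \<le> weight A x"
  by (auto simp: state_cone_def weight_simps weight_nonneg)

lemma states_cone: "\<rho> \<in> states T A \<Longrightarrow> \<rho> \<in> state_cone A"
  by (auto simp: state_cone_def intro: exI[of _ 1])

lemma cone_normalised: "x \<in> state_cone A \<Longrightarrow> \<exists>\<sigma> \<in> normalised T A. x = weight A x *\<^sub>R \<sigma>"
proof -
  assume "x \<in> state_cone A"
  then obtain c \<rho> where c: "x = c *\<^sub>R \<rho>" "0 \<le> c" "\<rho> \<in> states T A" by (auto simp: state_cone_def)
  obtain \<sigma> where "\<sigma> \<in> normalised T A" "\<rho> = weight A \<rho> *\<^sub>R \<sigma>" using state_rescale[OF c(3)] by blast
  moreover from this have "x = (c * weight A \<rho>) *\<^sub>R \<sigma>" using c(1) by (metis scaleR_scaleR)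
  ultimately show ?thesis using c(1) by (intro bexI[of _ \<sigma>]) (simp_all add: weight_simps normalised_weight)
qed

lemma cone_state: "\<lbrakk>x \<in> state_cone A; weight A x \<le> 1\<rbrakk> \<Longrightarrow> x \<in> states T A"
  using cone_normalised[of x A] cone_weight[of x A] scale_state normalised_state by metis

lemma cone_scale: "\<lbrakk>x \<in> state_cone A; 0 \<le> c\<rbrakk> \<Longrightarrow> c *\<^sub>R x \<in> state_cone A"
  by (force simp: state_cone_def)

lemma cone_add:
  assumes "x \<in> state_cone A" "y \<in> state_cone A"
  shows "x + y \<in> state_cone A"
proof -
  let ?k = "1 / (1 + weight A x + weight A y)"
  have w: "0 \<le> weight A x" "0 \<le> weight A y" using assms cone_weight by auto
  have "?k *\<^sub>R x \<in> states T A" "?k *\<^sub>R y \<in> states T A"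
    using assms w by (auto intro!: cone_state cone_scale simp: weight_simps divide_le_eq)
  moreover have "?k * weight A x + ?k * weight A y \<le> 1" using w by (simp add: add_divide_distrib[symmetric] divide_le_eq)
  ultimately have "?k *\<^sub>R x + ?k *\<^sub>R y \<in> states T A"
    by (intro add_states) (auto simp: weight_simps)
  then have "(1 + weight A x + weight A y) *\<^sub>R (?k *\<^sub>R x + ?k *\<^sub>R y) \<in> state_cone A"
    using w by (intro cone_scale states_cone) auto
  then show ?thesis using w by (simp add: scaleR_add_right[symmetric] del: scaleR_add_right)
qed

lemma cone_zero_weight: "\<lbrakk>x \<in> state_cone A; weight A x = 0\<rbrakk> \<Longrightarrow> x = 0"
  using cone_normalised by fastforce

text \<open>The admissible \<open>s\<close> form a closed set, which is bounded because weights are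
  nonnegative on the cone and \<open>x\<close> has positive weight.\<close>

lemma cone_max:
  assumes "y \<in> state_cone A" "x \<in> state_cone A" "x \<noteq> 0"
  shows "\<exists>s\<ge>0. y - s *\<^sub>R x \<in> state_cone A \<and> (\<forall>t>s. y - t *\<^sub>R x \<notin> state_cone A)"
proof -
  \<comment> \<open>Closedness is given for the set of states; this factor brings
    \<open>y - s *\<^sub>R x\<close>, when it is in the cone and \<open>s\<close> is nonnegative,
    back into that set.\<close>
  let ?k = "1 / (1 + weight A y)"
  have wy: "0 \<le> weight A y" and wx: "0 < weight A x"
    using assms cone_weight cone_zero_weight by (auto simp: less_le)
  define J where "J = {s. 0 \<le> s \<and> ?k *\<^sub>R (y - s *\<^sub>R x) \<in> states T A}"
  have J: "s \<in> J \<longleftrightarrow> 0 \<le> s \<and> y - s *\<^sub>R x \<in> state_cone A" for s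
  proof -
    have "y - s *\<^sub>R x \<in> state_cone A" if "?k *\<^sub>R (y - s *\<^sub>R x) \<in> states T A"
      using cone_scale[OF states_cone[OF that], of "1 + weight A y"] wy by simp
    moreover have "?k *\<^sub>R (y - s *\<^sub>R x) \<in> states T A" if "y - s *\<^sub>R x \<in> state_cone A" "0 \<le> s"
    proof (rule cone_state[OF cone_scale[OF that(1)]])
      have "weight A y - s * weight A x \<le> 1 + weight A y" using that(2) wx by (simp add: add.commute add_increasing)
      then show "weight A (?k *\<^sub>R (y - s *\<^sub>R x)) \<le> 1" using wy by (simp add: weight_simps divide_le_eq)
    qed (use wy in simp)
    ultimately show ?thesis by (auto simp: J_def)
  qed
  have "closed J"
  proof -
    have "closed (states T A)" by (simp add: states_eq closed_transf)
    then have "closed ((\<lambda>s. ?k *\<^sub>R (y - s *\<^sub>R x)) -` states T A)"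
      by (rule closed_vimage) (intro continuous_intros)
    then have "closed ({0..} \<inter> ((\<lambda>s. ?k *\<^sub>R (y - s *\<^sub>R x)) -` states T A))" by (intro closed_Int) auto
    moreover have "J = {0..} \<inter> ((\<lambda>s. ?k *\<^sub>R (y - s *\<^sub>R x)) -` states T A)" by (auto simp: J_def)
    ultimately show ?thesis by simp
  qed
  moreover have "0 \<in> J" using assms(1) by (simp add: J)
  moreover have bdd: "bdd_above J"
  proof (rule bdd_aboveI)
    fix s assume "s \<in> J"
    then have "0 \<le> weight A y - s * weight A x" using cone_weight[of "y - s *\<^sub>R x" A] by (simp add: J weight_simps)
    then show "s \<le> weight A y / weight A x" using wx by (simp add: field_simps)
  qed
  ultimately have "Sup J \<in> J" by (intro closed_contains_Sup) auto
  moreover have "t \<le> Sup J" if "0 \<le> t" "y - t *\<^sub>R x \<in> state_cone A" for t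
    using cSup_upper[OF _ bdd, of t] that by (simp add: J)
  ultimately show ?thesis
    unfolding J by (metis less_le_not_le order_trans)
qed

text \<open>For \<open>y\<close> in the cone, the smallest face that contains
  \<open>y\<close>.\<close>

definition face :: "'a \<Rightarrow> 'b \<Rightarrow> 'b set" where
  "face A y = {x \<in> state_cone A. \<exists>r>0. y - r *\<^sub>R x \<in> state_cone A}"

lemma face_add:
  assumes "x1 \<in> face A y" "x2 \<in> face A y"
  shows "x1 + x2 \<in> face A y"
proof -
  obtain r1 r2 where r: "r1 > 0" "y - r1 *\<^sub>R x1 \<in> state_cone A" "r2 > 0" "y - r2 *\<^sub>R x2 \<in> state_cone A"
    "x1 \<in> state_cone A" "x2 \<in> state_cone A" using assms by (auto simp: face_def)
  \<comment> \<open>Half the harmonic mean of \<open>r1\<close> and \<open>r2\<close>: it makes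
    \<open>y - r *\<^sub>R (x1 + x2)\<close> a convex combination of
    \<open>y - r1 *\<^sub>R x1\<close> and \<open>y - r2 *\<^sub>R x2\<close>.\<close>
  define r where "r = r1 * r2 / (r1 + r2)"
  have rp: "r > 0" using r by (simp add: r_def add_pos_pos)
  have "y - r *\<^sub>R (x1 + x2) = (r2 / (r1 + r2)) *\<^sub>R (y - r1 *\<^sub>R x1) + (r1 / (r1 + r2)) *\<^sub>R (y - r2 *\<^sub>R x2)"
  proof -
    have "r2 / (r1 + r2) + r1 / (r1 + r2) = 1" using r by (simp add: add_divide_distrib[symmetric])
    then have "y = (r2 / (r1 + r2)) *\<^sub>R y + (r1 / (r1 + r2)) *\<^sub>R y"
      by (metis scaleR_add_left scaleR_one)
    then show ?thesis by (simp add: r_def algebra_simps)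
  qed
  also have "\<dots> \<in> state_cone A" using r by (intro cone_add cone_scale) auto
  finally show ?thesis using rp r cone_add by (auto simp: face_def)
qed

lemma face_scale: "\<lbrakk>x \<in> face A y; 0 \<le> c\<rbrakk> \<Longrightarrow> c *\<^sub>R x \<in> face A y"
proof -
  assume *: "x \<in> face A y" "0 \<le> c"
  then obtain r where r: "r > 0" "y - r *\<^sub>R x \<in> state_cone A" "x \<in> state_cone A" by (auto simp: face_def)
  show ?thesis
  proof (cases "c = 0")
    case True
    have "y = (y - r *\<^sub>R x) + r *\<^sub>R x" by simp
    then have "y \<in> state_cone A" using r by (metis cone_add cone_scale less_imp_le)
    then show ?thesis using True r(3) cone_scale[OF r(3), of 0] by (auto simp: face_def intro: exI[of _ 1])
  next
    case False
    then have "r / c > 0" "y - (r / c) *\<^sub>R (c *\<^sub>R x) \<in> state_cone A" using * r by auto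
    then show ?thesis using cone_scale[OF r(3) *(2)] unfolding face_def by blast
  qed
qed

text \<open>Elements of the span are differences \<open>f - g\<close> of elements of the face. Since
  \<open>g\<close> lies in the cone, a multiple that can be subtracted from \<open>y\<close> for
  \<open>f\<close> can be subtracted for \<open>f - g\<close> as well. Hence an element of the cone
  outside the face is linearly independent of it.\<close>

lemma face_span:
  assumes "x \<in> state_cone A" "x \<in> span (face A y)" "y \<in> state_cone A"
  shows "x \<in> face A y"
proof -
  have z: "0 \<in> face A y" using assms(3) states_cone[OF zero_state] by (auto simp: face_def intro: exI[of _ 1])
  have "\<exists>f\<in>face A y. \<exists>g\<in>face A y. x = f - g"
    using assms(2)
  proof (induction rule: span_induct_alt)
    case base
    then show ?case using z by (intro bexI[of _ 0]) auto
  next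
    case (step c x v)
    then obtain f g where fg: "f \<in> face A y" "g \<in> face A y" "v = f - g" by blast
    show ?case
    proof (cases "c \<ge> 0")
      case True
      then have "c *\<^sub>R x + v = (c *\<^sub>R x + f) - g" "c *\<^sub>R x + f \<in> face A y"
        using fg step(1) by (auto intro: face_add face_scale)
      then show ?thesis using fg(2) by blast
    next
      case False
      then have "(- c) *\<^sub>R x + g \<in> face A y" using fg step(1) by (intro face_add face_scale) auto
      moreover have "c *\<^sub>R x + v = f - ((- c) *\<^sub>R x + g)" using fg(3) by simp
      ultimately show ?thesis using fg(1) by blast
    qed
  qed
  then obtain f g where fg: "f \<in> face A y" "g \<in> face A y" "x = f - g" by blast
  then obtain r where r: "r > 0" "y - r *\<^sub>R f \<in> state_cone A" "g \<in> state_cone A" by (auto simp: face_def)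
  have "y - r *\<^sub>R x = (y - r *\<^sub>R f) + r *\<^sub>R g" unfolding fg(3) by (simp add: scaleR_diff_right)
  also have "\<dots> \<in> state_cone A" using r by (intro cone_add cone_scale) auto
  finally show ?thesis using assms(1) r(1) by (auto simp: face_def)
qed

text \<open>Descent to a face of smaller dimension: subtract a component that is not proportional to the
  given element until the boundary of the cone is reached.\<close>

lemma cone_pure_component:
  assumes "y \<in> state_cone A" "y \<noteq> 0"
    and "\<And>S. \<lbrakk>finite S; independent S; S \<subseteq> face A y\<rbrakk> \<Longrightarrow> card S \<le> n"
  shows "\<exists>\<phi> \<in> pure_states T A. \<exists>r>0. y - r *\<^sub>R \<phi> \<in> state_cone A"
  using assms
proof (induction n arbitrary: y rule: less_induct)
  case (less n)
  obtain \<sigma> where \<sigma>: "\<sigma> \<in> normalised T A" "y = weight A y *\<^sub>R \<sigma>" using cone_normalised[OF less.prems(1)] by blast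
  have wy: "0 < weight A y"
    using cone_weight[OF less.prems(1)] cone_zero_weight[OF less.prems(1)] less.prems(2) by (auto simp: less_le)
  show ?case
  proof (cases "\<sigma> \<in> pure_states T A")
    case True
    then show ?thesis using \<sigma>(2) wy states_cone[OF zero_state]
      by (intro bexI[of _ \<sigma>] exI[of _ "weight A y"]) auto
  next
    case False
    then obtain x1 x2 where x: "x1 \<in> states T A" "x2 \<in> states T A" "\<sigma> = x1 + x2" "\<forall>c. x1 \<noteq> c *\<^sub>R \<sigma>"
      using pure_states_I[OF \<sigma>(1)] by blast
    have nprop: "x1 \<noteq> c *\<^sub>R y" for c
    proof
      assume "x1 = c *\<^sub>R y"
      then have "x1 = (c * weight A y) *\<^sub>R \<sigma>" using \<sigma>(2) by (metis scaleR_scaleR)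
      then show False using x(4) by blast
    qed
    have x1: "x1 \<in> state_cone A" "x1 \<noteq> 0" using states_cone[OF x(1)] nprop[of 0] by auto
    obtain s where s: "s \<ge> 0" "y - s *\<^sub>R x1 \<in> state_cone A" "\<forall>t>s. y - t *\<^sub>R x1 \<notin> state_cone A"
      using cone_max[OF less.prems(1) x1] by blast
    define \<omega> where "\<omega> = y - s *\<^sub>R x1"
    have \<omega>0: "\<omega> \<noteq> 0"
    proof
      assume "\<omega> = 0"
      then have "y = s *\<^sub>R x1" by (simp add: \<omega>_def)
      moreover from this have "s \<noteq> 0" using less.prems(2) by auto
      ultimately have "x1 = (1 / s) *\<^sub>R y" by simp
      then show False using nprop by blast
    qed
    have \<omega>: "\<omega> \<in> state_cone A" using s by (simp add: \<omega>_def)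
    \<comment> \<open>By maximality of \<open>s\<close> nothing more of \<open>x1\<close> can be
      removed, so \<open>x1\<close> has left the face and, by \<open>face_span\<close>, its
      span.\<close>
    have "x1 \<notin> face A \<omega>"
    proof
      assume "x1 \<in> face A \<omega>"
      then obtain r where "r > 0" "\<omega> - r *\<^sub>R x1 \<in> state_cone A" by (auto simp: face_def)
      then have "y - (s + r) *\<^sub>R x1 \<in> state_cone A" by (simp add: \<omega>_def algebra_simps)
      then show False using s(3) \<open>r > 0\<close> by auto
    qed
    then have nspan: "x1 \<notin> span (face A \<omega>)" using face_span x1(1) \<omega> by blast
    have sub: "face A \<omega> \<subseteq> face A y"
    proof
      fix v assume "v \<in> face A \<omega>"
      then obtain r where r: "r > 0" "\<omega> - r *\<^sub>R v \<in> state_cone A" "v \<in> state_cone A" by (auto simp: face_def)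
      have "y - r *\<^sub>R v = (\<omega> - r *\<^sub>R v) + s *\<^sub>R x1" by (simp add: \<omega>_def)
      also have "\<dots> \<in> state_cone A" using r s x1 by (intro cone_add cone_scale) auto
      finally show "v \<in> face A y" using r by (auto simp: face_def)
    qed
    have x1y: "x1 \<in> face A y"
    proof -
      have "y - weight A y *\<^sub>R x1 = weight A y *\<^sub>R x2"
        using \<sigma>(2) x(3) by (metis add_diff_cancel_left' scaleR_right_diff_distrib)
      then show ?thesis using x1(1) wy cone_scale[OF states_cone[OF x(2)], of "weight A y"]
        unfolding face_def by auto
    qed
    have bound: "Suc (card S) \<le> n" if S: "finite S" "independent S" "S \<subseteq> face A \<omega>" for S
    proof -
      have "x1 \<notin> span S" using nspan span_mono[OF S(3)] by blast
      then have "independent (insert x1 S)" "x1 \<notin> S" using S(2) span_base by (auto simp: independent_insert)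
      then show ?thesis using less.prems(3)[of "insert x1 S"] S sub x1y by auto
    qed
    \<comment> \<open>The empty set in \<open>bound\<close> shows that \<open>n\<close> is positive,
      so the subtraction of natural numbers is a real decrease.\<close>
    have "n - 1 < n" using bound[OF finite.emptyI independent_empty] by simp
    moreover have "card S \<le> n - 1" if "finite S" "independent S" "S \<subseteq> face A \<omega>" for S
      using bound[OF that] by simp
    ultimately obtain \<phi> r where \<phi>: "\<phi> \<in> pure_states T A" "r > 0" "\<omega> - r *\<^sub>R \<phi> \<in> state_cone A"
      using less.IH[OF _ \<omega> \<omega>0] by blast
    have "y - r *\<^sub>R \<phi> = (\<omega> - r *\<^sub>R \<phi>) + s *\<^sub>R x1" by (simp add: \<omega>_def)
    also have "\<dots> \<in> state_cone A" using \<phi> s x1 by (intro cone_add cone_scale) auto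
    finally show ?thesis using \<phi> by blast
  qed
qed

lemma pure_component:
  assumes "\<rho> \<in> states T A" "\<rho> \<noteq> 0"
  shows "\<exists>\<phi> \<in> pure_states T A. \<exists>r>0. \<rho> - r *\<^sub>R \<phi> \<in> states T A"
proof -
  obtain F where F: "finite F" "transf T 1 A \<subseteq> span F" using finite_dimensional by blast
  have "state_cone A \<subseteq> span F" using F(2) by (auto simp: state_cone_def states_eq intro!: span_scale)
  then have "card S \<le> card F" if "finite S" "independent S" "S \<subseteq> face A \<rho>" for S
    using independent_span_bound[OF F(1) that(2)] that(3) by (auto simp: face_def)
  then obtain \<phi> r where \<phi>: "\<phi> \<in> pure_states T A" "r > 0" "\<rho> - r *\<^sub>R \<phi> \<in> state_cone A"
    using cone_pure_component[OF states_cone[OF assms(1)] assms(2), of "card F"] by blast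
  have "weight A (\<rho> - r *\<^sub>R \<phi>) \<le> 1"
    using weight_le_1[OF assms(1)] \<phi>(2) pure_states_normalised[OF \<phi>(1)]
    by (simp add: weight_simps normalised_weight)
  then show ?thesis using \<phi> cone_state by blast
qed

lemma ex_pure_state: "\<exists>\<phi>. \<phi> \<in> pure_states T A"
proof -
  obtain \<rho> where \<rho>: "\<rho> \<in> normalised T A" using ex_normalised by blast
  then have "\<rho> \<noteq> 0" by (auto simp: normalised_weight weight_simps)
  then show ?thesis using pure_component[OF normalised_state[OF \<rho>]] by blast
qed

text \<open>Pure states of \<open>A\<close> are purifications, with purifying system
  \<open>A\<close>, of the one normalised state of the trivial system; uniqueness of purification
  relates any two of them.\<close>

lemma transitivity:
  assumes "\<phi> \<in> pure_states T A" "\<psi> \<in> pure_states T A"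
  shows "\<exists>U \<in> reversible T A A. \<psi> = U \<cdot> \<phi>"
proof -
  have m: "marginal1 T 1 A \<omega> = \<I> 1" if "\<omega> \<in> pure_states T A" for \<omega>
  proof -
    have "\<omega> \<in> channels T 1 A" using pure_states_normalised[OF that] by (simp add: normalised_channel)
    from discard_seq[OF this] show ?thesis
      by (simp add: marginal1_def par_unit_left[OF discard_transf] discard_unit)
  qed
  obtain U where U: "U \<in> reversible T A A" "\<psi> = (\<I> 1 \<otimes> U) \<cdot> \<phi>"
    using purification_unique[of \<phi> 1 A \<psi>] assms m by auto
  then show ?thesis using par_unit_left[OF reversible_transf[OF U(1)]] by auto
qed

section \<open>Marginals and steering\<close>

lemma par_states:
  "\<lbrakk>C \<in> transf T A A'; D \<in> transf T B B'; \<rho> \<in> states T A; \<sigma> \<in> states T B\<rbrakk>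
    \<Longrightarrow> (C \<otimes> D) \<cdot> (\<rho> \<otimes> \<sigma>) = (C \<cdot> \<rho>) \<otimes> (D \<cdot> \<sigma>)"
  unfolding states_eq by (rule interchange)

lemma unit_state: "\<I> 1 \<in> states T 1"
  by (simp add: states_eq ident_transf)

lemma append_right: "\<lbrakk>\<rho> \<in> states T A; \<gamma> \<in> states T C\<rbrakk> \<Longrightarrow> (\<I> A \<otimes> \<gamma>) \<cdot> \<rho> = \<rho> \<otimes> \<gamma>"
  using par_states[OF ident_transf _ _ unit_state, of \<gamma> C \<rho> A] par_unit_right[of \<rho> 1 A]
  by (simp add: states_eq ident_state[unfolded states_eq] seq_ident_right)

lemma append_left: "\<lbrakk>\<rho> \<in> states T A; \<gamma> \<in> states T C\<rbrakk> \<Longrightarrow> (\<gamma> \<otimes> \<I> A) \<cdot> \<rho> = \<gamma> \<otimes> \<rho>"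
  using par_states[OF _ ident_transf unit_state, of \<gamma> C \<rho> A] par_unit_left[of \<rho> 1 A]
  by (simp add: states_eq ident_state[unfolded states_eq] seq_ident_right)

lemma ident_par_assoc: "C \<in> transf T B B' \<Longrightarrow> \<I> (A * A') \<otimes> C = \<I> A \<otimes> (\<I> A' \<otimes> C)"
  and par_ident_assoc: "C \<in> transf T B B' \<Longrightarrow> C \<otimes> \<I> (A * A') = (C \<otimes> \<I> A) \<otimes> \<I> A'"
  using par_assoc[OF ident_transf ident_transf, of C B B' A A']
    par_assoc[OF _ ident_transf ident_transf, of C B B' A A'] by (simp_all add: par_ident)

lemma seq_par_right: "\<lbrakk>C \<in> transf T B B'; D \<in> transf T B' B''; \<Psi> \<in> states T (A * B)\<rbrakk>
    \<Longrightarrow> (\<I> A \<otimes> D) \<cdot> ((\<I> A \<otimes> C) \<cdot> \<Psi>) = (\<I> A \<otimes> (D \<cdot> C)) \<cdot> \<Psi>"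
  using par_seq[OF ident_transf ident_transf, of C B B' D B'' \<Psi> 1 A] seq_ident_left[OF ident_transf]
  by (simp add: states_eq)

lemma seq_par_left: "\<lbrakk>C \<in> transf T A A'; D \<in> transf T A' A''; \<Psi> \<in> states T (A * B)\<rbrakk>
    \<Longrightarrow> (D \<otimes> \<I> B) \<cdot> ((C \<otimes> \<I> B) \<cdot> \<Psi>) = ((D \<cdot> C) \<otimes> \<I> B) \<cdot> \<Psi>"
  using par_seq[OF _ _ ident_transf ident_transf, of C A A' D A'' \<Psi> 1 B] seq_ident_left[OF ident_transf]
  by (simp add: states_eq)

lemma par_left_right: "\<lbrakk>C \<in> transf T A A'; D \<in> transf T B B'; \<Psi> \<in> states T (A * B)\<rbrakk>
    \<Longrightarrow> (C \<otimes> \<I> B') \<cdot> ((\<I> A \<otimes> D) \<cdot> \<Psi>) = (C \<otimes> D) \<cdot> \<Psi>"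
  using par_seq[OF ident_transf _ _ ident_transf, of C A A' D B B' \<Psi> 1]
  by (simp add: states_eq seq_ident_left seq_ident_right)

lemma par_right_left: "\<lbrakk>C \<in> transf T A A'; D \<in> transf T B B'; \<Psi> \<in> states T (A * B)\<rbrakk>
    \<Longrightarrow> (\<I> A' \<otimes> D) \<cdot> ((C \<otimes> \<I> B) \<cdot> \<Psi>) = (C \<otimes> D) \<cdot> \<Psi>"
  using par_seq[OF _ ident_transf ident_transf, of C A A' D B B' \<Psi> 1]
  by (simp add: states_eq seq_ident_left seq_ident_right)

lemma par_seq_state: "\<lbrakk>C \<in> transf T A A'; E \<in> transf T A' A''; D \<in> transf T B B'; F \<in> transf T B' B'';
    \<Psi> \<in> states T (A * B)\<rbrakk> \<Longrightarrow> (E \<otimes> F) \<cdot> ((C \<otimes> D) \<cdot> \<Psi>) = ((E \<cdot> C) \<otimes> (F \<cdot> D)) \<cdot> \<Psi>"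
  unfolding states_eq by (rule par_seq)

lemma par_state: "\<lbrakk>C \<in> transf T A A'; D \<in> transf T B B'; \<Psi> \<in> states T (A * B)\<rbrakk>
    \<Longrightarrow> (C \<otimes> D) \<cdot> \<Psi> \<in> states T (A' * B')"
  by (rule state_seq[OF par_transf])

lemma swap_par: "\<lbrakk>C \<in> transf T A A'; D \<in> transf T B B'; \<Psi> \<in> states T (A * B)\<rbrakk>
    \<Longrightarrow> swap T A' B' \<cdot> ((C \<otimes> D) \<cdot> \<Psi>) = (D \<otimes> C) \<cdot> (swap T A B \<cdot> \<Psi>)"
  using state_assoc[OF par_transf swap_transf, of C A A' D B B' \<Psi>]
    state_assoc[OF swap_transf par_transf, of D B B' C A A' \<Psi>] swap_natural[of C A A' D B B'] by simp

lemma swap_swap_state: "\<Psi> \<in> states T (A * B) \<Longrightarrow> swap T B A \<cdot> (swap T A B \<cdot> \<Psi>) = \<Psi>"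
  by (rule reversible_cancel[OF swap_swap swap_transf swap_transf])

lemma swap_state: "\<Psi> \<in> states T (A * B) \<Longrightarrow> swap T A B \<cdot> \<Psi> \<in> states T (B * A)"
  by (rule state_seq[OF swap_transf])

lemma swap_pure_states: "\<Psi> \<in> pure_states T (A * B) \<Longrightarrow> swap T A B \<cdot> \<Psi> \<in> pure_states T (B * A)"
  by (rule reversible_pure_states[OF reversible_swap])

lemma swap_product: "\<lbrakk>\<rho> \<in> states T A; \<sigma> \<in> states T B\<rbrakk> \<Longrightarrow> swap T A B \<cdot> (\<rho> \<otimes> \<sigma>) = \<sigma> \<otimes> \<rho>"
  unfolding states_eq by (rule swap_states)

lemma marginal1_state: "\<Psi> \<in> states T (A * B) \<Longrightarrow> marginal1 T A B \<Psi> \<in> states T A"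
  and marginal2_state: "\<Psi> \<in> states T (A * B) \<Longrightarrow> marginal2 T A B \<Psi> \<in> states T B"
  unfolding marginal1_def marginal2_def
  using par_state[OF ident_transf discard_transf, of \<Psi> A B] par_state[OF discard_transf ident_transf, of \<Psi> A B]
  by simp_all

lemma marginal1_normalised: "\<Psi> \<in> normalised T (A * B) \<Longrightarrow> marginal1 T A B \<Psi> \<in> normalised T A"
  and marginal2_normalised: "\<Psi> \<in> normalised T (A * B) \<Longrightarrow> marginal2 T A B \<Psi> \<in> normalised T B"
  unfolding marginal1_def marginal2_def
  using normalised_seq[OF par_channel[OF ident_channel discard_channel], of \<Psi> A B]
    normalised_seq[OF par_channel[OF discard_channel ident_channel], of \<Psi> A B] by simp_all

lemma linear_marginal1: "linear (marginal1 T A B)" and linear_marginal2: "linear (marginal2 T A B)"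
  unfolding marginal1_def marginal2_def by (rule linear_seq_right)+

lemmas marginal_simps = linear_add[OF linear_marginal1] linear_scale[OF linear_marginal1]
  linear_0[OF linear_marginal1] linear_diff[OF linear_marginal1]
  linear_add[OF linear_marginal2] linear_scale[OF linear_marginal2]
  linear_0[OF linear_marginal2] linear_diff[OF linear_marginal2]

lemma marginal_sum_list: "marginal1 T A B (sum_list xs) = (\<Sum>x\<leftarrow>xs. marginal1 T A B x)"
  by (induction xs) (auto simp: marginal_simps)

lemma marginal1_par:
  assumes "C \<in> transf T A A'" "D \<in> channels T B B'" "\<Psi> \<in> states T (A * B)"
  shows "marginal1 T A' B' ((C \<otimes> D) \<cdot> \<Psi>) = C \<cdot> marginal1 T A B \<Psi>"
proof -
  have "marginal1 T A' B' ((C \<otimes> D) \<cdot> \<Psi>) = (C \<otimes> \<u> B) \<cdot> \<Psi>"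
    unfolding marginal1_def
    using par_seq_state[OF assms(1) ident_transf channel_transf[OF assms(2)] discard_transf assms(3)]
      seq_ident_left[OF assms(1)] discard_seq[OF assms(2)] by simp
  also have "\<dots> = C \<cdot> marginal1 T A B \<Psi>"
    unfolding marginal1_def
    using par_left_right[OF assms(1) discard_transf assms(3)] par_unit_right[OF assms(1)] by simp
  finally show ?thesis .
qed

lemma marginal2_par:
  assumes "C \<in> channels T A A'" "D \<in> transf T B B'" "\<Psi> \<in> states T (A * B)"
  shows "marginal2 T A' B' ((C \<otimes> D) \<cdot> \<Psi>) = D \<cdot> marginal2 T A B \<Psi>"
proof -
  have "marginal2 T A' B' ((C \<otimes> D) \<cdot> \<Psi>) = (\<u> A \<otimes> D) \<cdot> \<Psi>"
    unfolding marginal2_def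
    using par_seq_state[OF channel_transf[OF assms(1)] discard_transf assms(2) ident_transf assms(3)]
      seq_ident_left[OF assms(2)] discard_seq[OF assms(1)] by simp
  also have "\<dots> = D \<cdot> marginal2 T A B \<Psi>"
    unfolding marginal2_def
    using par_right_left[OF discard_transf assms(2,3)] par_unit_left[OF assms(2)] by simp
  finally show ?thesis .
qed

lemma marginal1_swap:
  assumes "\<Psi> \<in> states T (A * B)"
  shows "marginal1 T B A (swap T A B \<cdot> \<Psi>) = marginal2 T A B \<Psi>"
  using swap_par[OF discard_transf ident_transf assms] marginal2_state[OF assms]
  by (simp add: marginal1_def marginal2_def swap_unit_left ident_state)

lemma marginal2_swap:
  assumes "\<Psi> \<in> states T (A * B)"
  shows "marginal2 T B A (swap T A B \<cdot> \<Psi>) = marginal1 T A B \<Psi>"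
  using swap_par[OF ident_transf discard_transf assms] marginal1_state[OF assms]
  by (simp add: marginal1_def marginal2_def swap_unit_right ident_state)

lemma discard_state: "\<sigma> \<in> states T B \<Longrightarrow> \<u> B \<cdot> \<sigma> = weight B \<sigma> *\<^sub>R \<I> 1"
  unfolding weight_def states_eq by (rule seq_effect_state[OF discard_transf])

lemma marginal1_product:
  "\<lbrakk>\<rho> \<in> states T A; \<sigma> \<in> states T B\<rbrakk> \<Longrightarrow> marginal1 T A B (\<rho> \<otimes> \<sigma>) = weight B \<sigma> *\<^sub>R \<rho>"
  unfolding marginal1_def
  using par_states[OF ident_transf discard_transf, of \<rho> A \<sigma> B] par_unit_right[of \<rho> 1 A]
  by (simp add: discard_state lin_simps ident_state states_eq[symmetric])

lemma marginal2_product: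
  "\<lbrakk>\<rho> \<in> states T A; \<sigma> \<in> states T B\<rbrakk> \<Longrightarrow> marginal2 T A B (\<rho> \<otimes> \<sigma>) = weight A \<rho> *\<^sub>R \<sigma>"
  unfolding marginal2_def
  using par_states[OF discard_transf ident_transf, of \<rho> A \<sigma> B] par_unit_left[of \<sigma> 1 B]
  by (simp add: discard_state lin_simps ident_state states_eq[symmetric])

lemma marginal1_assoc:
  assumes "\<Psi> \<in> states T (A * (B * C))"
  shows "marginal1 T A (B * C) \<Psi> = marginal1 T A B (marginal1 T (A * B) C \<Psi>)"
proof -
  have t: "\<I> A \<otimes> \<u> B \<in> transf T (A * B) A"
    using par_transf[OF ident_transf discard_transf, of A B] by simp
  have "(\<I> A \<otimes> \<u> B) \<cdot> ((\<I> (A * B) \<otimes> \<u> C) \<cdot> \<Psi>) = ((\<I> A \<otimes> \<u> B) \<otimes> \<u> C) \<cdot> \<Psi>"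
    using par_left_right[OF t discard_transf, of \<Psi> C] assms par_unit_right[OF t] by (simp add: mult.assoc)
  then show ?thesis
    unfolding marginal1_def discard_par using par_assoc[OF ident_transf discard_transf discard_transf] by simp
qed

lemma purification_unique_left:
  assumes "\<Psi> \<in> pure_states T (A * B)" "\<Psi>' \<in> pure_states T (A * B)"
    and "marginal2 T A B \<Psi> = marginal2 T A B \<Psi>'"
  shows "\<exists>U \<in> reversible T A A. \<Psi>' = (U \<otimes> \<I> B) \<cdot> \<Psi>"
proof -
  note s = pure_states_state[OF assms(1)] pure_states_state[OF assms(2)]
  obtain U where U: "U \<in> reversible T A A" "swap T A B \<cdot> \<Psi>' = (\<I> B \<otimes> U) \<cdot> (swap T A B \<cdot> \<Psi>)"
    using purification_unique[OF swap_pure_states[OF assms(1)] swap_pure_states[OF assms(2)]]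
      marginal1_swap[OF s(1)] marginal1_swap[OF s(2)] assms(3) by auto
  have "\<Psi>' = swap T B A \<cdot> (swap T A B \<cdot> \<Psi>')" by (simp add: swap_swap_state s)
  also have "\<dots> = (U \<otimes> \<I> B) \<cdot> (swap T B A \<cdot> (swap T A B \<cdot> \<Psi>))"
    unfolding U(2) by (rule swap_par[OF ident_transf reversible_transf[OF U(1)] swap_state[OF s(1)]])
  finally show ?thesis using U(1) by (auto simp: swap_swap_state s)
qed

text \<open>Two purifications of one state with different purifying systems \<open>B\<close> and \<open>C\<close>: padding both
  with pure states makes the purifying systems equal up to a swap.\<close>

lemma purification_connect:
  assumes \<Psi>: "\<Psi> \<in> pure_states T (A * B)" and \<Psi>': "\<Psi>' \<in> pure_states T (A * C)"
    and m: "marginal1 T A B \<Psi> = marginal1 T A C \<Psi>'"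
    and \<gamma>: "\<gamma> \<in> pure_states T C" and \<beta>: "\<beta> \<in> pure_states T B"
  shows "\<exists>U \<in> reversible T (B * C) (C * B). (\<I> A \<otimes> U) \<cdot> (\<Psi> \<otimes> \<gamma>) = \<Psi>' \<otimes> \<beta>"
proof -
  note s = pure_states_state[OF \<Psi>] pure_states_state[OF \<Psi>'] pure_states_state[OF \<gamma>] pure_states_state[OF \<beta>]
  have p: "\<Psi> \<otimes> \<gamma> \<in> pure_states T (A * (B * C))" "\<Psi>' \<otimes> \<beta> \<in> pure_states T (A * (C * B))"
    using pure_states_par[OF \<Psi> \<gamma>] pure_states_par[OF \<Psi>' \<beta>] by (simp_all add: mult.assoc)
  note ps = pure_states_state[OF p(1)] pure_states_state[OF p(2)]
  let ?\<Omega> = "(\<I> A \<otimes> swap T C B) \<cdot> (\<Psi>' \<otimes> \<beta>)"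
  have \<Omega>: "?\<Omega> \<in> pure_states T (A * (B * C))"
    by (rule reversible_pure_states[OF reversible_par[OF reversible_ident reversible_swap] p(2)])
  have w: "weight C \<gamma> = 1" "weight B \<beta> = 1"
    using \<gamma> \<beta> pure_states_normalised by (auto simp: normalised_weight)
  have "marginal1 T A (B * C) (\<Psi> \<otimes> \<gamma>) = marginal1 T A B \<Psi>"
    using marginal1_assoc[OF ps(1)] marginal1_product[OF s(1,3)] w by simp
  moreover have "marginal1 T A (B * C) ?\<Omega> = marginal1 T A C \<Psi>'"
    using marginal1_par[OF ident_transf swap_channel ps(2)] marginal1_assoc[OF ps(2)]
      marginal1_product[OF s(2,4)] w ident_state[OF marginal1_state[OF s(2)]] by simp
  ultimately obtain V where V: "V \<in> reversible T (B * C) (B * C)" "?\<Omega> = (\<I> A \<otimes> V) \<cdot> (\<Psi> \<otimes> \<gamma>)"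
    using purification_unique[OF p(1) \<Omega>] m by auto
  have "(\<I> A \<otimes> (swap T B C \<cdot> V)) \<cdot> (\<Psi> \<otimes> \<gamma>) = (\<I> A \<otimes> swap T B C) \<cdot> ?\<Omega>"
    unfolding V(2) by (rule seq_par_right[symmetric, OF reversible_transf[OF V(1)] swap_transf ps(1)])
  also have "\<dots> = (\<I> A \<otimes> \<I> (C * B)) \<cdot> (\<Psi>' \<otimes> \<beta>)"
    using seq_par_right[OF swap_transf swap_transf ps(2)] swap_swap by simp
  also have "\<dots> = \<Psi>' \<otimes> \<beta>" using ident_state[OF ps(2)] by (simp add: par_ident)
  finally show ?thesis using reversible_seq[OF V(1) reversible_swap] by blast
qed

text \<open>Append the pure state \<open>\<gamma>\<close>, apply the reversible channel of
  \<open>purification_connect\<close>, and discard \<open>B\<close>.\<close>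

lemma purification_channel:
  assumes \<Psi>: "\<Psi> \<in> pure_states T (A * B)" and \<Psi>': "\<Psi>' \<in> pure_states T (A * C)"
    and m: "marginal1 T A B \<Psi> = marginal1 T A C \<Psi>'"
  shows "\<exists>C' \<in> channels T B C. (\<I> A \<otimes> C') \<cdot> \<Psi> = \<Psi>'"
proof -
  obtain \<gamma> \<beta> where \<gamma>: "\<gamma> \<in> pure_states T C" and \<beta>: "\<beta> \<in> pure_states T B" using ex_pure_state by meson
  note s = pure_states_state[OF \<Psi>] pure_states_state[OF \<Psi>'] pure_states_state[OF \<gamma>] pure_states_state[OF \<beta>]
  obtain U where U: "U \<in> reversible T (B * C) (C * B)" "(\<I> A \<otimes> U) \<cdot> (\<Psi> \<otimes> \<gamma>) = \<Psi>' \<otimes> \<beta>"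
    using purification_connect[OF assms \<gamma> \<beta>] by blast
  have g: "\<gamma> \<in> channels T 1 C" using pure_states_normalised[OF \<gamma>] by (simp add: normalised_channel)
  have c1: "\<I> B \<otimes> \<gamma> \<in> channels T B (B * C)" using par_channel[OF ident_channel g, of B] by simp
  have c2: "\<I> C \<otimes> \<u> B \<in> channels T (C * B) C" using par_channel[OF ident_channel discard_channel, of C B] by simp
  note t = channel_transf[OF c1] reversible_transf[OF U(1)] channel_transf[OF c2]
  let ?C = "(\<I> C \<otimes> \<u> B) \<cdot> (U \<cdot> (\<I> B \<otimes> \<gamma>))"
  have a1: "(\<I> A \<otimes> (\<I> B \<otimes> \<gamma>)) \<cdot> \<Psi> = \<Psi> \<otimes> \<gamma>"
    using append_right[OF s(1,3)] ident_par_assoc[of \<gamma> 1 C A B] s(3) by (simp add: states_eq)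
  have "(\<I> A \<otimes> ?C) \<cdot> \<Psi> = (\<I> A \<otimes> (\<I> C \<otimes> \<u> B)) \<cdot> ((\<I> A \<otimes> U) \<cdot> ((\<I> A \<otimes> (\<I> B \<otimes> \<gamma>)) \<cdot> \<Psi>))"
    using seq_par_right[OF t(1,2) s(1)] seq_par_right[OF seq_transf[OF t(1,2)] t(3) s(1)] by simp
  also have "\<dots> = marginal1 T (A * C) B (\<Psi>' \<otimes> \<beta>)"
    unfolding a1 U(2) marginal1_def using ident_par_assoc[OF discard_transf, of A C B] by simp
  also have "\<dots> = \<Psi>'"
    using marginal1_product[OF s(2,4)] pure_states_normalised[OF \<beta>] by (simp add: normalised_weight)
  finally show ?thesis
    using seq_channel[OF seq_channel[OF c1 reversible_channel[OF U(1)]] c2] by blast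
qed

text \<open>The test is dilated to a deterministic state with a pointer \<open>X\<close>, which is
  then purified with \<open>Y\<close>. This pure state and \<open>\<Psi>\<close> have the same
  marginal on \<open>A\<close>, so a channel on \<open>B\<close> prepares it; reading the pointer
  and discarding \<open>Y\<close> yields the ensemble.\<close>

lemma steering:
  assumes \<Psi>: "\<Psi> \<in> pure_states T (A * B)" and xs: "xs \<in> tests T 1 (A * C)"
    and m: "marginal1 T A C (sum_list xs) = marginal1 T A B \<Psi>"
  shows "\<exists>cs \<in> tests T B C. length cs = length xs \<and> (\<forall>i<length xs. (\<I> A \<otimes> cs ! i) \<cdot> \<Psi> = xs ! i)"
proof -
  obtain X D es where D: "D \<in> channels T 1 (A * C * X)" and es: "es \<in> tests T X 1" "length es = length xs"
    and xsD: "\<forall>i<length xs. xs ! i = (\<I> (A * C) \<otimes> es ! i) \<cdot> D"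
    using test_dilation[OF xs] by blast
  have Dn: "D \<in> normalised T (A * C * X)" using D by (simp add: normalised_channel)
  obtain Y \<Delta> where \<Delta>: "\<Delta> \<in> pure_states T (A * C * X * Y)" "marginal1 T (A * C * X) Y \<Delta> = D"
    using purification[OF Dn] by blast
  have \<Delta>': "\<Delta> \<in> pure_states T (A * (C * (X * Y)))" using \<Delta>(1) by (simp add: mult.assoc)
  note Ds = normalised_state[OF Dn] and \<Delta>s = pure_states_state[OF \<Delta>(1)] and \<Delta>s' = pure_states_state[OF \<Delta>']
  have "sum_list xs = (\<Sum>i<length xs. xs ! i)" by (simp add: sum_list_sum_nth atLeast0LessThan)
  also have "\<dots> = (\<Sum>i<length xs. (\<I> (A * C) \<otimes> es ! i) \<cdot> D)" using xsD by (intro sum.cong) auto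
  also have "\<dots> = (\<I> (A * C) \<otimes> sum_list es) \<cdot> D"
    by (simp add: seq_sum_left[symmetric] par_sum_right[symmetric] sum_list_sum_nth es(2) atLeast0LessThan)
  also have "sum_list es = \<u> X" by (rule discard_unique[OF sum_channel[OF es(1)]])
  finally have sum: "sum_list xs = marginal1 T (A * C) X D" by (simp add: marginal1_def)
  have "marginal1 T A (C * (X * Y)) \<Delta> = marginal1 T A C (marginal1 T (A * C) (X * Y) \<Delta>)"
    by (rule marginal1_assoc[OF \<Delta>s'])
  also have "marginal1 T (A * C) (X * Y) \<Delta> = marginal1 T (A * C) X D"
    using marginal1_assoc[of \<Delta> "A * C" X Y] \<Delta>s \<Delta>(2) by (simp add: mult.assoc)
  finally have "marginal1 T A (C * (X * Y)) \<Delta> = marginal1 T A B \<Psi>" using m sum by simp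
  then obtain E where E: "E \<in> channels T B (C * (X * Y))" "(\<I> A \<otimes> E) \<cdot> \<Psi> = \<Delta>"
    using purification_channel[OF \<Psi> \<Delta>'] by metis
  let ?es = "map (\<lambda>e. \<I> C \<otimes> (e \<otimes> \<u> Y)) es"
  have "map (\<lambda>e. e \<otimes> \<u> Y) es \<in> tests T (X * Y) 1" using test_par_left[OF es(1) discard_channel, of Y] by simp
  from test_par_right[OF ident_channel this, of C]
  have es': "?es \<in> tests T (C * (X * Y)) C" by (simp add: comp_def)
  let ?cs = "map (\<lambda>d. d \<cdot> E) ?es"
  have cs: "?cs \<in> tests T B C" by (rule test_pre[OF E(1) es'])
  moreover have "(\<I> A \<otimes> ?cs ! i) \<cdot> \<Psi> = xs ! i" if i: "i < length xs" for i
  proof -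
    have e: "es ! i \<in> transf T X 1" using transf_nth[OF es(1)] i es(2) by simp
    have ee: "?es ! i \<in> transf T (C * (X * Y)) C" using transf_nth[OF es'] i es(2) by simp
    have f: "\<I> (A * C) \<otimes> es ! i \<in> transf T (A * C * X) (A * C)"
      using par_transf[OF ident_transf e, of "A * C"] by simp
    have "(\<I> A \<otimes> ?cs ! i) \<cdot> \<Psi> = (\<I> A \<otimes> ?es ! i) \<cdot> \<Delta>"
      using seq_par_right[OF channel_transf[OF E(1)] ee pure_states_state[OF \<Psi>]] E(2) i es(2) by simp
    also have "\<I> A \<otimes> ?es ! i = \<I> (A * C) \<otimes> (es ! i \<otimes> \<u> Y)"
      using ident_par_assoc[OF par_transf[OF e discard_transf], of A C Y] i es(2) by simp
    also have "\<dots> = (\<I> (A * C) \<otimes> es ! i) \<otimes> \<u> Y" using par_assoc[OF ident_transf e discard_transf] by simp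
    also have "\<dots> \<cdot> \<Delta> = (\<I> (A * C) \<otimes> es ! i) \<cdot> D"
      using par_left_right[OF f discard_transf \<Delta>s] par_unit_right[OF f] \<Delta>(2) by (simp add: marginal1_def)
    finally show ?thesis using xsD i by simp
  qed
  ultimately show ?thesis using es(2) by (intro bexI[of _ ?cs]) auto
qed

lemma steering_left:
  assumes \<Psi>: "\<Psi> \<in> pure_states T (A * B)" and xs: "xs \<in> tests T 1 (C * B)"
    and m: "marginal2 T C B (sum_list xs) = marginal2 T A B \<Psi>"
  shows "\<exists>cs \<in> tests T A C. length cs = length xs \<and> (\<forall>i<length xs. (cs ! i \<otimes> \<I> B) \<cdot> \<Psi> = xs ! i)"
proof -
  let ?ys = "map (\<lambda>x. swap T C B \<cdot> x) xs"
  note s = pure_states_state[OF \<Psi>]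
  have xss: "set xs \<subseteq> states T (C * B)" using transf_I[OF xs] by (auto simp: states_eq)
  have sum: "sum_list xs \<in> states T (C * B)"
    using sum_channel[OF xs] by (simp add: normalised_channel[symmetric] normalised_state)
  have ys: "?ys \<in> tests T 1 (B * C)" by (rule test_post[OF xs swap_channel])
  have "sum_list ?ys = swap T C B \<cdot> sum_list xs" by (simp add: seq_sum_list_right)
  then have "marginal1 T B C (sum_list ?ys) = marginal1 T B A (swap T A B \<cdot> \<Psi>)"
    using marginal1_swap[OF sum] marginal1_swap[OF s] m by simp
  from steering[OF swap_pure_states[OF \<Psi>] ys this]
  obtain cs where cs: "cs \<in> tests T A C" "length cs = length xs"
    "\<forall>i<length xs. (\<I> B \<otimes> cs ! i) \<cdot> (swap T A B \<cdot> \<Psi>) = swap T C B \<cdot> xs ! i" by auto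
  have "(cs ! i \<otimes> \<I> B) \<cdot> \<Psi> = xs ! i" if i: "i < length xs" for i
  proof -
    have c: "cs ! i \<in> transf T A C" using transf_nth[OF cs(1)] i cs(2) by simp
    have "swap T C B \<cdot> ((cs ! i \<otimes> \<I> B) \<cdot> \<Psi>) = swap T C B \<cdot> xs ! i"
      using swap_par[OF c ident_transf s] cs(3) i by simp
    then have "swap T B C \<cdot> (swap T C B \<cdot> ((cs ! i \<otimes> \<I> B) \<cdot> \<Psi>)) = swap T B C \<cdot> (swap T C B \<cdot> xs ! i)" by simp
    moreover have "xs ! i \<in> states T (C * B)" using xss i by auto
    ultimately show ?thesis using swap_swap_state par_state[OF c ident_transf s] by simp
  qed
  with cs show ?thesis by blast
qed

section \<open>Full-rank states and the Choi isomorphism\<close>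

lemma cone_sum: "\<lbrakk>finite S; \<And>b. b \<in> S \<Longrightarrow> f b \<in> state_cone A\<rbrakk> \<Longrightarrow> sum f S \<in> state_cone A"
  by (induction S rule: finite_induct) (auto intro: cone_add states_cone[OF zero_state])

text \<open>The uniform mixture of a basis of normalised states works: every state has coordinates
  in this basis, and a small multiple of them is dominated by the equal weights.\<close>

lemma ex_full_rank: "\<exists>\<nu> \<in> normalised T A. \<forall>\<rho> \<in> states T A. \<exists>r>0. \<nu> - r *\<^sub>R \<rho> \<in> states T A"
proof -
  obtain F where F: "finite F" "transf T 1 A \<subseteq> span F" using finite_dimensional by blast
  obtain B where B: "B \<subseteq> normalised T A" "independent B" "normalised T A \<subseteq> span B"
    using maximal_independent_subset[of "normalised T A"] by blast
  have "B \<subseteq> span F" using B(1) F(2) normalised_state by (auto simp: states_eq)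
  then have fin: "finite B" using independent_span_bound[OF F(1) B(2)] by blast
  obtain \<rho>0 where "\<rho>0 \<in> normalised T A" using ex_normalised by blast
  then have "B \<noteq> {}" using B(3) by (auto simp: normalised_weight weight_simps)
  then have n: "card B > 0" using fin by (simp add: card_gt_0_iff)
  have cone: "b \<in> state_cone A" "weight A b = 1" if "b \<in> B" for b
    using B(1) that states_cone by (auto simp: normalised_weight)
  define \<nu> where "\<nu> = (\<Sum>b\<in>B. (1 / card B) *\<^sub>R b)"
  have "weight A \<nu> = (\<Sum>b\<in>B. 1 / card B)"
    unfolding \<nu>_def linear_sum[OF linear_weight] by (rule sum.cong) (auto simp: weight_scale cone)
  then have w: "weight A \<nu> = 1" using n by simp
  have "\<nu> \<in> state_cone A" unfolding \<nu>_def using fin cone by (intro cone_sum cone_scale) auto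
  then have \<nu>: "\<nu> \<in> normalised T A" using w cone_state by (simp add: normalised_weight)
  have "\<exists>r>0. \<nu> - r *\<^sub>R \<rho> \<in> states T A" if \<rho>: "\<rho> \<in> states T A" for \<rho>
  proof -
    have "\<rho> \<in> span B" using state_rescale[OF \<rho>] B(3) by (metis span_scale subsetD)
    then obtain c where c: "\<rho> = (\<Sum>b\<in>B. c b *\<^sub>R b)" using span_finite[OF fin] by auto
    define K where "K = 1 + (\<Sum>b\<in>B. \<bar>c b\<bar>)"
    have K: "K > 0" unfolding K_def by (simp add: add_pos_nonneg sum_nonneg)
    have cK: "c b \<le> K" if "b \<in> B" for b
      using member_le_sum[OF that _ fin, of "\<lambda>b. \<bar>c b\<bar>"] unfolding K_def by (simp add: abs_le_iff)
    \<comment> \<open>Since \<open>c b \<le> K\<close>, each coefficient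
      \<open>1 / card B - r * c b\<close> is nonnegative. The summand 1 in \<open>K\<close> keeps
      \<open>K\<close> positive.\<close>
    define r where "r = 1 / (card B * K)"
    have r: "r > 0" using n K by (simp add: r_def)
    have "\<nu> - r *\<^sub>R \<rho> = (\<Sum>b\<in>B. (1 / card B - r * c b) *\<^sub>R b)"
      by (simp add: \<nu>_def c scaleR_sum_right sum_subtractf[symmetric] scaleR_diff_left)
    also have "\<dots> \<in> state_cone A"
    proof (intro cone_sum[OF fin] cone_scale cone(1))
      fix b assume "b \<in> B"
      from cK[OF this] have "c b / K \<le> 1" using K by simp
      then show "0 \<le> 1 / card B - r * c b" using n by (simp add: r_def field_simps)
    qed
    finally have "\<nu> - r *\<^sub>R \<rho> \<in> state_cone A" .
    moreover have "weight A (\<nu> - r *\<^sub>R \<rho>) \<le> 1"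
      using w r weight_nonneg[OF \<rho>] by (simp add: weight_simps)
    ultimately show ?thesis using r cone_state by blast
  qed
  then show ?thesis using \<nu> by blast
qed

text \<open>Choi isomorphism: a purification of a full-rank state determines transformations, because
  every bipartite state can be steered from it.\<close>

definition choi_state :: "'a \<Rightarrow> 'a \<Rightarrow> 'b \<Rightarrow> bool" where
  "choi_state A S \<Psi> \<longleftrightarrow> \<Psi> \<in> pure_states T (A * S) \<and>
     (\<forall>\<rho> \<in> states T A. \<exists>r>0. marginal1 T A S \<Psi> - r *\<^sub>R \<rho> \<in> states T A)"

lemma ex_choi_state: "\<exists>S \<Psi>. choi_state A S \<Psi>"
  using ex_full_rank[of A] purification[of _ A] unfolding choi_state_def by metis

lemma choi_pure_states: "choi_state A S \<Psi> \<Longrightarrow> \<Psi> \<in> pure_states T (A * S)"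
  by (simp add: choi_state_def)

lemma choi_unique:
  assumes \<Psi>: "choi_state A S \<Psi>" and C: "C \<in> transf T A B" and D: "D \<in> transf T A B"
    and eq: "(C \<otimes> \<I> S) \<cdot> \<Psi> = (D \<otimes> \<I> S) \<cdot> \<Psi>"
  shows "C = D"
proof (rule transf_eqI[OF C D], intro allI ballI)
  fix R \<sigma> assume \<sigma>: "\<sigma> \<in> states T (A * R)"
  note \<Psi>p = choi_pure_states[OF \<Psi>] and \<Psi>s = pure_states_state[OF choi_pure_states[OF \<Psi>]]
  let ?\<nu> = "marginal1 T A S \<Psi>"
  obtain r where r: "r > 0" "?\<nu> - r *\<^sub>R marginal1 T A R \<sigma> \<in> states T A"
    using \<Psi> marginal1_state[OF \<sigma>] by (auto simp: choi_state_def)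
  define x where "x = ?\<nu> - r *\<^sub>R marginal1 T A R \<sigma>"
  \<comment> \<open>Capped at 1 so that \<open>k *\<^sub>R \<sigma>\<close> is itself a state;
    subtracting a smaller multiple of the marginal of \<open>\<sigma>\<close> stays within the
    cone.\<close>
  define k where "k = min r 1"
  have k: "0 < k" "k \<le> 1" "k \<le> r" using r(1) by (auto simp: k_def)
  define y where "y = ?\<nu> - k *\<^sub>R marginal1 T A R \<sigma>"
  have w1: "weight A ?\<nu> = 1"
    using marginal1_normalised[OF pure_states_normalised[OF \<Psi>p]] by (simp add: normalised_weight)
  have wm: "weight A (marginal1 T A R \<sigma>) = weight (A * R) \<sigma>"
    using weight_channel[OF par_channel[OF ident_channel discard_channel], of \<sigma> A R] \<sigma>
    by (simp add: marginal1_def)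
  have "y = x + (r - k) *\<^sub>R marginal1 T A R \<sigma>" by (simp add: x_def y_def algebra_simps)
  also have "\<dots> \<in> state_cone A"
    using r(2)[folded x_def] k marginal1_state[OF \<sigma>] by (intro cone_add cone_scale states_cone) auto
  finally have "y \<in> state_cone A" .
  moreover have wy: "weight A y = 1 - k * weight (A * R) \<sigma>" by (simp add: y_def weight_simps w1 wm)
  ultimately have y: "y \<in> states T A" using k(1) weight_nonneg[OF \<sigma>] by (intro cone_state) auto
  \<comment> \<open>The ensemble lives on \<open>A * R\<close>, so the rest \<open>y\<close> of the
    marginal has to be extended to \<open>R\<close>; any normalised state serves.\<close>
  obtain \<tau> where \<tau>: "\<tau> \<in> normalised T R" using ex_normalised by blast
  have wyt: "weight (A * R) (y \<otimes> \<tau>) = weight A y"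
  proof -
    have "weight A (marginal1 T A R (y \<otimes> \<tau>)) = weight (A * R) (y \<otimes> \<tau>)"
      using weight_channel[OF par_channel[OF ident_channel discard_channel], of "y \<otimes> \<tau>" A R]
        state_par[OF y normalised_state[OF \<tau>]] by (simp add: marginal1_def)
    then show ?thesis using marginal1_product[OF y normalised_state[OF \<tau>]] \<tau> by (simp add: normalised_weight)
  qed
  have xs: "[k *\<^sub>R \<sigma>, y \<otimes> \<tau>] \<in> tests T 1 (A * R)"
    by (rule prep_testI)
      (use k \<sigma> scale_state state_par[OF y normalised_state[OF \<tau>]] wyt wy in \<open>auto simp: weight_scale\<close>)
  have "marginal1 T A R (sum_list [k *\<^sub>R \<sigma>, y \<otimes> \<tau>]) = ?\<nu>"
    using marginal1_product[OF y normalised_state[OF \<tau>]] \<tau>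
    by (simp add: marginal_simps normalised_weight y_def)
  from steering[OF \<Psi>p xs this]
  obtain cs where cs: "cs \<in> tests T S R" "length cs = 2"
    "\<forall>i<2. (\<I> A \<otimes> cs ! i) \<cdot> \<Psi> = [k *\<^sub>R \<sigma>, y \<otimes> \<tau>] ! i" by auto
  have c: "cs ! 0 \<in> transf T S R" using transf_nth[OF cs(1)] cs(2) by simp
  have k\<sigma>: "k *\<^sub>R \<sigma> = (\<I> A \<otimes> cs ! 0) \<cdot> \<Psi>" using cs(3) by simp
  have "(E \<otimes> \<I> R) \<cdot> (k *\<^sub>R \<sigma>) = (\<I> B \<otimes> cs ! 0) \<cdot> ((E \<otimes> \<I> S) \<cdot> \<Psi>)" if "E \<in> transf T A B" for E
    unfolding k\<sigma> using par_left_right[OF that c \<Psi>s] par_right_left[OF that c \<Psi>s] by simp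
  then have "(C \<otimes> \<I> R) \<cdot> (k *\<^sub>R \<sigma>) = (D \<otimes> \<I> R) \<cdot> (k *\<^sub>R \<sigma>)" using C D eq by simp
  then show "(C \<otimes> \<I> R) \<cdot> \<sigma> = (D \<otimes> \<I> R) \<cdot> \<sigma>" using k(1) by (simp add: lin_simps)
qed

text \<open>A decomposition of \<open>C\<close> decomposes the pure state
  \<open>(C \<otimes> \<I> S) \<cdot> \<Psi>\<close>; the resulting proportionality lifts back to
  transformations by \<open>choi_unique\<close>.\<close>

lemma choi_pure:
  assumes \<Psi>: "choi_state A S \<Psi>" and C: "C \<in> transf T A B" and p: "(C \<otimes> \<I> S) \<cdot> \<Psi> \<in> pure T 1 (B * S)"
  shows "C \<in> pure T A B"
proof (rule pureI[OF C])
  fix D E F assume t: "[D, E, F] \<in> tests T A B" and sum: "C = D + E"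
  note \<Psi>s = pure_states_state[OF choi_pure_states[OF \<Psi>]]
  have DE: "D \<in> transf T A B" "E \<in> transf T A B" by (auto intro: transf_I[OF t])
  have "(C \<otimes> \<I> S) \<cdot> \<Psi> = (D \<otimes> \<I> S) \<cdot> \<Psi> + (E \<otimes> \<I> S) \<cdot> \<Psi>" by (simp add: sum lin_simps)
  from pure_state_split[OF p par_state[OF DE(1) ident_transf \<Psi>s] par_state[OF DE(2) ident_transf \<Psi>s] this]
  obtain c where c: "0 \<le> c" "c \<le> 1" "(D \<otimes> \<I> S) \<cdot> \<Psi> = c *\<^sub>R ((C \<otimes> \<I> S) \<cdot> \<Psi>)" by blast
  have "D = c *\<^sub>R C"
    by (rule choi_unique[OF \<Psi> DE(1) scale_transf[OF C c(1,2)]]) (simp add: c(3) lin_simps)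
  then show "\<exists>c. D = c *\<^sub>R C" by blast
qed

text \<open>Makes Purity Preservation applicable to a pure transformation of one factor of a
  composite system, which is a parallel composition with an identity.\<close>

lemma ident_pure: "\<I> A \<in> pure T A A"
proof -
  obtain S \<Psi> where \<Psi>: "choi_state A S \<Psi>" using ex_choi_state by blast
  note p = choi_pure_states[OF \<Psi>]
  have "(\<I> A \<otimes> \<I> S) \<cdot> \<Psi> = \<Psi>" using ident_state[OF pure_states_state[OF p]] by (simp add: par_ident)
  then show ?thesis using choi_pure[OF \<Psi> ident_transf] pure_states_pure[OF p] by simp
qed

section \<open>Sharp effects and the Schmidt decomposition\<close>

text \<open>The product of the pure marginal with any pure \<open>\<beta>\<close> purifies it too,
  and the reversible channel that relates the two purifications acts on \<open>B\<close> alone, so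
  it preserves the product form.\<close>

lemma pure_marginal1_product:
  assumes "\<Psi> \<in> pure_states T (A * B)" "marginal1 T A B \<Psi> \<in> pure_states T A"
  shows "\<exists>\<beta> \<in> pure_states T B. \<Psi> = marginal1 T A B \<Psi> \<otimes> \<beta>"
proof -
  let ?\<alpha> = "marginal1 T A B \<Psi>"
  obtain \<beta> where \<beta>: "\<beta> \<in> pure_states T B" using ex_pure_state by blast
  note s = pure_states_state[OF assms(2)] pure_states_state[OF \<beta>]
  have "marginal1 T A B (?\<alpha> \<otimes> \<beta>) = ?\<alpha>"
    using marginal1_product[OF s] pure_states_normalised[OF \<beta>] by (simp add: normalised_weight)
  then obtain U where U: "U \<in> reversible T B B" "\<Psi> = (\<I> A \<otimes> U) \<cdot> (?\<alpha> \<otimes> \<beta>)"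
    using purification_unique[OF pure_states_par[OF assms(2) \<beta>] assms(1)] by auto
  then show ?thesis
    using par_states[OF ident_transf reversible_transf[OF U(1)] s] ident_state[OF s(1)]
      reversible_pure_states[OF U(1) \<beta>] by auto
qed

lemma pure_marginal2_product:
  assumes "\<Psi> \<in> pure_states T (A * B)" "marginal2 T A B \<Psi> \<in> pure_states T B"
  shows "\<exists>\<alpha> \<in> pure_states T A. \<Psi> = \<alpha> \<otimes> marginal2 T A B \<Psi>"
proof -
  note s = pure_states_state[OF assms(1)]
  obtain \<alpha> where \<alpha>: "\<alpha> \<in> pure_states T A" "swap T A B \<cdot> \<Psi> = marginal2 T A B \<Psi> \<otimes> \<alpha>"
    using pure_marginal1_product[OF swap_pure_states[OF assms(1)]] assms(2) marginal1_swap[OF s] by auto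
  have "\<Psi> = swap T B A \<cdot> (marginal2 T A B \<Psi> \<otimes> \<alpha>)" using swap_swap_state[OF s] \<alpha>(2) by simp
  then show ?thesis
    using swap_product[OF pure_states_state[OF assms(2)] pure_states_state[OF \<alpha>(1)]] \<alpha>(1) by auto
qed

lemma pure_left: "\<lbrakk>C \<in> pure T A A'; \<Psi> \<in> pure T 1 (A * B)\<rbrakk> \<Longrightarrow> (C \<otimes> \<I> B) \<cdot> \<Psi> \<in> pure T 1 (A' * B)"
  by (rule purity_seq[OF _ purity_par[OF _ ident_pure]])

lemma pure_right: "\<lbrakk>C \<in> pure T B B'; \<Psi> \<in> pure T 1 (A * B)\<rbrakk> \<Longrightarrow> (\<I> A \<otimes> C) \<cdot> \<Psi> \<in> pure T 1 (A * B')"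
  by (rule purity_seq[OF _ purity_par[OF ident_pure]])

lemma effect_left_state: "\<lbrakk>a \<in> transf T A 1; \<Psi> \<in> states T (A * B)\<rbrakk> \<Longrightarrow> (a \<otimes> \<I> B) \<cdot> \<Psi> \<in> states T B"
  using par_state[OF _ ident_transf, of a A 1 \<Psi> B] by simp

lemma effect_right_state: "\<lbrakk>b \<in> transf T B 1; \<Psi> \<in> states T (A * B)\<rbrakk> \<Longrightarrow> (\<I> A \<otimes> b) \<cdot> \<Psi> \<in> states T A"
  using par_state[OF ident_transf, of b B 1 \<Psi> A] by simp

lemma effect_after_left:
  "\<lbrakk>a \<in> transf T A 1; b \<in> transf T B 1; \<Psi> \<in> states T (A * B)\<rbrakk> \<Longrightarrow> b \<cdot> ((a \<otimes> \<I> B) \<cdot> \<Psi>) = (a \<otimes> b) \<cdot> \<Psi>"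
  using par_right_left[of a A 1 b B 1 \<Psi>] by (simp add: par_unit_left)

lemma effect_after_right:
  "\<lbrakk>a \<in> transf T A 1; b \<in> transf T B 1; \<Psi> \<in> states T (A * B)\<rbrakk> \<Longrightarrow> a \<cdot> ((\<I> A \<otimes> b) \<cdot> \<Psi>) = (a \<otimes> b) \<cdot> \<Psi>"
  using par_left_right[of a A 1 b B 1 \<Psi>] by (simp add: par_unit_right)

lemma weight_effect_left:
  "\<lbrakk>a \<in> transf T A 1; \<Psi> \<in> states T (A * B)\<rbrakk> \<Longrightarrow> weight B ((a \<otimes> \<I> B) \<cdot> \<Psi>) = scal (a \<cdot> marginal1 T A B \<Psi>)"
  unfolding weight_def marginal1_def
  using effect_after_left[OF _ discard_transf, of a A \<Psi> B] effect_after_right[OF _ discard_transf, of a A \<Psi> B] by simp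

lemma weight_effect_right:
  "\<lbrakk>b \<in> transf T B 1; \<Psi> \<in> states T (A * B)\<rbrakk> \<Longrightarrow> weight A ((\<I> A \<otimes> b) \<cdot> \<Psi>) = scal (b \<cdot> marginal2 T A B \<Psi>)"
  unfolding weight_def marginal2_def
  using effect_after_left[OF discard_transf, of b B \<Psi> A] effect_after_right[OF discard_transf, of b B \<Psi> A] by simp

lemma effect_complement: "a \<in> transf T A 1 \<Longrightarrow> \<exists>a' \<in> transf T A 1. [a, a'] \<in> tests T A 1 \<and> \<u> A = a + a'"
  using test_complement[of a A 1] pairing_complement transf_I by (metis list.set_intros(1) list.set_intros(2))

text \<open>The complementary effect occurs with probability 0, so it leaves the zero state on
  \<open>B\<close>; the effect itself then acts like discarding \<open>A\<close>.\<close>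

lemma sure_marginal2:
  assumes "a \<in> transf T A 1" "\<Psi> \<in> normalised T (A * B)" "scal (a \<cdot> marginal1 T A B \<Psi>) = 1"
  shows "(a \<otimes> \<I> B) \<cdot> \<Psi> = marginal2 T A B \<Psi>"
proof -
  note s = normalised_state[OF assms(2)]
  obtain a' where a': "a' \<in> transf T A 1" "\<u> A = a + a'" using effect_complement[OF assms(1)] by blast
  have "scal (\<u> A \<cdot> marginal1 T A B \<Psi>) = 1"
    using marginal1_normalised[OF assms(2)] by (simp add: normalised_weight weight_def)
  then have "weight B ((a' \<otimes> \<I> B) \<cdot> \<Psi>) = 0"
    using weight_effect_left[OF a'(1) s] assms(3) by (simp add: a'(2) lin_simps scal_simps)
  then have "(a' \<otimes> \<I> B) \<cdot> \<Psi> = 0" by (rule weight_zero[OF effect_left_state[OF a'(1) s]])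
  then show ?thesis by (simp add: marginal2_def a'(2) lin_simps)
qed

text \<open>Applied to a purification of \<open>\<rho>\<close>, the pure effect leaves a pure state
  of \<open>B\<close>, which by certainty is the full marginal. A pure marginal forces a product of
  pure states, whose first factor is \<open>\<rho>\<close>.\<close>

lemma sure_pure:
  assumes a: "a \<in> pure T A 1" and \<rho>: "\<rho> \<in> normalised T A" and 1: "scal (a \<cdot> \<rho>) = 1"
  shows "\<rho> \<in> pure_states T A"
proof -
  obtain B \<Psi> where \<Psi>: "\<Psi> \<in> pure_states T (A * B)" "marginal1 T A B \<Psi> = \<rho>" using purification[OF \<rho>] by blast
  have "(a \<otimes> \<I> B) \<cdot> \<Psi> = marginal2 T A B \<Psi>"
    using sure_marginal2[OF pure_transf[OF a] pure_states_normalised[OF \<Psi>(1)]] \<Psi>(2) 1 by simp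
  then have "marginal2 T A B \<Psi> \<in> pure_states T B"
    using pure_left[OF a pure_states_pure[OF \<Psi>(1)]] marginal2_normalised[OF pure_states_normalised[OF \<Psi>(1)]]
    by (simp add: pure_states_iff)
  then obtain \<alpha> where \<alpha>: "\<alpha> \<in> pure_states T A" "\<Psi> = \<alpha> \<otimes> marginal2 T A B \<Psi>"
    "marginal2 T A B \<Psi> \<in> normalised T B"
    using pure_marginal2_product[OF \<Psi>(1)] pure_states_normalised by blast
  have "marginal1 T A B (\<alpha> \<otimes> marginal2 T A B \<Psi>) = \<alpha>"
    using marginal1_product[OF pure_states_state[OF \<alpha>(1)] normalised_state[OF \<alpha>(3)]] \<alpha>(3)
    by (simp add: normalised_weight)
  then show ?thesis using \<alpha> \<Psi>(2) by simp
qed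

text \<open>The effect is also certain on the midpoint of \<open>\<rho>\<close> and
  \<open>\<sigma>\<close>, so the midpoint is pure by \<open>sure_pure\<close>, and then both states
  are proportional to it.\<close>

lemma sure_unique:
  assumes a: "a \<in> pure T A 1" and \<rho>: "\<rho> \<in> normalised T A" "scal (a \<cdot> \<rho>) = 1"
    and \<sigma>: "\<sigma> \<in> normalised T A" "scal (a \<cdot> \<sigma>) = 1"
  shows "\<rho> = \<sigma>"
proof -
  define \<tau> where "\<tau> = (1/2) *\<^sub>R \<rho> + (1/2) *\<^sub>R \<sigma>"
  note s = normalised_state[OF \<rho>(1)] normalised_state[OF \<sigma>(1)]
  have w: "weight A \<rho> = 1" "weight A \<sigma> = 1" using \<rho> \<sigma> by (auto simp: normalised_weight)
  have h: "(1/2) *\<^sub>R \<rho> \<in> states T A" "(1/2) *\<^sub>R \<sigma> \<in> states T A" using s by (auto intro: scale_state)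
  have \<tau>: "\<tau> \<in> normalised T A"
    unfolding normalised_weight \<tau>_def using h w by (auto intro!: add_states simp: weight_simps)
  have "scal (a \<cdot> \<tau>) = 1" using \<rho> \<sigma> by (simp add: \<tau>_def lin_simps scal_simps)
  then have p: "\<tau> \<in> pure_states T A" by (rule sure_pure[OF a \<tau>])
  have "\<rho> = \<tau>"
  proof -
    obtain c where "(1/2) *\<^sub>R \<rho> = c *\<^sub>R \<tau>"
      using pure_state_split[OF pure_states_pure[OF p] h] \<tau>_def by blast
    moreover from arg_cong[OF this, of "weight A"] have "c = 1/2"
      using w(1) \<tau> by (simp add: weight_scale normalised_weight)
    ultimately show ?thesis by simp
  qed
  then have "(1/2) *\<^sub>R \<rho> = (1/2) *\<^sub>R \<sigma>" unfolding \<tau>_def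
    by (metis add_diff_cancel_left' field_sum_of_halves scaleR_add_left scaleR_one)
  then show ?thesis by simp
qed

lemma reversible_pure: "U \<in> reversible T A B \<Longrightarrow> U \<in> pure T A B"
proof -
  assume U: "U \<in> reversible T A B"
  obtain S \<Psi> where \<Psi>: "choi_state A S \<Psi>" using ex_choi_state by blast
  from reversible_pure_states[OF reversible_par[OF U reversible_ident] choi_pure_states[OF \<Psi>]]
  show ?thesis using choi_pure[OF \<Psi> reversible_transf[OF U]] pure_states_pure by blast
qed

text \<open>Pure Sharpness provides one sharp effect, certain on some pure state; a reversible
  channel from \<open>\<alpha>\<close> to that state transports it.\<close>

lemma ex_sharp_effect:
  assumes "\<alpha> \<in> pure_states T A"
  shows "\<exists>a \<in> pure T A 1. scal (a \<cdot> \<alpha>) = 1"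
proof -
  obtain a \<rho> where a: "a \<in> pure T A 1" "\<rho> \<in> states T A" "prob T a \<rho> = 1" using pure_sharpness by blast
  have 1: "scal (a \<cdot> \<rho>) = 1" using prob_scal[of a A \<rho>] a pure_transf effects_eq by auto
  then have "\<rho> \<in> normalised T A"
    using pairing_le_weight[of a A \<rho>] weight_le_1[OF a(2)] a pure_transf effects_eq normalised_weight by force
  then have "\<rho> \<in> pure_states T A" using sure_pure[OF a(1)] 1 by blast
  then obtain U where U: "U \<in> reversible T A A" "\<rho> = U \<cdot> \<alpha>" using transitivity[OF assms] by blast
  have "scal ((a \<cdot> U) \<cdot> \<alpha>) = 1"
    using state_assoc[OF reversible_transf[OF U(1)] pure_transf[OF a(1)] pure_states_state[OF assms]] U(2) 1 by simp
  then show ?thesis using purity_seq[OF reversible_pure[OF U(1)] a(1)] by blast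
qed

text \<open>Closedness is not given for the set of pure states, but this set is the orbit of
  \<open>\<alpha>0\<close> under the reversible channels. A sequence whose weights tend to the
  supremum is therefore written as \<open>U n \<cdot> \<alpha>0\<close>, and
  \<open>reversible_subseq\<close> supplies a limit that attains it.\<close>

lemma max_component:
  assumes \<rho>: "\<rho> \<in> normalised T A"
  shows "\<exists>p>0. \<exists>\<alpha> \<in> pure_states T A. \<rho> - p *\<^sub>R \<alpha> \<in> states T A \<and>
    (\<forall>q. \<forall>\<alpha>' \<in> pure_states T A. \<rho> - q *\<^sub>R \<alpha>' \<in> states T A \<longrightarrow> q \<le> p)"
proof -
  define P where "P = {p. \<exists>\<alpha> \<in> pure_states T A. \<rho> - p *\<^sub>R \<alpha> \<in> states T A}"
  have w: "weight A \<rho> = 1" and \<rho>0: "\<rho> \<noteq> 0" using \<rho> by (auto simp: normalised_weight weight_simps)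
  obtain r where r: "r > 0" "r \<in> P" using pure_component[OF normalised_state[OF \<rho>] \<rho>0] by (auto simp: P_def)
  have bdd: "bdd_above P"
  proof (rule bdd_aboveI)
    fix p assume "p \<in> P"
    then obtain \<alpha> where \<alpha>: "\<alpha> \<in> pure_states T A" "\<rho> - p *\<^sub>R \<alpha> \<in> states T A" by (auto simp: P_def)
    from weight_nonneg[OF \<alpha>(2)] show "p \<le> 1"
      using pure_states_normalised[OF \<alpha>(1)] by (simp add: weight_simps w normalised_weight)
  qed
  define s where "s = Sup P"
  have sr: "r \<le> s" unfolding s_def by (rule cSup_upper[OF r(2) bdd])
  have "\<forall>n. \<exists>p. p \<in> P \<and> s - 1 / real (Suc n) < p"
  proof
    fix n
    have "s - 1 / real (Suc n) < Sup P" by (simp add: s_def)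
    then show "\<exists>p. p \<in> P \<and> s - 1 / real (Suc n) < p" using less_cSup_iff[OF _ bdd] r(2) by blast
  qed
  then obtain p where p: "\<And>n. p n \<in> P" "\<And>n. s - 1 / real (Suc n) < p n" by metis
  have plim: "p \<longlonglongrightarrow> s"
  proof (rule tendsto_sandwich)
    show "\<forall>\<^sub>F n in sequentially. s - 1 / real (Suc n) \<le> p n" by (intro always_eventually allI less_imp_le p(2))
    show "\<forall>\<^sub>F n in sequentially. p n \<le> s" using p(1) cSup_upper[OF _ bdd] by (simp add: s_def)
    show "(\<lambda>n. s - 1 / real (Suc n)) \<longlonglongrightarrow> s"
      using tendsto_diff[OF tendsto_const LIMSEQ_inverse_real_of_nat, of s] by (simp add: inverse_eq_divide)
  qed simp
  obtain \<alpha>0 where \<alpha>0: "\<alpha>0 \<in> pure_states T A" using ex_pure_state by blast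
  have "\<forall>n. \<exists>U. U \<in> reversible T A A \<and> \<rho> - p n *\<^sub>R (U \<cdot> \<alpha>0) \<in> states T A"
    using p(1) transitivity[OF \<alpha>0] unfolding P_def by blast
  then obtain U where U: "\<And>n. U n \<in> reversible T A A" "\<And>n. \<rho> - p n *\<^sub>R (U n \<cdot> \<alpha>0) \<in> states T A" by metis
  obtain W r' where W: "W \<in> reversible T A A" "strict_mono r'" "fin_lim (\<lambda>n. U (r' n)) W"
    using reversible_subseq[of U A] U(1) by blast
  have "(\<lambda>n. p (r' n)) \<longlonglongrightarrow> s" using LIMSEQ_subseq_LIMSEQ[OF plim W(2)] by (simp add: comp_def)
  then have "(\<lambda>n. \<rho> - p (r' n) *\<^sub>R (U (r' n) \<cdot> \<alpha>0)) \<longlonglongrightarrow> \<rho> - s *\<^sub>R (W \<cdot> \<alpha>0)"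
    by (intro tendsto_intros fin_lim_linear[OF W(3) linear_seq_left])
  then have "\<rho> - s *\<^sub>R (W \<cdot> \<alpha>0) \<in> transf T 1 A"
    by (rule closed_sequentially[OF closed_transf, rotated]) (use U(2) in \<open>simp add: states_eq\<close>)
  moreover have "q \<le> s" if "\<alpha>' \<in> pure_states T A" "\<rho> - q *\<^sub>R \<alpha>' \<in> states T A" for q \<alpha>'
    unfolding s_def using that by (intro cSup_upper[OF _ bdd]) (auto simp: P_def)
  ultimately show ?thesis
    using r(1) sr reversible_pure_states[OF W(1) \<alpha>0]
    by (intro exI[of _ s] conjI bexI[of _ "W \<cdot> \<alpha>0"]) (auto simp: states_eq)
qed

lemma marginal1_unit: "x \<in> states T A \<Longrightarrow> marginal1 T A 1 x = x"
  by (simp add: marginal1_def discard_unit par_unit_right[OF ident_transf] ident_state)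

text \<open>Steering with trivial output system: the ensemble of \<open>x\<close> and its remainder
  comes from a two-outcome observation-test on \<open>B\<close>.\<close>

lemma component_effect:
  assumes \<Psi>: "\<Psi> \<in> pure_states T (A * B)" and x: "x \<in> states T A" "marginal1 T A B \<Psi> - x \<in> states T A"
  shows "\<exists>b \<in> transf T B 1. (\<I> A \<otimes> b) \<cdot> \<Psi> = x"
proof -
  let ?xs = "[x, marginal1 T A B \<Psi> - x]"
  have n: "marginal1 T A B \<Psi> \<in> normalised T A" by (rule marginal1_normalised[OF pure_states_normalised[OF \<Psi>]])
  have "?xs \<in> tests T 1 (A * 1)"
    using prep_testI[of ?xs A] x n by (simp add: weight_simps normalised_weight)
  moreover have "marginal1 T A 1 (sum_list ?xs) = marginal1 T A B \<Psi>"
    using marginal1_unit[OF normalised_state[OF n]] by simp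
  ultimately obtain cs where "cs \<in> tests T B 1" "length cs = 2" "\<forall>i<2. (\<I> A \<otimes> cs ! i) \<cdot> \<Psi> = ?xs ! i"
    using steering[OF \<Psi>, of ?xs 1] by auto
  then show ?thesis using transf_nth[of cs B 1 0] by (intro bexI[of _ "cs ! 0"]) auto
qed

lemma effect_component_left:
  assumes "a \<in> transf T A 1" "\<Psi> \<in> states T (A * B)"
  shows "marginal2 T A B \<Psi> - (a \<otimes> \<I> B) \<cdot> \<Psi> \<in> states T B"
proof -
  obtain a' where a': "a' \<in> transf T A 1" "\<u> A = a + a'" using effect_complement[OF assms(1)] by blast
  then show ?thesis using effect_left_state[OF a'(1) assms(2)] by (simp add: marginal2_def lin_simps)
qed

lemma effect_component_right:
  assumes "b \<in> transf T B 1" "\<Psi> \<in> states T (A * B)"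
  shows "marginal1 T A B \<Psi> - (\<I> A \<otimes> b) \<cdot> \<Psi> \<in> states T A"
proof -
  obtain b' where b': "b' \<in> transf T B 1" "\<u> B = b + b'" using effect_complement[OF assms(1)] by blast
  then show ?thesis using effect_right_state[OF b'(1) assms(2)] by (simp add: marginal1_def lin_simps)
qed

text \<open>A component \<open>\<alpha>\<close> of maximal weight \<open>p\<close> in one marginal is steered by some effect; the sharp
  effect of \<open>\<alpha>\<close> then prepares a component of weight at least \<open>p\<close> in the other marginal. Going back
  and forth, maximality forces all weights to agree.\<close>

lemma max_component_pair:
  assumes \<Psi>: "\<Psi> \<in> pure_states T (A * B)"
  shows "\<exists>p \<alpha> \<beta> a b. 0 < p \<and> \<alpha> \<in> pure_states T A \<and> \<beta> \<in> pure_states T B \<and> a \<in> pure T A 1 \<and> b \<in> pure T B 1 \<and>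
    scal (a \<cdot> \<alpha>) = 1 \<and> scal (b \<cdot> \<beta>) = 1 \<and> (a \<otimes> \<I> B) \<cdot> \<Psi> = p *\<^sub>R \<beta> \<and> (\<I> A \<otimes> b) \<cdot> \<Psi> = p *\<^sub>R \<alpha>"
proof -
  note s = pure_states_state[OF \<Psi>] and n = pure_states_normalised[OF \<Psi>]
  let ?A = "marginal1 T A B \<Psi>" and ?B = "marginal2 T A B \<Psi>"
  obtain p \<alpha> where p: "0 < p" and \<alpha>: "\<alpha> \<in> pure_states T A" and p\<alpha>: "?A - p *\<^sub>R \<alpha> \<in> states T A"
    and max: "\<And>q \<alpha>'. \<lbrakk>\<alpha>' \<in> pure_states T A; ?A - q *\<^sub>R \<alpha>' \<in> states T A\<rbrakk> \<Longrightarrow> q \<le> p"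
    using max_component[OF marginal1_normalised[OF n]] by blast
  have w\<alpha>: "weight A \<alpha> = 1" and wA: "weight A ?A = 1"
    using pure_states_normalised[OF \<alpha>] marginal1_normalised[OF n] by (auto simp: normalised_weight)
  have p1: "p \<le> 1" using weight_nonneg[OF p\<alpha>] by (simp add: weight_simps w\<alpha> wA)
  obtain b0 where b0: "b0 \<in> transf T B 1" "(\<I> A \<otimes> b0) \<cdot> \<Psi> = p *\<^sub>R \<alpha>"
    using component_effect[OF \<Psi> scale_state p\<alpha>] pure_states_state[OF \<alpha>] p p1 by auto
  obtain a where a: "a \<in> pure T A 1" "scal (a \<cdot> \<alpha>) = 1" using ex_sharp_effect[OF \<alpha>] by blast
  note at = pure_transf[OF a(1)]
  define x where "x = (a \<otimes> \<I> B) \<cdot> \<Psi>"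
  have xp: "x \<in> pure T 1 B" using pure_left[OF a(1) pure_states_pure[OF \<Psi>]] by (simp add: x_def)
  have wx: "weight B x = scal (a \<cdot> ?A)" unfolding x_def by (rule weight_effect_left[OF at s])
  \<comment> \<open>Since \<open>a\<close> has value 1 on \<open>\<alpha>\<close>, it occurs on the
    whole marginal with probability at least \<open>p\<close>.\<close>
  have "0 \<le> scal (a \<cdot> (?A - p *\<^sub>R \<alpha>))" using pairing_nonneg[of a A] at p\<alpha> by (simp add: effects_eq)
  then have q: "p \<le> weight B x" using a(2) by (simp add: wx lin_simps scal_simps)
  then have "x \<noteq> 0" using p by (auto simp: weight_simps)
  then obtain \<beta> where \<beta>: "\<beta> \<in> pure_states T B" "x = weight B x *\<^sub>R \<beta>" using pure_rescale[OF xp] by blast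
  obtain b where b: "b \<in> pure T B 1" "scal (b \<cdot> \<beta>) = 1" using ex_sharp_effect[OF \<beta>(1)] by blast
  note bt = pure_transf[OF b(1)]
  define y where "y = (\<I> A \<otimes> b) \<cdot> \<Psi>"
  have yp: "y \<in> pure T 1 A" using pure_right[OF b(1), of \<Psi> A] pure_states_pure[OF \<Psi>] by (simp add: y_def)
  have wy: "weight A y = scal (b \<cdot> ?B)" unfolding y_def by (rule weight_effect_right[OF bt s])
  have bx: "scal (b \<cdot> x) = weight B x" using b(2) by (subst \<beta>(2)) (simp add: lin_simps scal_simps)
  have "0 \<le> scal (b \<cdot> (?B - x))"
    using pairing_nonneg[of b B] bt effect_component_left[OF at s] by (simp add: effects_eq x_def)
  then have q2: "weight B x \<le> weight A y" using bx by (simp add: wy lin_simps scal_simps)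
  then have "y \<noteq> 0" using p q by (auto simp: weight_simps)
  then obtain \<alpha>2 where \<alpha>2: "\<alpha>2 \<in> pure_states T A" "y = weight A y *\<^sub>R \<alpha>2" using pure_rescale[OF yp] by blast
  have "weight A y \<le> p" using max[OF \<alpha>2(1), of "weight A y"] \<alpha>2(2) effect_component_right[OF bt s] by (simp add: y_def)
  then have eq: "weight B x = p" "weight A y = p" using q q2 by auto
  \<comment> \<open>Both sides are the joint value of \<open>a \<otimes> b\<close> on
    \<open>\<Psi>\<close>. The equality shows that \<open>a\<close> is certain on
    \<open>\<alpha>2\<close>, and by \<open>sure_unique\<close> it is certain on one normalised
    state only.\<close>
  have "a \<cdot> y = b \<cdot> x"
    unfolding x_def y_def using effect_after_left[OF at bt s] effect_after_right[OF at bt s] by simp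
  then have "scal (a \<cdot> y) = p" using bx eq by simp
  moreover have "scal (a \<cdot> y) = p * scal (a \<cdot> \<alpha>2)" using \<alpha>2(2) eq by (metis scal_simps(2) seq_scale_right real_scaleR_def)
  ultimately have "scal (a \<cdot> \<alpha>2) = 1" using p by simp
  then have "\<alpha>2 = \<alpha>" using sure_unique[OF a(1)] a(2) \<alpha> \<alpha>2(1) pure_states_normalised by blast
  then show ?thesis using p \<alpha> \<beta> a b \<alpha>2 eq x_def y_def by metis
qed

lemma pure_scale:
  assumes "\<phi> \<in> pure_states T A" "0 \<le> q" "q \<le> 1"
  shows "q *\<^sub>R \<phi> \<in> pure T 1 A"
proof (rule pure_stateI)
  show "q *\<^sub>R \<phi> \<in> states T A" using assms pure_states_state scale_state by blast
  fix y z assume yz: "y \<in> states T A" "z \<in> states T A" "q *\<^sub>R \<phi> = y + z"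
  have w: "weight A y + weight A z = q"
    using arg_cong[OF yz(3), of "weight A"] pure_states_normalised[OF assms(1)] by (simp add: weight_simps normalised_weight)
  show "\<exists>c. y = c *\<^sub>R q *\<^sub>R \<phi>"
  proof (cases "q = 0")
    case True
    then have "y = 0" using w weight_nonneg[OF yz(1)] weight_nonneg[OF yz(2)] weight_zero[OF yz(1)] by simp
    then show ?thesis by (intro exI[of _ 0]) simp
  next
    case False
    then have "(1 / q) *\<^sub>R y \<in> states T A" "(1 / q) *\<^sub>R z \<in> states T A"
      using cone_state[OF cone_scale[OF states_cone[OF yz(1)], of "1 / q"]]
        cone_state[OF cone_scale[OF states_cone[OF yz(2)], of "1 / q"]]
        assms(2) w weight_nonneg[OF yz(1)] weight_nonneg[OF yz(2)] False
      by (simp_all add: weight_scale)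
    moreover have "\<phi> = (1 / q) *\<^sub>R y + (1 / q) *\<^sub>R z"
      using False yz(3)[symmetric] by (simp add: scaleR_add_right[symmetric] del: scaleR_add_right)
    ultimately obtain c where "(1 / q) *\<^sub>R y = c *\<^sub>R \<phi>"
      using pure_state_split[OF pure_states_pure[OF assms(1)]] by blast
    then have "q *\<^sub>R ((1 / q) *\<^sub>R y) = q *\<^sub>R (c *\<^sub>R \<phi>)" by simp
    then show ?thesis using False by (intro exI[of _ c]) (simp add: mult.commute)
  qed
qed

lemma weight_product: "\<lbrakk>\<rho> \<in> states T A; \<sigma> \<in> states T B\<rbrakk> \<Longrightarrow> weight (A * B) (\<rho> \<otimes> \<sigma>) = weight A \<rho> * weight B \<sigma>"
proof -
  assume *: "\<rho> \<in> states T A" "\<sigma> \<in> states T B"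
  have "\<u> (A * B) \<cdot> (\<rho> \<otimes> \<sigma>) = (weight A \<rho> * weight B \<sigma>) *\<^sub>R \<I> 1"
    unfolding discard_par using par_states[OF discard_transf discard_transf *]
    by (simp add: discard_state * lin_simps par_ident)
  then show ?thesis by (simp add: weight_def[of "A * B"] scal_simps)
qed

text \<open>The state \<open>x\<close> that \<open>a'\<close> leaves on the reference
  \<open>S\<close> of a Choi state is purified with the output system \<open>Y\<close>; steering
  turns this pure state into a transformation, which is pure by \<open>choi_pure\<close>. The state
  \<open>\<omega>\<close> ensures that \<open>a'\<close> is nonzero, so that \<open>x\<close> can be
  normalised.\<close>

lemma pure_instrument:
  assumes t: "[a, a'] \<in> tests T A 1" and \<omega>: "\<omega> \<in> states T A" "scal (a' \<cdot> \<omega>) \<noteq> 0"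
  shows "\<exists>Y C0 C. [C0, C] \<in> tests T A Y \<and> \<u> Y \<cdot> C0 = a \<and> \<u> Y \<cdot> C = a' \<and> C \<in> pure T A Y"
proof -
  have at: "a \<in> transf T A 1" "a' \<in> transf T A 1" by (auto intro: transf_I[OF t])
  obtain S \<Psi> where \<Psi>: "choi_state A S \<Psi>" using ex_choi_state by blast
  note p = choi_pure_states[OF \<Psi>] note s = pure_states_state[OF p] and n = pure_states_normalised[OF p]
  define x0 x where "x0 = (a \<otimes> \<I> S) \<cdot> \<Psi>" and "x = (a' \<otimes> \<I> S) \<cdot> \<Psi>"
  have xs: "x0 \<in> states T S" "x \<in> states T S" unfolding x0_def x_def using effect_left_state at s by auto
  have sum: "x0 + x = marginal2 T A S \<Psi>"
    unfolding x0_def x_def marginal2_def pairing_complement[OF t, symmetric] by (simp add: lin_simps)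
  have "x \<noteq> 0"
  proof
    assume "x = 0"
    then have "a' = 0" using choi_unique[OF \<Psi> at(2) zero_transf[OF at(2)]] by (simp add: x_def lin_simps)
    then show False using \<omega>(2) by (simp add: lin_simps scal_simps)
  qed
  define q where "q = weight S x"
  have q: "0 < q" "q \<le> 1" unfolding q_def using weight_pos[OF xs(2) \<open>x \<noteq> 0\<close>] weight_le_1[OF xs(2)] by auto
  obtain x1 where x1: "x1 \<in> normalised T S" "x = q *\<^sub>R x1" using state_rescale[OF xs(2)] by (auto simp: q_def)
  obtain Y \<Theta> where \<Theta>: "\<Theta> \<in> pure_states T (S * Y)" "marginal1 T S Y \<Theta> = x1" using purification[OF x1(1)] by blast
  let ?\<Theta> = "swap T S Y \<cdot> \<Theta>"
  have \<Theta>': "?\<Theta> \<in> pure_states T (Y * S)" "marginal2 T Y S ?\<Theta> = x1"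
    using swap_pure_states[OF \<Theta>(1)] marginal2_swap[OF pure_states_state[OF \<Theta>(1)]] \<Theta>(2) by auto
  obtain y where y: "y \<in> normalised T Y" using ex_normalised by blast
  have wy: "weight Y y = 1" using y by (simp add: normalised_weight)
  \<comment> \<open>No purity is demanded of the outcome for \<open>a\<close>, so its output is a
    fixed state \<open>y\<close>, uncorrelated with \<open>S\<close>.\<close>
  let ?xs = "[y \<otimes> x0, q *\<^sub>R ?\<Theta>]"
  have ww: "weight S x0 + q = 1"
    using arg_cong[OF sum, of "weight S"] marginal2_normalised[OF n] by (simp add: q_def weight_simps normalised_weight)
  have test: "?xs \<in> tests T 1 (Y * S)"
    by (rule prep_testI)
      (use state_par[OF normalised_state[OF y] xs(1)] scale_state[OF pure_states_state[OF \<Theta>'(1)]] q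
        weight_product[OF normalised_state[OF y] xs(1)] wy ww pure_states_normalised[OF \<Theta>'(1)]
        in \<open>auto simp: weight_scale normalised_weight\<close>)
  have m0: "marginal2 T Y S (y \<otimes> x0) = x0" using marginal2_product[OF normalised_state[OF y] xs(1)] wy by simp
  have m1: "marginal2 T Y S (q *\<^sub>R ?\<Theta>) = x" using \<Theta>'(2) x1(2) by (simp add: marginal_simps)
  have "marginal2 T Y S (sum_list ?xs) = marginal2 T A S \<Psi>"
    using m0 m1 sum by (simp add: marginal_simps)
  from steering_left[OF p test this]
  obtain cs where cs: "cs \<in> tests T A Y" "length cs = 2" "\<forall>i<2. (cs ! i \<otimes> \<I> S) \<cdot> \<Psi> = ?xs ! i" by auto
  then obtain C0 C where C: "cs = [C0, C]" by (metis One_nat_def Suc_1 length_0_conv length_Suc_conv)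
  have ct: "C0 \<in> transf T A Y" "C \<in> transf T A Y" using transf_I[OF cs(1)] C by auto
  have ev: "(C0 \<otimes> \<I> S) \<cdot> \<Psi> = y \<otimes> x0" "(C \<otimes> \<I> S) \<cdot> \<Psi> = q *\<^sub>R ?\<Theta>" using cs(3) C by (auto simp: numeral_2_eq_2 less_Suc_eq)
  have dm: "((\<u> Y \<cdot> D) \<otimes> \<I> S) \<cdot> \<Psi> = marginal2 T Y S ((D \<otimes> \<I> S) \<cdot> \<Psi>)" if "D \<in> transf T A Y" for D
    unfolding marginal2_def by (rule seq_par_left[symmetric, OF that discard_transf s])
  have "\<u> Y \<cdot> C0 = a"
    by (rule choi_unique[OF \<Psi> seq_transf[OF ct(1) discard_transf] at(1)]) (simp add: dm ct ev m0 flip: x0_def)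
  moreover have "\<u> Y \<cdot> C = a'"
    by (rule choi_unique[OF \<Psi> seq_transf[OF ct(2) discard_transf] at(2)]) (simp add: dm ct ev m1 x_def)
  moreover have "C \<in> pure T A Y"
    by (rule choi_pure[OF \<Psi> ct(2)]) (use pure_scale[OF \<Theta>'(1)] q ev in auto)
  ultimately show ?thesis using cs(1) C by blast
qed

section \<open>Undoing pure transformations that succeed with certainty\<close>

lemma marginal1_append_left:
  assumes "\<gamma> \<in> states T C" "\<Psi> \<in> states T (A * B)"
  shows "marginal1 T (C * A) B (\<gamma> \<otimes> \<Psi>) = \<gamma> \<otimes> marginal1 T A B \<Psi>"
  unfolding marginal1_def ident_par_assoc[OF discard_transf]
  using par_states[OF ident_transf _ assms, of "\<I> A \<otimes> \<u> B" A] par_transf[OF ident_transf discard_transf, of A B]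
    ident_state[OF assms(1)] by simp

lemma marginal2_assoc:
  assumes "\<Psi> \<in> states T (C * (A * B))"
  shows "marginal2 T (C * A) B \<Psi> = marginal2 T A B (marginal2 T C (A * B) \<Psi>)"
proof -
  have t: "\<u> A \<otimes> \<I> B \<in> transf T (A * B) B"
    using par_transf[OF discard_transf ident_transf, of A B] by simp
  have "(\<u> A \<otimes> \<I> B) \<cdot> ((\<u> C \<otimes> \<I> (A * B)) \<cdot> \<Psi>) = (\<u> C \<otimes> (\<u> A \<otimes> \<I> B)) \<cdot> \<Psi>"
    using par_right_left[OF discard_transf t assms] par_unit_left[OF t] by simp
  then show ?thesis
    unfolding marginal2_def discard_par using par_assoc[OF discard_transf discard_transf ident_transf] by simp
qed

lemma marginal2_append_left:
  assumes "\<gamma> \<in> normalised T C" "\<Psi> \<in> states T (A * B)"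
  shows "marginal2 T (C * A) B (\<gamma> \<otimes> \<Psi>) = marginal2 T A B \<Psi>"
  using marginal2_assoc[OF state_par[OF normalised_state[OF assms(1)] assms(2)]] assms
    marginal2_product[OF normalised_state[OF assms(1)] assms(2)] by (simp add: normalised_weight)

lemma purification_connect_left:
  assumes \<Psi>: "\<Psi> \<in> pure_states T (A * B)" and \<Psi>': "\<Psi>' \<in> pure_states T (C * B)"
    and m: "marginal2 T A B \<Psi> = marginal2 T C B \<Psi>'"
    and \<gamma>: "\<gamma> \<in> pure_states T C" and \<alpha>: "\<alpha> \<in> pure_states T A"
  shows "\<exists>U \<in> reversible T (C * A) (A * C). (U \<otimes> \<I> B) \<cdot> (\<gamma> \<otimes> \<Psi>) = \<alpha> \<otimes> \<Psi>'"
proof -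
  note s = pure_states_state[OF \<Psi>] pure_states_state[OF \<Psi>'] pure_states_state[OF \<gamma>] pure_states_state[OF \<alpha>]
  have p: "\<gamma> \<otimes> \<Psi> \<in> pure_states T (C * A * B)" "\<alpha> \<otimes> \<Psi>' \<in> pure_states T (A * C * B)"
    using pure_states_par[OF \<gamma> \<Psi>] pure_states_par[OF \<alpha> \<Psi>'] by (simp_all add: mult.assoc)
  note ps = pure_states_state[OF p(1)] pure_states_state[OF p(2)]
  let ?\<Omega> = "(swap T A C \<otimes> \<I> B) \<cdot> (\<alpha> \<otimes> \<Psi>')"
  have \<Omega>: "?\<Omega> \<in> pure_states T (C * A * B)"
    by (rule reversible_pure_states[OF reversible_par[OF reversible_swap reversible_ident] p(2)])
  have "marginal2 T (C * A) B ?\<Omega> = marginal2 T C B \<Psi>'"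
    using marginal2_par[OF swap_channel ident_transf ps(2)] marginal2_append_left[OF pure_states_normalised[OF \<alpha>] s(2)]
      ident_state[OF marginal2_state[OF s(2)]] by simp
  then obtain V where V: "V \<in> reversible T (C * A) (C * A)" "?\<Omega> = (V \<otimes> \<I> B) \<cdot> (\<gamma> \<otimes> \<Psi>)"
    using purification_unique_left[OF p(1) \<Omega>] m marginal2_append_left[OF pure_states_normalised[OF \<gamma>] s(1)] by auto
  have "((swap T C A \<cdot> V) \<otimes> \<I> B) \<cdot> (\<gamma> \<otimes> \<Psi>) = (swap T C A \<otimes> \<I> B) \<cdot> ?\<Omega>"
    unfolding V(2) by (rule seq_par_left[symmetric, OF reversible_transf[OF V(1)] swap_transf ps(1)])
  also have "\<dots> = (\<I> (A * C) \<otimes> \<I> B) \<cdot> (\<alpha> \<otimes> \<Psi>')"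
    using seq_par_left[OF swap_transf swap_transf ps(2)] swap_swap by simp
  also have "\<dots> = \<alpha> \<otimes> \<Psi>'" using ident_state[OF ps(2)] by (simp add: par_ident)
  finally show ?thesis using reversible_seq[OF V(1) reversible_swap] by blast
qed

text \<open>Certainty on the marginal of \<open>\<Omega>\<close> means, by
  \<open>sure_marginal2\<close>, that the reference \<open>R\<close> is undisturbed; the result is
  another purification of the same state of \<open>R\<close>.\<close>

lemma pure_sure:
  assumes C: "C \<in> pure T A Y" and \<Omega>: "\<Omega> \<in> pure_states T (A * R)"
    and 1: "scal ((\<u> Y \<cdot> C) \<cdot> marginal1 T A R \<Omega>) = 1"
  shows pure_sure_marginal: "marginal2 T Y R ((C \<otimes> \<I> R) \<cdot> \<Omega>) = marginal2 T A R \<Omega>"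
    and pure_sure_pure: "(C \<otimes> \<I> R) \<cdot> \<Omega> \<in> pure_states T (Y * R)"
proof -
  note s = pure_states_state[OF \<Omega>] and ct = pure_transf[OF C]
  note et = seq_transf[OF ct discard_transf]
  have "marginal2 T Y R ((C \<otimes> \<I> R) \<cdot> \<Omega>) = ((\<u> Y \<cdot> C) \<otimes> \<I> R) \<cdot> \<Omega>"
    unfolding marginal2_def by (rule seq_par_left[OF ct discard_transf s])
  also have "\<dots> = marginal2 T A R \<Omega>" by (rule sure_marginal2[OF et pure_states_normalised[OF \<Omega>] 1])
  finally show m: "marginal2 T Y R ((C \<otimes> \<I> R) \<cdot> \<Omega>) = marginal2 T A R \<Omega>" .
  have st: "(C \<otimes> \<I> R) \<cdot> \<Omega> \<in> states T (Y * R)" by (rule par_state[OF ct ident_transf s])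
  have "weight (Y * R) ((C \<otimes> \<I> R) \<cdot> \<Omega>) = weight R (marginal2 T Y R ((C \<otimes> \<I> R) \<cdot> \<Omega>))"
    using weight_channel[OF par_channel[OF discard_channel ident_channel], of _ Y R] st by (simp add: marginal2_def)
  then have "weight (Y * R) ((C \<otimes> \<I> R) \<cdot> \<Omega>) = 1"
    using m marginal2_normalised[OF pure_states_normalised[OF \<Omega>]] by (simp add: normalised_weight)
  then show "(C \<otimes> \<I> R) \<cdot> \<Omega> \<in> pure_states T (Y * R)"
    using pure_left[OF C pure_states_pure[OF \<Omega>]] st by (simp add: pure_states_iff normalised_weight)
qed

text \<open>The residual state is obtained by applying a pure transformation that reveals only the failure
  of the effect \<open>a\<close>; on \<open>\<sigma>\<close> it succeeds with certainty, so it can be undone there.\<close>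

lemma residual_purification:
  assumes \<Psi>: "\<Psi> \<in> pure_states T (A * B)" and a: "a \<in> transf T A 1" and p: "p < 1"
    and \<alpha>: "\<alpha> \<in> states T A" and a\<alpha>: "scal (a \<cdot> \<alpha>) = 1" and \<beta>: "(a \<otimes> \<I> B) \<cdot> \<Psi> = p *\<^sub>R \<beta>" "\<beta> \<in> normalised T B"
    and \<sigma>: "\<sigma> \<in> normalised T A" "marginal1 T A B \<Psi> = p *\<^sub>R \<alpha> + (1 - p) *\<^sub>R \<sigma>"
    and \<tau>: "marginal2 T A B \<Psi> = p *\<^sub>R \<beta> + (1 - p) *\<^sub>R \<tau>"
  shows "\<exists>\<Psi>' \<in> pure_states T (A * B). marginal1 T A B \<Psi>' = \<sigma> \<and> marginal2 T A B \<Psi>' = \<tau>"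
proof -
  note s = pure_states_state[OF \<Psi>] and n = pure_states_normalised[OF \<Psi>]
  obtain a' where a': "a' \<in> transf T A 1" "[a, a'] \<in> tests T A 1" "\<u> A = a + a'"
    using effect_complement[OF a] by blast
  have wA: "weight A \<alpha> = 1"
    using pairing_le_weight[of a A \<alpha>] a \<alpha> a\<alpha> weight_le_1[OF \<alpha>] by (simp add: effects_eq)
  have "scal (a \<cdot> marginal1 T A B \<Psi>) = p"
    using weight_effect_left[OF a s] \<beta> by (simp add: weight_scale normalised_weight)
  then have a\<sigma>: "scal (a \<cdot> \<sigma>) = 0" using p by (simp add: \<sigma>(2) lin_simps scal_simps a\<alpha>)
  have a'v: "scal (a' \<cdot> \<sigma>) = 1" "scal (a' \<cdot> \<alpha>) = 0"
    using \<sigma>(1) wA a\<sigma> a\<alpha> unfolding normalised_weight weight_def a'(3) by (auto simp: lin_simps scal_simps)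
  obtain Y C0 C where C: "\<u> Y \<cdot> C = a'" "C \<in> pure T A Y"
    using pure_instrument[OF a'(2) normalised_state[OF \<sigma>(1)]] a'v by auto
  note ct = pure_transf[OF C(2)]
  obtain R \<Omega> where \<Omega>: "\<Omega> \<in> pure_states T (A * R)" "marginal1 T A R \<Omega> = \<sigma>" using purification[OF \<sigma>(1)] by blast
  note \<Omega>s = pure_states_state[OF \<Omega>(1)]
  obtain \<alpha>0 y0 where \<alpha>0: "\<alpha>0 \<in> pure_states T A" and y0: "y0 \<in> pure_states T Y" using ex_pure_state by meson
  note \<alpha>0s = pure_states_state[OF \<alpha>0] and y0s = pure_states_state[OF y0]
  \<comment> \<open>Both \<open>\<Omega>\<close> and its image under \<open>C\<close> purify the
    same state of \<open>R\<close>, so a reversible channel undoes \<open>C\<close> on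
    \<open>\<sigma>\<close>, with \<open>\<alpha>0\<close> and \<open>y0\<close> as padding.\<close>
  obtain U where U: "U \<in> reversible T (A * Y) (Y * A)" "(U \<otimes> \<I> R) \<cdot> (\<alpha>0 \<otimes> ((C \<otimes> \<I> R) \<cdot> \<Omega>)) = y0 \<otimes> \<Omega>"
    using purification_connect_left[OF pure_sure_pure[OF C(2) \<Omega>(1)] \<Omega>(1) pure_sure_marginal[OF C(2) \<Omega>(1)] \<alpha>0 y0]
      C(1) \<Omega>(2) a'v(1) by auto
  have m1: "marginal1 T Y Z ((C \<otimes> \<I> Z) \<cdot> X) = C \<cdot> marginal1 T A Z X" if "X \<in> states T (A * Z)" for X Z
    by (rule marginal1_par[OF ct ident_channel that])
  have U\<sigma>: "U \<cdot> (\<alpha>0 \<otimes> (C \<cdot> \<sigma>)) = y0 \<otimes> \<sigma>"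
  proof -
    have c: "(C \<otimes> \<I> R) \<cdot> \<Omega> \<in> states T (Y * R)" by (rule par_state[OF ct ident_transf \<Omega>s])
    have "marginal1 T (Y * A) R ((U \<otimes> \<I> R) \<cdot> (\<alpha>0 \<otimes> ((C \<otimes> \<I> R) \<cdot> \<Omega>))) = U \<cdot> (\<alpha>0 \<otimes> (C \<cdot> \<sigma>))"
      using marginal1_par[OF reversible_transf[OF U(1)] ident_channel, of "\<alpha>0 \<otimes> ((C \<otimes> \<I> R) \<cdot> \<Omega>)" R]
        state_par[OF \<alpha>0s c] marginal1_append_left[OF \<alpha>0s c] m1[OF \<Omega>s] \<Omega>(2) by (simp add: mult.assoc)
    then show ?thesis using U(2) marginal1_append_left[OF y0s \<Omega>s] \<Omega>(2) by simp
  qed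
  define X where "X = (C \<otimes> \<I> B) \<cdot> \<Psi>"
  have Xp: "X \<in> pure T 1 (Y * B)" unfolding X_def by (rule pure_left[OF C(2) pure_states_pure[OF \<Psi>]])
  have Xs: "X \<in> states T (Y * B)" unfolding X_def by (rule par_state[OF ct ident_transf s])
  have m2X: "marginal2 T Y B X = (1 - p) *\<^sub>R \<tau>"
  proof -
    have "marginal2 T Y B X = (a' \<otimes> \<I> B) \<cdot> \<Psi>"
      unfolding X_def marginal2_def using seq_par_left[OF ct discard_transf s] C(1) by simp
    moreover have "(a \<otimes> \<I> B) \<cdot> \<Psi> + (a' \<otimes> \<I> B) \<cdot> \<Psi> = p *\<^sub>R \<beta> + (1 - p) *\<^sub>R \<tau>"
      using \<tau> by (simp add: marginal2_def a'(3) lin_simps)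
    ultimately show ?thesis using \<beta>(1) by simp
  qed
  \<comment> \<open>The effect \<open>a\<close> never fails on \<open>\<alpha>\<close>, so this
    component drops out of the first marginal.\<close>
  have "C \<cdot> \<alpha> = 0"
  proof (rule weight_zero[OF state_seq[OF ct \<alpha>]])
    show "weight Y (C \<cdot> \<alpha>) = 0"
      using state_assoc[OF ct discard_transf \<alpha>] C(1) a'v(2) by (simp add: weight_def)
  qed
  then have m1X: "marginal1 T Y B X = (1 - p) *\<^sub>R (C \<cdot> \<sigma>)"
    unfolding X_def m1[OF s] \<sigma>(2) by (simp add: lin_simps)
  have wX: "weight (Y * B) X = 1 - p"
  proof -
    have "weight (Y * B) X = weight Y (marginal1 T Y B X)"
      using weight_channel[OF par_channel[OF ident_channel discard_channel], of X Y B] Xs by (simp add: marginal1_def)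
    also have "\<dots> = (1 - p) * scal (a' \<cdot> \<sigma>)"
      using m1X state_assoc[OF ct discard_transf normalised_state[OF \<sigma>(1)]] C(1)
      by (simp add: weight_def lin_simps scal_simps)
    finally show ?thesis using a'v by simp
  qed
  then have "X \<noteq> 0" using p by (auto simp: weight_simps)
  then obtain \<Psi>1 where \<Psi>1: "\<Psi>1 \<in> pure_states T (Y * B)" "X = (1 - p) *\<^sub>R \<Psi>1" using pure_rescale[OF Xp] wX by auto
  note \<Psi>1s = pure_states_state[OF \<Psi>1(1)]
  have m: "marginal1 T Y B \<Psi>1 = C \<cdot> \<sigma>" "marginal2 T Y B \<Psi>1 = \<tau>"
    using m1X m2X p unfolding \<Psi>1(2) by (auto simp: marginal_simps)
  \<comment> \<open>Undoing \<open>C\<close> on \<open>\<Psi>1\<close> makes the marginal on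
    \<open>Y * A\<close> equal to \<open>y0 \<otimes> \<sigma>\<close>; the pure factor
    \<open>y0\<close> then splits off and leaves a pure state of \<open>A * B\<close>.\<close>
  define \<Xi> where "\<Xi> = (U \<otimes> \<I> B) \<cdot> (\<alpha>0 \<otimes> \<Psi>1)"
  have \<alpha>\<Psi>: "\<alpha>0 \<otimes> \<Psi>1 \<in> pure_states T (A * Y * B)" using pure_states_par[OF \<alpha>0 \<Psi>1(1)] by (simp add: mult.assoc)
  have \<Xi>: "\<Xi> \<in> pure_states T (Y * A * B)"
    unfolding \<Xi>_def by (rule reversible_pure_states[OF reversible_par[OF U(1) reversible_ident] \<alpha>\<Psi>])
  have \<Xi>m: "marginal1 T (Y * A) B \<Xi> = y0 \<otimes> \<sigma>"
    unfolding \<Xi>_def using marginal1_par[OF reversible_transf[OF U(1)] ident_channel pure_states_state[OF \<alpha>\<Psi>]]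
      marginal1_append_left[OF \<alpha>0s \<Psi>1s] m(1) U\<sigma> by simp
  have \<Xi>m2: "marginal2 T (Y * A) B \<Xi> = \<tau>"
    unfolding \<Xi>_def using marginal2_par[OF reversible_channel[OF U(1)] ident_transf pure_states_state[OF \<alpha>\<Psi>]]
      marginal2_append_left[OF pure_states_normalised[OF \<alpha>0] \<Psi>1s] m(2) ident_state[OF marginal2_state[OF \<Psi>1s]] by simp
  have \<Xi>': "\<Xi> \<in> pure_states T (Y * (A * B))" using \<Xi> by (simp add: mult.assoc)
  have "marginal1 T Y (A * B) \<Xi> = y0"
    using marginal1_assoc[OF pure_states_state[OF \<Xi>']] \<Xi>m marginal1_product[OF y0s normalised_state[OF \<sigma>(1)]] \<sigma>(1)
    by (simp add: normalised_weight)
  then obtain \<Psi>' where \<Psi>': "\<Psi>' \<in> pure_states T (A * B)" "\<Xi> = y0 \<otimes> \<Psi>'"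
    using pure_marginal1_product[OF \<Xi>'] y0 by auto
  note \<Psi>'s = pure_states_state[OF \<Psi>'(1)]
  have wy: "weight Y y0 = 1" using pure_states_normalised[OF y0] by (simp add: normalised_weight)
  have "marginal2 T Y A (y0 \<otimes> marginal1 T A B \<Psi>') = marginal2 T Y A (y0 \<otimes> \<sigma>)"
    using \<Xi>m marginal1_append_left[OF y0s \<Psi>'s] \<Psi>'(2) by simp
  then have "marginal1 T A B \<Psi>' = \<sigma>"
    using marginal2_product[OF y0s marginal1_state[OF \<Psi>'s]] marginal2_product[OF y0s normalised_state[OF \<sigma>(1)]] wy by simp
  moreover have "marginal2 T A B \<Psi>' = \<tau>"
    using \<Xi>m2 marginal2_append_left[OF pure_states_normalised[OF y0] \<Psi>'s] \<Psi>'(2) by simp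
  ultimately show ?thesis using \<Psi>'(1) by blast
qed

lemma purification_channel_left:
  assumes \<Psi>: "\<Psi> \<in> pure_states T (A * B)" and \<Psi>': "\<Psi>' \<in> pure_states T (C * B)"
    and m: "marginal2 T A B \<Psi> = marginal2 T C B \<Psi>'"
  shows "\<exists>D \<in> channels T A C. (D \<otimes> \<I> B) \<cdot> \<Psi> = \<Psi>'"
proof -
  note s = pure_states_state[OF \<Psi>] pure_states_state[OF \<Psi>']
  obtain D where D: "D \<in> channels T A C" "(\<I> B \<otimes> D) \<cdot> (swap T A B \<cdot> \<Psi>) = swap T C B \<cdot> \<Psi>'"
    using purification_channel[OF swap_pure_states[OF \<Psi>] swap_pure_states[OF \<Psi>']]
      marginal1_swap[OF s(1)] marginal1_swap[OF s(2)] m by auto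
  have "(D \<otimes> \<I> B) \<cdot> \<Psi> = swap T B C \<cdot> ((\<I> B \<otimes> D) \<cdot> (swap T A B \<cdot> \<Psi>))"
    using swap_par[OF ident_transf channel_transf[OF D(1)] swap_state[OF s(1)]] swap_swap_state[OF s(1)] by simp
  also have "\<dots> = \<Psi>'" unfolding D(2) by (rule swap_swap_state[OF s(2)])
  finally show ?thesis using D(1) by blast
qed

text \<open>By \<open>pure_sure\<close> a channel on \<open>Y\<close> restores the purification
  \<open>\<Omega>\<close> itself. A component of \<open>\<omega>\<close> is obtained from
  \<open>\<Omega>\<close> by an effect on \<open>R\<close>, which commutes with everything done on
  the other side, so the component is restored as well.\<close>

lemma pure_sure_recover:
  assumes C: "C \<in> pure T A Y" and \<omega>: "\<omega> \<in> normalised T A" and 1: "scal ((\<u> Y \<cdot> C) \<cdot> \<omega>) = 1"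
  shows "\<exists>D \<in> channels T Y A. \<forall>x \<in> states T A. \<omega> - x \<in> states T A \<longrightarrow> D \<cdot> (C \<cdot> x) = x"
proof -
  obtain R \<Omega> where \<Omega>: "\<Omega> \<in> pure_states T (A * R)" "marginal1 T A R \<Omega> = \<omega>" using purification[OF \<omega>] by blast
  note s = pure_states_state[OF \<Omega>(1)] and ct = pure_transf[OF C]
  note ps = pure_sure[OF C \<Omega>(1)]
  obtain D where D: "D \<in> channels T Y A" "(D \<otimes> \<I> R) \<cdot> ((C \<otimes> \<I> R) \<cdot> \<Omega>) = \<Omega>"
    using purification_channel_left[OF ps(2) \<Omega>(1) ps(1)] \<Omega>(2) 1 by auto
  note dt = channel_transf[OF D(1)] and Cs = par_state[OF ct ident_transf s]
  have "D \<cdot> (C \<cdot> x) = x" if x: "x \<in> states T A" "\<omega> - x \<in> states T A" for x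
  proof -
    obtain c where c: "c \<in> transf T R 1" "(\<I> A \<otimes> c) \<cdot> \<Omega> = x"
      using component_effect[OF \<Omega>(1) x(1)] x(2) \<Omega>(2) by auto
    have "E \<cdot> ((\<I> A' \<otimes> c) \<cdot> X) = (\<I> A'' \<otimes> c) \<cdot> ((E \<otimes> \<I> R) \<cdot> X)"
      if "E \<in> transf T A' A''" "X \<in> states T (A' * R)" for E A' A'' X
      using par_left_right[OF that(1) c(1) that(2)] par_right_left[OF that(1) c(1) that(2)] par_unit_right[OF that(1)]
      by simp
    then show ?thesis using ct dt s Cs c(2) D(2) by metis
  qed
  then show ?thesis using D(1) by blast
qed

text \<open>Each effect has to exclude only the later states. Successive removal of components
  produces exactly this, whereas the effects of different steps are not known to form one
  observation-test.\<close>

primrec triangular :: "'a \<Rightarrow> 'b list \<Rightarrow> bool" where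
  "triangular A [] \<longleftrightarrow> True"
| "triangular A (\<alpha> # \<alpha>s) \<longleftrightarrow> \<alpha> \<in> normalised T A \<and>
     (\<exists>a \<in> transf T A 1. scal (a \<cdot> \<alpha>) = 1 \<and> (\<forall>\<beta> \<in> set \<alpha>s. scal (a \<cdot> \<beta>) = 0)) \<and> triangular A \<alpha>s"

lemma triangular_normalised: "triangular A \<alpha>s \<Longrightarrow> set \<alpha>s \<subseteq> normalised T A"
  by (induction \<alpha>s) auto

lemma perfectly_distinguishable_iff:
  "perfectly_distinguishable T A \<rho>s \<longleftrightarrow> set \<rho>s \<subseteq> normalised T A \<and>
    (\<exists>as \<in> tests T A 1. length as = length \<rho>s \<and>
      (\<forall>i<length \<rho>s. \<forall>j<length \<rho>s. scal (as ! i \<cdot> \<rho>s ! j) = (if i = j then 1 else 0)))"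
proof -
  have "prob T (as ! i) (\<rho>s ! j) = scal (as ! i \<cdot> \<rho>s ! j)"
    if "set \<rho>s \<subseteq> normalised T A" "as \<in> tests T A 1" "length as = length \<rho>s" "i < length \<rho>s" "j < length \<rho>s" for as i j
    by (rule prob_scal[of _ A]) (use that transf_nth[OF that(2)] normalised_state[OF subsetD[OF that(1) nth_mem]] in \<open>auto simp: effects_eq\<close>)
  then show ?thesis unfolding perfectly_distinguishable_def by (auto 0 3)
qed

text \<open>A single state that has every \<open>\<rho>\<close> as a component lets one recovery
  channel serve all of them; effects that vanish on every \<open>\<rho>\<close> still vanish on
  it.\<close>

lemma average_full_rank:
  assumes "set \<rho>s \<subseteq> normalised T A" "\<rho>s \<noteq> []"
  shows "\<exists>\<omega> \<in> normalised T A. (\<forall>\<rho> \<in> set \<rho>s. \<exists>r>0. \<omega> - r *\<^sub>R \<rho> \<in> states T A) \<and>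
    (\<forall>a. (\<forall>\<rho> \<in> set \<rho>s. scal (a \<cdot> \<rho>) = 0) \<longrightarrow> scal (a \<cdot> \<omega>) = 0)"
  using assms
proof (induction \<rho>s)
  case (Cons \<rho> \<rho>s)
  show ?case
  proof (cases "\<rho>s = []")
    case True
    then show ?thesis using Cons.prems zero_state by (intro bexI[of _ \<rho>]) (auto intro!: exI[of _ 1])
  next
    case False
    then obtain \<omega> where \<omega>: "\<omega> \<in> normalised T A" "\<forall>\<rho> \<in> set \<rho>s. \<exists>r>0. \<omega> - r *\<^sub>R \<rho> \<in> states T A"
      "\<forall>a. (\<forall>\<rho> \<in> set \<rho>s. scal (a \<cdot> \<rho>) = 0) \<longrightarrow> scal (a \<cdot> \<omega>) = 0" using Cons by auto
    define \<omega>' where "\<omega>' = (1/2) *\<^sub>R \<rho> + (1/2) *\<^sub>R \<omega>"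
    have mix: "(1/2) *\<^sub>R x + (1/2) *\<^sub>R y \<in> states T A" if "x \<in> states T A" "y \<in> states T A" for x y
      using subconvex_transf[of x 1 A y "1/2" "1/2"] that by (simp add: states_eq)
    have \<rho>: "\<rho> \<in> normalised T A" using Cons.prems by simp
    note s = normalised_state[OF \<rho>] normalised_state[OF \<omega>(1)]
    have "\<omega>' \<in> normalised T A"
      using mix[OF s] \<rho> \<omega>(1) by (simp add: normalised_weight \<omega>'_def weight_simps)
    moreover have "\<exists>r>0. \<omega>' - r *\<^sub>R x \<in> states T A" if x: "x \<in> set (\<rho> # \<rho>s)" for x
    proof (cases "x = \<rho>")
      case True
      then show ?thesis using scale_state[OF s(2), of "1/2"] by (intro exI[of _ "1/2"]) (simp add: \<omega>'_def)
    next
      case False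
      then obtain r where r: "r > 0" "\<omega> - r *\<^sub>R x \<in> states T A" using x \<omega>(2) by auto
      have "\<omega>' - (r/2) *\<^sub>R x = (1/2) *\<^sub>R \<rho> + (1/2) *\<^sub>R (\<omega> - r *\<^sub>R x)" by (simp add: \<omega>'_def scaleR_diff_right)
      then have "\<omega>' - (r/2) *\<^sub>R x \<in> states T A" using mix[OF s(1) r(2)] by simp
      then show ?thesis using r(1) by (intro exI[of _ "r/2"]) simp
    qed
    moreover have "scal (a \<cdot> \<omega>') = 0" if "\<forall>x \<in> set (\<rho> # \<rho>s). scal (a \<cdot> x) = 0" for a
      using that \<omega>(3) by (simp add: \<omega>'_def lin_simps scal_simps)
    ultimately show ?thesis by blast
  qed
qed simp

text \<open>Measure the effects one after another; a failed effect leaves the remaining states undisturbed.\<close>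

lemma triangular_perfectly_distinguishable:
  assumes "triangular A \<alpha>s" "\<alpha>s \<noteq> []"
  shows "perfectly_distinguishable T A \<alpha>s"
  using assms
proof (induction \<alpha>s)
  case (Cons \<alpha> \<alpha>s)
  have \<alpha>: "\<alpha> \<in> normalised T A" and tri: "triangular A \<alpha>s" using Cons.prems by auto
  obtain a where a: "a \<in> transf T A 1" "scal (a \<cdot> \<alpha>) = 1" "\<forall>\<beta> \<in> set \<alpha>s. scal (a \<cdot> \<beta>) = 0"
    using Cons.prems by auto
  show ?case
  proof (cases "\<alpha>s = []")
    case True
    have "scal (\<u> A \<cdot> \<alpha>) = 1" using \<alpha> by (simp add: normalised_weight weight_def)
    then show ?thesis
      unfolding perfectly_distinguishable_iff using True \<alpha> discard_channel[of A]
      by (intro conjI bexI[of _ "[\<u> A]"]) (auto simp: channels_iff)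
  next
    case False
    then have pd: "perfectly_distinguishable T A \<alpha>s" using Cons.IH tri by blast
    then obtain bs where bs: "bs \<in> tests T A 1" "length bs = length \<alpha>s"
      "\<forall>i<length \<alpha>s. \<forall>j<length \<alpha>s. scal (bs ! i \<cdot> \<alpha>s ! j) = (if i = j then 1 else 0)"
      by (auto simp: perfectly_distinguishable_iff)
    note \<alpha>sn = triangular_normalised[OF tri]
    obtain \<omega> where \<omega>: "\<omega> \<in> normalised T A" "\<forall>\<rho> \<in> set \<alpha>s. \<exists>r>0. \<omega> - r *\<^sub>R \<rho> \<in> states T A" "scal (a \<cdot> \<omega>) = 0"
      using average_full_rank[OF \<alpha>sn False] a(3) by blast
    obtain a' where a': "a' \<in> transf T A 1" "[a, a'] \<in> tests T A 1" "\<u> A = a + a'"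
      using effect_complement[OF a(1)] by blast
    have v: "scal (a' \<cdot> \<rho>) = 1 - scal (a \<cdot> \<rho>)" if "\<rho> \<in> normalised T A" for \<rho>
      using that unfolding normalised_weight weight_def a'(3) by (simp add: lin_simps scal_simps)
    obtain Y C0 C where C: "[C0, C] \<in> tests T A Y" "\<u> Y \<cdot> C0 = a" "\<u> Y \<cdot> C = a'" "C \<in> pure T A Y"
      using pure_instrument[OF a'(2) normalised_state[OF \<omega>(1)]] v[OF \<omega>(1)] \<omega>(3) by auto
    note ct = pure_transf[OF C(4)]
    obtain D where D: "D \<in> channels T Y A" "\<forall>x \<in> states T A. \<omega> - x \<in> states T A \<longrightarrow> D \<cdot> (C \<cdot> x) = x"
      using pure_sure_recover[OF C(4) \<omega>(1)] v[OF \<omega>(1)] \<omega>(3) C(3) by auto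
    note dt = channel_transf[OF D(1)]
    have DC: "D \<cdot> (C \<cdot> \<beta>) = \<beta>" if \<beta>: "\<beta> \<in> set \<alpha>s" for \<beta>
    proof -
      have \<beta>s: "\<beta> \<in> states T A" using \<beta> \<alpha>sn normalised_state by blast
      obtain r where r: "r > 0" "\<omega> - r *\<^sub>R \<beta> \<in> states T A" using \<omega>(2) \<beta> by blast
      \<comment> \<open>Comparison of weights; it makes \<open>r *\<^sub>R \<beta>\<close> a state,
        as the recovery property requires.\<close>
      have "0 \<le> 1 - r" using weight_nonneg[OF r(2)] \<omega>(1) \<beta> \<alpha>sn by (auto simp: weight_simps normalised_weight)
      then have "D \<cdot> (C \<cdot> (r *\<^sub>R \<beta>)) = r *\<^sub>R \<beta>" using D(2) r scale_state[OF \<beta>s, of r] by simp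
      then show ?thesis using r(1) by (simp add: lin_simps)
    qed
    let ?bs = "map (\<lambda>d. d \<cdot> C) (map (\<lambda>b. b \<cdot> D) bs)"
    let ?as = "a # ?bs"
    \<comment> \<open>After \<open>C0\<close>, which counts as the outcome \<open>a\<close>, the
      system is discarded; after \<open>C\<close> the recovery \<open>D\<close> is followed by the
      inductive test.\<close>
    have "concat (map2 (\<lambda>c. map (\<lambda>d. d \<cdot> c)) [C0, C] [[\<u> Y], map (\<lambda>b. b \<cdot> D) bs]) \<in> tests T A 1"
      by (rule seq_test[OF C(1)])
        (use discard_channel[of Y] test_pre[OF D(1) bs(1)] in \<open>auto simp: channels_iff\<close>)
    then have as: "?as \<in> tests T A 1" using C(2) by simp
    have at: "?bs ! i \<in> transf T A 1" if "i < length \<alpha>s" for i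
      using transf_nth[OF as, of "Suc i"] that bs(2) by simp
    have bt: "bs ! i \<in> transf T A 1" if "i < length \<alpha>s" for i using transf_nth[OF bs(1)] that bs(2) by simp
    have val: "scal (?bs ! i \<cdot> x) = scal (bs ! i \<cdot> (D \<cdot> (C \<cdot> x)))" if "i < length \<alpha>s" "x \<in> states T A" for i x
      using that bs(2) state_assoc[OF ct seq_transf[OF dt bt] that(2), of i]
        state_assoc[OF dt bt state_seq[OF ct that(2)], of i] by simp
    have z: "scal (?bs ! i \<cdot> \<alpha>) = 0" if i: "i < length \<alpha>s" for i
    proof -
      have "C \<cdot> \<alpha> = 0"
      proof (rule weight_zero[OF state_seq[OF ct normalised_state[OF \<alpha>]]])
        show "weight Y (C \<cdot> \<alpha>) = 0"
          using state_assoc[OF ct discard_transf normalised_state[OF \<alpha>]] C(3) v[OF \<alpha>] a(2) by (simp add: weight_def)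
      qed
      then show ?thesis using val[OF i normalised_state[OF \<alpha>]] by (simp add: lin_simps scal_simps)
    qed
    have "scal (?as ! i \<cdot> (\<alpha> # \<alpha>s) ! j) = (if i = j then 1 else 0)"
      if ij: "i < length (\<alpha> # \<alpha>s)" "j < length (\<alpha> # \<alpha>s)" for i j
    proof (cases i)
      case 0
      then show ?thesis using a ij by (cases j) auto
    next
      case i: (Suc i')
      show ?thesis
      proof (cases j)
        case 0
        then show ?thesis using i z[of i'] ij by simp
      next
        case j: (Suc j')
        have m: "\<alpha>s ! j' \<in> set \<alpha>s" using ij j by simp
        then have "scal (?bs ! i' \<cdot> \<alpha>s ! j') = scal (bs ! i' \<cdot> \<alpha>s ! j')"
          using val[of i' "\<alpha>s ! j'"] DC[OF m] ij i \<alpha>sn normalised_state by auto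
        then show ?thesis using bs(3) ij i j by simp
      qed
    qed
    then show ?thesis
      unfolding perfectly_distinguishable_iff using \<alpha> \<alpha>sn as bs(2) by (intro conjI bexI[of _ ?as]) auto
  qed
qed simp

text \<open>The distinguishing effects are coordinate functionals for the states, so the states are
  linearly independent and their number is bounded by the dimension.\<close>

lemma perfectly_distinguishable_bound: "\<exists>N. \<forall>\<rho>s. perfectly_distinguishable T A \<rho>s \<longrightarrow> length \<rho>s \<le> N"
proof -
  obtain F where F: "finite F" "transf T 1 A \<subseteq> span F" using finite_dimensional by blast
  have "length \<rho>s \<le> card F" if pd: "perfectly_distinguishable T A \<rho>s" for \<rho>s
  proof -
    obtain as where as: "set \<rho>s \<subseteq> normalised T A" 
      "\<forall>i<length \<rho>s. \<forall>j<length \<rho>s. scal (as ! i \<cdot> \<rho>s ! j) = (if i = j then 1 else 0)"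
      using pd by (auto simp: perfectly_distinguishable_iff)
    have dist: "distinct \<rho>s"
      unfolding distinct_conv_nth using as(2) by (metis zero_neq_one)
    have "independent (set \<rho>s)"
      unfolding dependent_def
    proof
      assume "\<exists>x\<in>set \<rho>s. x \<in> span (set \<rho>s - {x})"
      then obtain j where j: "j < length \<rho>s" "\<rho>s ! j \<in> span (set \<rho>s - {\<rho>s ! j})" by (metis in_set_conv_nth)
      have lin: "linear (\<lambda>x. scal (as ! j \<cdot> x))" by (rule linearI) (auto simp: lin_simps scal_simps)
      have "scal (as ! j \<cdot> x) = 0" if "x \<in> set \<rho>s - {\<rho>s ! j}" for x
        using that as(2) j(1) by (auto simp: in_set_conv_nth)
      then have "scal (as ! j \<cdot> \<rho>s ! j) = 0" using linear_eq_0_on_span[OF lin _ j(2)] by blast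
      then show False using as(2) j(1) by simp
    qed
    moreover have "set \<rho>s \<subseteq> span F" using as(1) F(2) normalised_state by (auto simp: states_eq)
    ultimately have "card (set \<rho>s) \<le> card F" using independent_span_bound[OF F(1)] by blast
    then show ?thesis using distinct_card[OF dist] by simp
  qed
  then show ?thesis by blast
qed

lemma sum_list_scale_zero:
  assumes "\<forall>p \<in> set ps. 0 < p" "length ps = length xs" "\<forall>x \<in> set xs. 0 \<le> scal (a \<cdot> x)"
    and "scal (a \<cdot> sum_list (map2 (*\<^sub>R) ps xs)) = 0"
  shows "\<forall>x \<in> set xs. scal (a \<cdot> x) = 0"
proof -
  have nn: "0 \<le> scal (a \<cdot> sum_list (map2 (*\<^sub>R) ps xs))"
    if "\<forall>p \<in> set ps. 0 < p" "\<forall>x \<in> set xs. 0 \<le> scal (a \<cdot> x)" for ps :: "real list" and xs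
    using that by (induction ps xs rule: list_induct2') (auto simp: lin_simps scal_simps)
  show ?thesis
    using assms(2,1,3,4)
  proof (induction ps xs rule: list_induct2)
    case (Cons p ps x xs)
    have "p * scal (a \<cdot> x) + scal (a \<cdot> sum_list (map2 (*\<^sub>R) ps xs)) = 0"
      using Cons.prems by (simp add: lin_simps scal_simps)
    moreover have "0 \<le> p * scal (a \<cdot> x)" "0 \<le> scal (a \<cdot> sum_list (map2 (*\<^sub>R) ps xs))"
      using Cons.prems nn[of ps xs] by auto
    ultimately have z: "p * scal (a \<cdot> x) = 0" "scal (a \<cdot> sum_list (map2 (*\<^sub>R) ps xs)) = 0" by linarith+
    have "0 < p" using Cons.prems(1) by simp
    then have "scal (a \<cdot> x) = 0" using z(1) by simp
    moreover have "\<forall>x \<in> set xs. scal (a \<cdot> x) = 0"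
      by (rule Cons.IH[OF _ _ z(2)]) (use Cons.prems(1,2) in simp_all)
    ultimately show ?case by simp
  qed simp
qed

section \<open>The Schmidt decomposition of the marginals\<close>

lemma sum_list_scale_scale:
  fixes xs :: "'b list"
  shows
  "sum_list (map2 (*\<^sub>R) (map ((*) c) ps) xs) = c *\<^sub>R sum_list (map2 (*\<^sub>R) ps xs)"
  by (induction ps xs rule: list_induct2') (auto simp: scaleR_add_right)

text \<open>What is left of the Schmidt form without amplitudes: the marginals are decomposed, with
  one list of weights for both, and \<open>\<Psi>\<close> itself is not expanded. A nonempty
  \<open>ps\<close> provides the reference pair at index 0 in \<open>local_exchange\<close>.\<close>

definition schmidt :: "'a \<Rightarrow> 'a \<Rightarrow> 'b \<Rightarrow> real list \<Rightarrow> 'b list \<Rightarrow> 'b list \<Rightarrow> bool" where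
  "schmidt A B \<Psi> ps \<alpha>s \<beta>s \<longleftrightarrow> length \<alpha>s = length ps \<and> length \<beta>s = length ps \<and> ps \<noteq> [] \<and>
     (\<forall>p \<in> set ps. 0 < p) \<and> set \<alpha>s \<subseteq> pure_states T A \<and> set \<beta>s \<subseteq> pure_states T B \<and>
     triangular A \<alpha>s \<and> triangular B \<beta>s \<and>
     marginal1 T A B \<Psi> = sum_list (map2 (*\<^sub>R) ps \<alpha>s) \<and> marginal2 T A B \<Psi> = sum_list (map2 (*\<^sub>R) ps \<beta>s)"

text \<open>The case \<open>p = 1\<close> is kept apart because the remainder is normalised by
  \<open>1 - p\<close>. The effects vanish on the remainder since their total probability
  \<open>p\<close> is used up by the component removed.\<close>

lemma schmidt_step:
  assumes \<Psi>: "\<Psi> \<in> pure_states T (A * B)"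
  shows "\<exists>p \<alpha> \<beta>. 0 < p \<and> \<alpha> \<in> pure_states T A \<and> \<beta> \<in> pure_states T B \<and>
    ((p = 1 \<and> marginal1 T A B \<Psi> = \<alpha> \<and> marginal2 T A B \<Psi> = \<beta>) \<or>
     (p < 1 \<and> (\<exists>\<Psi>' \<in> pure_states T (A * B). \<exists>a \<in> transf T A 1. \<exists>b \<in> transf T B 1.
       marginal1 T A B \<Psi> = p *\<^sub>R \<alpha> + (1 - p) *\<^sub>R marginal1 T A B \<Psi>' \<and>
       marginal2 T A B \<Psi> = p *\<^sub>R \<beta> + (1 - p) *\<^sub>R marginal2 T A B \<Psi>' \<and>
       scal (a \<cdot> \<alpha>) = 1 \<and> scal (b \<cdot> \<beta>) = 1 \<and>
       scal (a \<cdot> marginal1 T A B \<Psi>') = 0 \<and> scal (b \<cdot> marginal2 T A B \<Psi>') = 0)))"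
proof -
  note s = pure_states_state[OF \<Psi>] and n = pure_states_normalised[OF \<Psi>]
  obtain p \<alpha> \<beta> a b where p: "0 < p" and \<alpha>: "\<alpha> \<in> pure_states T A" and \<beta>: "\<beta> \<in> pure_states T B"
    and ab: "a \<in> pure T A 1" "b \<in> pure T B 1" "scal (a \<cdot> \<alpha>) = 1" "scal (b \<cdot> \<beta>) = 1"
    and eq: "(a \<otimes> \<I> B) \<cdot> \<Psi> = p *\<^sub>R \<beta>" "(\<I> A \<otimes> b) \<cdot> \<Psi> = p *\<^sub>R \<alpha>"
    using max_component_pair[OF \<Psi>] by blast
  note at = pure_transf[OF ab(1)] and bt = pure_transf[OF ab(2)]
  note \<alpha>n = pure_states_normalised[OF \<alpha>] and \<beta>n = pure_states_normalised[OF \<beta>]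
  let ?A = "marginal1 T A B \<Psi>" and ?B = "marginal2 T A B \<Psi>"
  have rA: "?A - p *\<^sub>R \<alpha> \<in> states T A" and rB: "?B - p *\<^sub>R \<beta> \<in> states T B"
    using effect_component_right[OF bt s] effect_component_left[OF at s] eq by auto
  have wA: "weight A (?A - p *\<^sub>R \<alpha>) = 1 - p" and wB: "weight B (?B - p *\<^sub>R \<beta>) = 1 - p"
    using marginal1_normalised[OF n] marginal2_normalised[OF n] \<alpha>n \<beta>n by (auto simp: weight_simps normalised_weight)
  have p1: "p \<le> 1" using weight_nonneg[OF rA] wA by simp
  show ?thesis
  proof (cases "p = 1")
    case True
    then have "?A = \<alpha>" "?B = \<beta>" using weight_zero[OF rA] weight_zero[OF rB] wA wB by auto
    then show ?thesis using True \<alpha> \<beta> by (intro exI[of _ 1] exI[of _ \<alpha>] exI[of _ \<beta>]) auto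
  next
    case False
    then have p2: "p < 1" using p1 by simp
    obtain \<sigma> where \<sigma>: "\<sigma> \<in> normalised T A" "?A - p *\<^sub>R \<alpha> = (1 - p) *\<^sub>R \<sigma>" using state_rescale[OF rA] wA by auto
    obtain \<tau> where \<tau>: "\<tau> \<in> normalised T B" "?B - p *\<^sub>R \<beta> = (1 - p) *\<^sub>R \<tau>" using state_rescale[OF rB] wB by auto
    have A: "?A = p *\<^sub>R \<alpha> + (1 - p) *\<^sub>R \<sigma>" and B: "?B = p *\<^sub>R \<beta> + (1 - p) *\<^sub>R \<tau>"
      using \<sigma>(2) \<tau>(2) by (auto simp: diff_eq_eq add.commute)
    obtain \<Psi>' where \<Psi>': "\<Psi>' \<in> pure_states T (A * B)" "marginal1 T A B \<Psi>' = \<sigma>" "marginal2 T A B \<Psi>' = \<tau>"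
      using residual_purification[OF \<Psi> at p2 normalised_state[OF \<alpha>n] ab(3) eq(1) \<beta>n \<sigma>(1) A B] by blast
    have "scal (a \<cdot> ?A) = p" "scal (b \<cdot> ?B) = p"
      using weight_effect_left[OF at s] weight_effect_right[OF bt s] eq \<alpha>n \<beta>n by (auto simp: weight_scale normalised_weight)
    then have "scal (a \<cdot> \<sigma>) = 0" "scal (b \<cdot> \<tau>) = 0" using p2 ab(3,4) unfolding A B by (auto simp: lin_simps scal_simps)
    then show ?thesis using p p2 \<alpha> \<beta> \<Psi>' A B at bt ab(3,4) by blast
  qed
qed

text \<open>The number \<open>k\<close> is fuel for the repeated removal: either it ends with a
  decomposition, or it has produced \<open>k\<close> states in triangular position. These are
  perfectly distinguishable, so the second alternative fails for large \<open>k\<close>.\<close>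

lemma schmidt_or_triangular:
  assumes "\<Psi> \<in> pure_states T (A * B)"
  shows "(\<exists>ps \<alpha>s \<beta>s. schmidt A B \<Psi> ps \<alpha>s \<beta>s) \<or>
    (\<exists>\<alpha>s. length \<alpha>s = k \<and> triangular A \<alpha>s \<and> (\<forall>\<alpha> \<in> set \<alpha>s. \<exists>r>0. marginal1 T A B \<Psi> - r *\<^sub>R \<alpha> \<in> states T A))"
  using assms
proof (induction k arbitrary: \<Psi>)
  case (Suc k)
  note n = pure_states_normalised[OF Suc.prems]
  from schmidt_step[OF Suc.prems] obtain p \<alpha> \<beta> where
    p: "0 < p" and \<alpha>: "\<alpha> \<in> pure_states T A" and \<beta>: "\<beta> \<in> pure_states T B" and
    alt: "(p = 1 \<and> marginal1 T A B \<Psi> = \<alpha> \<and> marginal2 T A B \<Psi> = \<beta>) \<or>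
     (p < 1 \<and> (\<exists>\<Psi>' \<in> pure_states T (A * B). \<exists>a \<in> transf T A 1. \<exists>b \<in> transf T B 1.
       marginal1 T A B \<Psi> = p *\<^sub>R \<alpha> + (1 - p) *\<^sub>R marginal1 T A B \<Psi>' \<and>
       marginal2 T A B \<Psi> = p *\<^sub>R \<beta> + (1 - p) *\<^sub>R marginal2 T A B \<Psi>' \<and>
       scal (a \<cdot> \<alpha>) = 1 \<and> scal (b \<cdot> \<beta>) = 1 \<and>
       scal (a \<cdot> marginal1 T A B \<Psi>') = 0 \<and> scal (b \<cdot> marginal2 T A B \<Psi>') = 0))" by blast
  note \<alpha>n = pure_states_normalised[OF \<alpha>] and \<beta>n = pure_states_normalised[OF \<beta>]
  note \<alpha>s = pure_states_state[OF \<alpha>]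
  have sharp: "\<exists>a \<in> transf T C 1. scal (a \<cdot> \<phi>) = 1" if "\<phi> \<in> pure_states T C" for C \<phi>
    using ex_sharp_effect[OF that] pure_transf by blast
  from alt show ?case
  proof (elim disjE conjE bexE)
    assume "p = 1" "marginal1 T A B \<Psi> = \<alpha>" "marginal2 T A B \<Psi> = \<beta>"
    then have "schmidt A B \<Psi> [1] [\<alpha>] [\<beta>]"
      using \<alpha> \<beta> \<alpha>n \<beta>n sharp[OF \<alpha>] sharp[OF \<beta>] by (auto simp: schmidt_def)
    then show ?thesis by blast
  next
    fix \<Psi>' a b
    assume p1: "p < 1" and \<Psi>': "\<Psi>' \<in> pure_states T (A * B)" and a: "a \<in> transf T A 1" and b: "b \<in> transf T B 1"
      and m: "marginal1 T A B \<Psi> = p *\<^sub>R \<alpha> + (1 - p) *\<^sub>R marginal1 T A B \<Psi>'"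
        "marginal2 T A B \<Psi> = p *\<^sub>R \<beta> + (1 - p) *\<^sub>R marginal2 T A B \<Psi>'"
      and v: "scal (a \<cdot> \<alpha>) = 1" "scal (b \<cdot> \<beta>) = 1"
        "scal (a \<cdot> marginal1 T A B \<Psi>') = 0" "scal (b \<cdot> marginal2 T A B \<Psi>') = 0"
    note s' = pure_states_state[OF \<Psi>']
    have nn: "0 \<le> scal (c \<cdot> x)" if "c \<in> transf T C 1" "x \<in> states T C" for c x C
      using pairing_nonneg that by (simp add: effects_eq)
    from Suc.IH[OF \<Psi>'] show ?thesis
    proof (elim disjE exE conjE)
      fix ps \<alpha>s \<beta>s assume "schmidt A B \<Psi>' ps \<alpha>s \<beta>s"
      then have S: "length \<alpha>s = length ps" "length \<beta>s = length ps" "\<forall>p \<in> set ps. 0 < p"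
        "set \<alpha>s \<subseteq> pure_states T A" "set \<beta>s \<subseteq> pure_states T B" "triangular A \<alpha>s" "triangular B \<beta>s"
        "marginal1 T A B \<Psi>' = sum_list (map2 (*\<^sub>R) ps \<alpha>s)" "marginal2 T A B \<Psi>' = sum_list (map2 (*\<^sub>R) ps \<beta>s)"
        by (auto simp: schmidt_def)
      have "\<forall>x \<in> set \<alpha>s. scal (a \<cdot> x) = 0"
        by (rule sum_list_scale_zero[OF S(3)]) (use S v nn a pure_states_state in auto)
      moreover have "\<forall>x \<in> set \<beta>s. scal (b \<cdot> x) = 0"
        by (rule sum_list_scale_zero[OF S(3)]) (use S v nn b pure_states_state in auto)
      ultimately have "schmidt A B \<Psi> (p # map ((*) (1 - p)) ps) (\<alpha> # \<alpha>s) (\<beta> # \<beta>s)"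
        unfolding schmidt_def using S p p1 \<alpha> \<beta> \<alpha>n \<beta>n a b v m by (auto simp: sum_list_scale_scale)
      then show ?thesis by blast
    next
      fix \<alpha>s assume S: "length \<alpha>s = k" "triangular A \<alpha>s"
        "\<forall>\<alpha> \<in> set \<alpha>s. \<exists>r>0. marginal1 T A B \<Psi>' - r *\<^sub>R \<alpha> \<in> states T A"
      have z: "scal (a \<cdot> x) = 0 \<and> (\<exists>r>0. marginal1 T A B \<Psi> - r *\<^sub>R x \<in> states T A)" if x: "x \<in> set \<alpha>s" for x
      proof -
        obtain r where r: "r > 0" "marginal1 T A B \<Psi>' - r *\<^sub>R x \<in> states T A" using S(3) x by blast
        have xs: "x \<in> states T A" using triangular_normalised[OF S(2)] x normalised_state by blast
        \<comment> \<open>The value 0 of \<open>a\<close> on the residual marginal is a sum of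
          nonnegative values on \<open>r *\<^sub>R x\<close> and on the rest.\<close>
        have "0 \<le> - (r * scal (a \<cdot> x))" using nn[OF a r(2)] v by (simp add: lin_simps scal_simps)
        then have "scal (a \<cdot> x) = 0" using nn[OF a xs] r(1) by (simp add: mult_le_0_iff)
        moreover have "p *\<^sub>R \<alpha> + (1 - p) *\<^sub>R (marginal1 T A B \<Psi>' - r *\<^sub>R x) \<in> states T A"
          using subconvex_transf[of \<alpha> 1 A _ p "1 - p"] \<alpha>s r(2) p p1 by (simp add: states_eq)
        then have "marginal1 T A B \<Psi> - ((1 - p) * r) *\<^sub>R x \<in> states T A"
          by (simp add: m(1) scaleR_diff_right algebra_simps)
        moreover have "(1 - p) * r > 0" using p1 r(1) by simp
        ultimately show ?thesis by blast
      qed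
      have "(1 - p) *\<^sub>R marginal1 T A B \<Psi>' \<in> states T A" using p p1 marginal1_state[OF s'] by (intro scale_state) auto
      then have "marginal1 T A B \<Psi> - p *\<^sub>R \<alpha> \<in> states T A" by (simp add: m(1))
      then have "length (\<alpha> # \<alpha>s) = Suc k \<and> triangular A (\<alpha> # \<alpha>s) \<and>
          (\<forall>x \<in> set (\<alpha> # \<alpha>s). \<exists>r>0. marginal1 T A B \<Psi> - r *\<^sub>R x \<in> states T A)"
        using S z p \<alpha>n a v by auto
      then show ?thesis by blast
    qed
  qed
qed (auto intro: exI[of _ "[]"])

lemma ex_schmidt:
  assumes "\<Psi> \<in> pure_states T (A * B)"
  shows "\<exists>ps \<alpha>s \<beta>s. schmidt A B \<Psi> ps \<alpha>s \<beta>s"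
proof -
  obtain N where N: "\<And>\<rho>s. perfectly_distinguishable T A \<rho>s \<Longrightarrow> length \<rho>s \<le> N"
    using perfectly_distinguishable_bound by blast
  have "\<not> (length \<alpha>s = Suc N \<and> triangular A \<alpha>s)" for \<alpha>s
  proof
    assume *: "length \<alpha>s = Suc N \<and> triangular A \<alpha>s"
    then have "\<alpha>s \<noteq> []" by (intro notI) simp
    have "length \<alpha>s \<le> N"
      by (rule N, rule triangular_perfectly_distinguishable) (rule conjunct2[OF *], fact)
    with * show False by simp
  qed
  then show ?thesis using schmidt_or_triangular[OF assms, of "Suc N"] by blast
qed

text \<open>The terms come from the first marginal of a purification in Schmidt form, which also
  makes the sum finite.\<close>

lemma pure_decomposition:
  assumes "x \<in> states T A"
  shows "\<exists>zs. (\<forall>z \<in> set zs. 0 < fst z \<and> snd z \<in> pure_states T A) \<and> x = (\<Sum>z\<leftarrow>zs. fst z *\<^sub>R snd z)"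
proof (cases "x = 0")
  case True
  then show ?thesis by (intro exI[of _ "[]"]) simp
next
  case False
  then have w: "weight A x > 0" using weight_pos[OF assms] by simp
  obtain \<sigma> where \<sigma>: "\<sigma> \<in> normalised T A" "x = weight A x *\<^sub>R \<sigma>" using state_rescale[OF assms] by blast
  obtain B \<Psi> where "\<Psi> \<in> pure_states T (A * B)" "marginal1 T A B \<Psi> = \<sigma>" using purification[OF \<sigma>(1)] by blast
  then obtain ps \<alpha>s where S: "length \<alpha>s = length ps" "\<forall>p \<in> set ps. 0 < p" "set \<alpha>s \<subseteq> pure_states T A"
    "\<sigma> = sum_list (map2 (*\<^sub>R) ps \<alpha>s)"
    using ex_schmidt[of \<Psi> A B] by (auto simp: schmidt_def)
  define zs where "zs = zip (map ((*) (weight A x)) ps) \<alpha>s"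
  have "weight A x *\<^sub>R \<sigma> = sum_list (map2 (*\<^sub>R) (map ((*) (weight A x)) ps) \<alpha>s)"
    unfolding sum_list_scale_scale S(4)[symmetric] ..
  also have "\<dots> = (\<Sum>z\<leftarrow>zs. fst z *\<^sub>R snd z)" by (simp add: zs_def case_prod_unfold)
  finally have "x = (\<Sum>z\<leftarrow>zs. fst z *\<^sub>R snd z)" using \<sigma>(2) by (rule trans[rotated])
  moreover have "0 < fst z \<and> snd z \<in> pure_states T A" if "z \<in> set zs" for z
  proof -
    have "(fst z, snd z) \<in> set (zip (map ((*) (weight A x)) ps) \<alpha>s)" using that by (simp add: zs_def)
    then have "fst z \<in> set (map ((*) (weight A x)) ps)" "snd z \<in> set \<alpha>s"
      by (rule set_zip_leftD, rule set_zip_rightD)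
    then show ?thesis using S(2,3) w by auto
  qed
  ultimately show ?thesis by blast
qed

end

section \<open>Pure maximal sets and local exchange\<close>

lemma length_concat_product: "length (concat (map (\<lambda>x. map (f x) ys) xs)) = length xs * length ys"
  by (induction xs) auto

lemma nth_concat_product:
  "\<lbrakk>i < length xs; j < length ys\<rbrakk> \<Longrightarrow> concat (map (\<lambda>x. map (f x) ys) xs) ! (i * length ys + j) = f (xs ! i) (ys ! j)"
proof (induction xs arbitrary: i)
  case (Cons x xs)
  then show ?case by (cases i) (auto simp: nth_append add.assoc)
qed simp

context sharp_theory_with_purification
begin

lemma perfectly_distinguishable_permute:
  assumes pd: "perfectly_distinguishable T A \<rho>s" and \<pi>: "\<pi> permutes {..<length \<rho>s}"
  shows "perfectly_distinguishable T A (map (\<lambda>i. \<rho>s ! \<pi> i) [0..<length \<rho>s])"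
proof -
  let ?n = "length \<rho>s"
  obtain as where as: "set \<rho>s \<subseteq> normalised T A" "as \<in> tests T A 1" "length as = ?n"
    "\<forall>i<?n. \<forall>j<?n. scal (as ! i \<cdot> \<rho>s ! j) = (if i = j then 1 else 0)"
    using pd by (auto simp: perfectly_distinguishable_iff)
  have lt: "\<pi> i < ?n" if "i < ?n" for i using permutes_in_image[OF \<pi>, of i] that by simp
  \<comment> \<open>Coarse-graining along a bijection only relabels: block \<open>k\<close> of
    \<open>inv \<pi>\<close> is the single outcome \<open>\<pi> k\<close>.\<close>
  have "inv \<pi> ` {..<length as} = {..<?n}" using permutes_image[OF permutes_inv[OF \<pi>]] as(3) by simp
  from coarse_graining[OF as(2) this]
  have "map (\<lambda>k. \<Sum>i | i < length as \<and> inv \<pi> i = k. as ! i) [0..<?n] \<in> tests T A 1" .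
  also have "map (\<lambda>k. \<Sum>i | i < length as \<and> inv \<pi> i = k. as ! i) [0..<?n] = map (\<lambda>k. as ! \<pi> k) [0..<?n]"
  proof (rule map_cong[OF refl])
    fix k assume "k \<in> set [0..<?n]"
    then have "{i. i < length as \<and> inv \<pi> i = k} = {\<pi> k}"
      using lt as(3) permutes_inverses[OF \<pi>] by auto
    then show "(\<Sum>i | i < length as \<and> inv \<pi> i = k. as ! i) = as ! \<pi> k" by simp
  qed
  finally have "map (\<lambda>k. as ! \<pi> k) [0..<?n] \<in> tests T A 1" .
  moreover have "set (map (\<lambda>i. \<rho>s ! \<pi> i) [0..<?n]) \<subseteq> normalised T A" using as(1) lt by auto
  moreover have "scal (as ! \<pi> i \<cdot> \<rho>s ! \<pi> j) = (if i = j then 1 else 0)" if "i < ?n" "j < ?n" for i j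
    using as(4) lt that permutes_inj[OF \<pi>] by (auto simp: inj_eq)
  ultimately show ?thesis
    unfolding perfectly_distinguishable_iff by (intro conjI bexI[of _ "map (\<lambda>k. as ! \<pi> k) [0..<?n]"]) auto
qed

lemma pure_maximal_permute:
  assumes pm: "pure_maximal T A \<phi>s" and \<pi>: "\<pi> permutes {..<length \<phi>s}"
  shows "pure_maximal T A (map (\<lambda>i. \<phi>s ! \<pi> i) [0..<length \<phi>s])"
proof -
  let ?n = "length \<phi>s" and ?\<psi>s = "map (\<lambda>i. \<phi>s ! \<pi> i) [0..<length \<phi>s]"
  have lt: "\<pi> i < ?n" if "i < ?n" for i using permutes_in_image[OF \<pi>, of i] that by simp
  have lt': "inv \<pi> i < ?n" if "i < ?n" for i using permutes_in_image[OF permutes_inv[OF \<pi>], of i] that by simp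
  have "\<not> perfectly_distinguishable T A (?\<psi>s @ [\<sigma>])" for \<sigma>
  proof
    assume pd: "perfectly_distinguishable T A (?\<psi>s @ [\<sigma>])"
    have inv: "inv \<pi> permutes {..<length (?\<psi>s @ [\<sigma>])}"
      by (rule permutes_subset[OF permutes_inv[OF \<pi>]]) auto
    have "map (\<lambda>i. (?\<psi>s @ [\<sigma>]) ! inv \<pi> i) [0..<length (?\<psi>s @ [\<sigma>])] = \<phi>s @ [\<sigma>]"
    proof (rule nth_equalityI)
      fix i assume "i < length (map (\<lambda>i. (?\<psi>s @ [\<sigma>]) ! inv \<pi> i) [0..<length (?\<psi>s @ [\<sigma>])])"
      then consider "i < ?n" | "i = ?n" by (auto simp: less_Suc_eq)
      then show "map (\<lambda>i. (?\<psi>s @ [\<sigma>]) ! inv \<pi> i) [0..<length (?\<psi>s @ [\<sigma>])] ! i = (\<phi>s @ [\<sigma>]) ! i"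
      proof cases
        case 1
        then show ?thesis using lt'[OF 1] permutes_inverses[OF \<pi>] by (simp add: nth_append)
      next
        case 2
        have "inv \<pi> ?n = ?n" by (rule permutes_not_in[OF permutes_inv[OF \<pi>]]) simp
        then show ?thesis using 2 by (simp add: nth_append)
      qed
    qed simp
    then show False using perfectly_distinguishable_permute[OF pd inv] pm by (auto simp: pure_maximal_def)
  qed
  moreover have "set ?\<psi>s \<subseteq> pure_states T A" using pm lt by (auto simp: pure_maximal_def)
  moreover have "perfectly_distinguishable T A ?\<psi>s"
    using perfectly_distinguishable_permute \<pi> pm by (simp add: pure_maximal_def)
  ultimately show ?thesis by (auto simp: pure_maximal_def)
qed

lemma strong_symmetry_imp_permutability:
  assumes "strong_symmetry T"
  shows "permutability T"
  unfolding permutability_def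
proof (intro allI impI)
  fix A \<phi>s \<pi> assume *: "pure_maximal T A \<phi>s \<and> \<pi> permutes {..<length \<phi>s}"
  let ?\<psi>s = "map (\<lambda>i. \<phi>s ! \<pi> i) [0..<length \<phi>s]"
  have "pure_maximal T A \<phi>s" "pure_maximal T A ?\<psi>s" "length \<phi>s = length ?\<psi>s"
    using * pure_maximal_permute by auto
  then have "\<exists>U\<in>reversible T A A. \<forall>i<length \<phi>s. U \<cdot> \<phi>s ! i = ?\<psi>s ! i"
    using assms unfolding strong_symmetry_def by blast
  then show "\<exists>U\<in>reversible T A A. \<forall>i<length \<phi>s. U \<cdot> \<phi>s ! i = \<phi>s ! \<pi> i" by auto
qed

section \<open>Extending distinguishable pure states to pure maximal sets\<close>

lemma component_effect_values:
  assumes e: "e \<in> transf T A 1" and \<sigma>: "\<sigma> \<in> normalised T A" and \<phi>: "\<phi> \<in> normalised T A"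
    and r: "r > 0" "\<sigma> - r *\<^sub>R \<phi> \<in> states T A"
  shows "scal (e \<cdot> \<sigma>) = 0 \<Longrightarrow> scal (e \<cdot> \<phi>) = 0" and "scal (e \<cdot> \<sigma>) = 1 \<Longrightarrow> scal (e \<cdot> \<phi>) = 1"
proof -
  have z: "scal (f \<cdot> \<phi>) = 0" if f: "f \<in> transf T A 1" "scal (f \<cdot> \<sigma>) = 0" for f
  proof -
    have "0 \<le> scal (f \<cdot> (\<sigma> - r *\<^sub>R \<phi>))" "0 \<le> scal (f \<cdot> \<phi>)"
      using pairing_nonneg f r(2) normalised_state[OF \<phi>] by (auto simp: effects_eq)
    then show ?thesis using f(2) r(1) by (simp add: lin_simps scal_simps mult_le_0_iff)
  qed
  show "scal (e \<cdot> \<phi>) = 0" if "scal (e \<cdot> \<sigma>) = 0" using z[OF e that] .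
  obtain e' where e': "e' \<in> transf T A 1" "\<u> A = e + e'" using effect_complement[OF e] by blast
  have v: "scal (e \<cdot> x) + scal (e' \<cdot> x) = 1" if "x \<in> normalised T A" for x
    using that unfolding normalised_weight weight_def e'(2) by (simp add: lin_simps scal_simps)
  show "scal (e \<cdot> \<phi>) = 1" if "scal (e \<cdot> \<sigma>) = 1" using z[OF e'(1)] v[OF \<sigma>] v[OF \<phi>] that by simp
qed

text \<open>An effect with value 0 or 1 on \<open>\<sigma>\<close> has the same value on every
  component of \<open>\<sigma>\<close>, so the same test works for a pure component. Maximality,
  which concerns arbitrary states, thus reduces to extension by pure ones.\<close>

lemma perfectly_distinguishable_pure_component:
  assumes "perfectly_distinguishable T A (\<phi>s @ [\<sigma>])"
  shows "\<exists>\<phi> \<in> pure_states T A. perfectly_distinguishable T A (\<phi>s @ [\<phi>])"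
proof -
  let ?n = "length \<phi>s"
  obtain as where as: "set (\<phi>s @ [\<sigma>]) \<subseteq> normalised T A" "as \<in> tests T A 1" "length as = Suc ?n"
    "\<forall>i<Suc ?n. \<forall>j<Suc ?n. scal (as ! i \<cdot> (\<phi>s @ [\<sigma>]) ! j) = (if i = j then 1 else 0)"
    using assms by (auto simp: perfectly_distinguishable_iff)
  have \<sigma>: "\<sigma> \<in> normalised T A" using as(1) by simp
  then have "\<sigma> \<noteq> 0" by (auto simp: normalised_weight weight_simps)
  then obtain \<phi> r where \<phi>: "\<phi> \<in> pure_states T A" "r > 0" "\<sigma> - r *\<^sub>R \<phi> \<in> states T A"
    using pure_component[OF normalised_state[OF \<sigma>]] by blast
  note \<phi>n = pure_states_normalised[OF \<phi>(1)]
  have "scal (as ! i \<cdot> (\<phi>s @ [\<phi>]) ! j) = (if i = j then 1 else 0)" if ij: "i < Suc ?n" "j < Suc ?n" for i j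
  proof (cases "j < ?n")
    case True
    then show ?thesis using as(4)[rule_format, OF ij] by (simp add: nth_append)
  next
    case False
    then have j: "j = ?n" using ij by simp
    have "scal (as ! i \<cdot> \<sigma>) = (if i = j then 1 else 0)" using as(4)[rule_format, OF ij] j by simp
    then show ?thesis
      using component_effect_values[OF transf_nth[OF as(2)] \<sigma> \<phi>n \<phi>(2,3), of i] as(3) ij j by (auto split: if_splits)
  qed
  then have "perfectly_distinguishable T A (\<phi>s @ [\<phi>])"
    unfolding perfectly_distinguishable_iff using as(1,2,3) \<phi>n by (intro conjI bexI[of _ as]) auto
  then show ?thesis using \<phi>(1) by blast
qed

text \<open>A longest pure extension exists by the dimension bound, and it is maximal because any
  further state could be replaced by a pure one.\<close>

lemma pure_maximal_extend:
  assumes "set \<phi>s \<subseteq> pure_states T A" "perfectly_distinguishable T A \<phi>s"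
  shows "\<exists>\<psi>s. pure_maximal T A (\<phi>s @ \<psi>s)"
proof -
  obtain N where N: "\<And>\<rho>s. perfectly_distinguishable T A \<rho>s \<Longrightarrow> length \<rho>s \<le> N"
    using perfectly_distinguishable_bound by blast
  define P where "P \<psi>s \<longleftrightarrow> set \<psi>s \<subseteq> pure_states T A \<and> perfectly_distinguishable T A (\<phi>s @ \<psi>s)" for \<psi>s
  have "P []" using assms(2) by (simp add: P_def)
  moreover have "length \<psi>s < Suc N" if "P \<psi>s" for \<psi>s
    using N[of "\<phi>s @ \<psi>s"] that by (simp add: P_def)
  ultimately obtain \<psi>s where \<psi>s: "P \<psi>s" "\<forall>\<psi>s'. P \<psi>s' \<longrightarrow> length \<psi>s' \<le> length \<psi>s"
    using Lattices_Big.ex_has_greatest_nat[of P "[]" length "Suc N"] by blast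
  have "\<not> perfectly_distinguishable T A ((\<phi>s @ \<psi>s) @ [\<sigma>])" for \<sigma>
  proof
    assume "perfectly_distinguishable T A ((\<phi>s @ \<psi>s) @ [\<sigma>])"
    then obtain \<phi> where "\<phi> \<in> pure_states T A" "perfectly_distinguishable T A ((\<phi>s @ \<psi>s) @ [\<phi>])"
      using perfectly_distinguishable_pure_component by blast
    then have "P (\<psi>s @ [\<phi>])" using \<psi>s(1) by (simp add: P_def)
    then show False using \<psi>s(2) by fastforce
  qed
  then show ?thesis using \<psi>s(1) assms(1) by (intro exI[of _ \<psi>s]) (auto simp: pure_maximal_def P_def)
qed

section \<open>Products of distinguishable families and their exchange\<close>

lemma scal_product:
  "\<lbrakk>a \<in> transf T A 1; b \<in> transf T B 1; \<alpha> \<in> states T A; \<beta> \<in> states T B\<rbrakk>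
    \<Longrightarrow> scal ((a \<otimes> b) \<cdot> (\<alpha> \<otimes> \<beta>)) = scal (a \<cdot> \<alpha>) * scal (b \<cdot> \<beta>)"
proof -
  assume *: "a \<in> transf T A 1" "b \<in> transf T B 1" "\<alpha> \<in> states T A" "\<beta> \<in> states T B"
  obtain s t where st: "a \<cdot> \<alpha> = s *\<^sub>R \<I> 1" "b \<cdot> \<beta> = t *\<^sub>R \<I> 1"
    using seq_effect_state * unfolding states_eq by metis
  show ?thesis using par_states[OF *] by (simp add: st lin_simps scal_simps par_ident)
qed

lemma perfectly_distinguishable_product:
  assumes "perfectly_distinguishable T A \<alpha>s" "perfectly_distinguishable T B \<beta>s"
  shows "perfectly_distinguishable T (A * B) (concat (map (\<lambda>\<alpha>. map (\<lambda>\<beta>. \<alpha> \<otimes> \<beta>) \<beta>s) \<alpha>s))"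
proof -
  let ?n = "length \<alpha>s" and ?m = "length \<beta>s"
  let ?L = "concat (map (\<lambda>\<alpha>. map (\<lambda>\<beta>. \<alpha> \<otimes> \<beta>) \<beta>s) \<alpha>s)"
  obtain as where as: "set \<alpha>s \<subseteq> normalised T A" "as \<in> tests T A 1" "length as = ?n"
    "\<forall>i<?n. \<forall>j<?n. scal (as ! i \<cdot> \<alpha>s ! j) = (if i = j then 1 else 0)"
    using assms(1) by (auto simp: perfectly_distinguishable_iff)
  obtain bs where bs: "set \<beta>s \<subseteq> normalised T B" "bs \<in> tests T B 1" "length bs = ?m"
    "\<forall>i<?m. \<forall>j<?m. scal (bs ! i \<cdot> \<beta>s ! j) = (if i = j then 1 else 0)"
    using assms(2) by (auto simp: perfectly_distinguishable_iff)
  let ?cs = "concat (map (\<lambda>a. map (\<lambda>b. a \<otimes> b) bs) as)"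
  have cs: "?cs \<in> tests T (A * B) 1" using par_test[OF as(2) bs(2)] by simp
  have L: "set ?L \<subseteq> normalised T (A * B)" using as(1) bs(1) by (auto intro!: normalised_par simp: subset_iff)
  have "scal (?cs ! k \<cdot> ?L ! l) = (if k = l then 1 else 0)" if kl: "k < ?n * ?m" "l < ?n * ?m" for k l
  proof -
    have m: "0 < ?m" using kl by (cases "?m = 0") auto
    let ?i = "k div ?m" and ?j = "k mod ?m" and ?i' = "l div ?m" and ?j' = "l mod ?m"
    have ij: "?i < ?n" "?j < ?m" "?i' < ?n" "?j' < ?m" using kl m by (auto simp: less_mult_imp_div_less)
    have c: "?cs ! k = as ! ?i \<otimes> bs ! ?j"
      using nth_concat_product[of ?i as ?j bs "\<lambda>a b. a \<otimes> b"] ij as(3) bs(3) by simp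
    have l: "?L ! l = \<alpha>s ! ?i' \<otimes> \<beta>s ! ?j'"
      using nth_concat_product[of ?i' \<alpha>s ?j' \<beta>s "\<lambda>a b. a \<otimes> b"] ij by simp
    have "scal (?cs ! k \<cdot> ?L ! l) = scal (as ! ?i \<cdot> \<alpha>s ! ?i') * scal (bs ! ?j \<cdot> \<beta>s ! ?j')"
      unfolding c l
      by (rule scal_product)
        (use ij as(3) bs(3) transf_nth[OF as(2)] transf_nth[OF bs(2)] normalised_state[OF subsetD[OF as(1) nth_mem]]
          normalised_state[OF subsetD[OF bs(1) nth_mem]] in auto)
    also have "\<dots> = (if ?i = ?i' \<and> ?j = ?j' then 1 else 0)" using as(4) bs(4) ij by auto
    also have "(?i = ?i' \<and> ?j = ?j') = (k = l)" by (metis div_mult_mod_eq)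
    finally show ?thesis .
  qed
  then show ?thesis
    unfolding perfectly_distinguishable_iff using cs L as(3) bs(3)
    by (intro conjI bexI[of _ ?cs]) (simp_all add: length_concat_product)
qed

text \<open>Interchanging the two indices permutes the product states; extended by the identity on
  the rest of a pure maximal set, this permutation is implemented by a reversible channel.\<close>

lemma permutability_product_swap:
  assumes perm: "permutability T"
    and \<alpha>: "set \<alpha>s \<subseteq> pure_states T A" "perfectly_distinguishable T A \<alpha>s" "length \<alpha>s = n"
    and \<beta>: "set \<beta>s \<subseteq> pure_states T B" "perfectly_distinguishable T B \<beta>s" "length \<beta>s = n"
  shows "\<exists>U \<in> reversible T (A * B) (A * B). \<forall>i<n. \<forall>j<n. U \<cdot> (\<alpha>s ! i \<otimes> \<beta>s ! j) = \<alpha>s ! j \<otimes> \<beta>s ! i"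
proof -
  let ?L = "concat (map (\<lambda>\<alpha>. map (\<lambda>\<beta>. \<alpha> \<otimes> \<beta>) \<beta>s) \<alpha>s)"
  have len: "length ?L = n * n" by (simp add: length_concat_product \<alpha>(3) \<beta>(3))
  have "set ?L \<subseteq> pure_states T (A * B)" using \<alpha>(1) \<beta>(1) by (auto intro!: pure_states_par simp: subset_iff)
  then obtain \<psi>s where \<psi>s: "pure_maximal T (A * B) (?L @ \<psi>s)"
    using pure_maximal_extend perfectly_distinguishable_product[OF \<alpha>(2) \<beta>(2)] by blast
  \<comment> \<open>The product with indices \<open>i\<close> and \<open>j\<close> stands at
    position \<open>i * n + j\<close>; \<open>\<pi>\<close> interchanges quotient and
    remainder.\<close>
  define \<pi> where "\<pi> k = (if k < n * n then (k mod n) * n + k div n else k)" for k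
  have lt: "i * n + j < n * n" if "i < n" "j < n" for i j
  proof -
    have "i * n + j < Suc i * n" using that by simp
    also have "\<dots> \<le> n * n" using that by (intro mult_le_mono1) simp
    finally show ?thesis .
  qed
  have \<pi>ij: "\<pi> (i * n + j) = j * n + i" if "i < n" "j < n" for i j
    using lt[OF that] that by (simp add: \<pi>_def)
  have inv: "\<pi> (\<pi> k) = k" for k
  proof (cases "k < n * n")
    case True
    then have "0 < n" by (cases n) auto
    then have "k div n < n" "k mod n < n" using True by (auto simp: less_mult_imp_div_less)
    then show ?thesis using True \<pi>ij[of "k mod n" "k div n"] by (simp add: \<pi>_def)
  qed (simp add: \<pi>_def)
  have "\<pi> permutes {..<length (?L @ \<psi>s)}"
    unfolding permutes_def
  proof (intro conjI allI impI)
    show "\<pi> x = x" if "x \<notin> {..<length (?L @ \<psi>s)}" for x using that by (simp add: \<pi>_def len del: length_concat)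
    show "\<exists>!x. \<pi> x = y" for y using inv by metis
  qed
  then obtain U where U: "U \<in> reversible T (A * B) (A * B)"
    "\<forall>i<length (?L @ \<psi>s). U \<cdot> (?L @ \<psi>s) ! i = (?L @ \<psi>s) ! \<pi> i"
    using perm \<psi>s unfolding permutability_def by blast
  have "U \<cdot> (\<alpha>s ! i \<otimes> \<beta>s ! j) = \<alpha>s ! j \<otimes> \<beta>s ! i" if "i < n" "j < n" for i j
  proof -
    have nth: "(?L @ \<psi>s) ! (i * n + j) = \<alpha>s ! i \<otimes> \<beta>s ! j" if "i < n" "j < n" for i j
      using nth_concat_product[of i \<alpha>s j \<beta>s "\<lambda>a b. a \<otimes> b"] lt[OF that] len that \<alpha>(3) \<beta>(3)
      by (simp add: nth_append del: length_concat)
    have "U \<cdot> (?L @ \<psi>s) ! (i * n + j) = (?L @ \<psi>s) ! \<pi> (i * n + j)"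
      using U(2) lt[OF that] len by (simp del: length_concat)
    then show ?thesis using nth that \<pi>ij by simp
  qed
  then show ?thesis using U(1) by blast
qed

text \<open>Controllability speaks of pure maximal sets, so the control states are extended to one,
  with the identity assigned to the additional states.\<close>

lemma controlled_reversible:
  assumes rc: "reversible_controllability T"
    and \<alpha>: "set \<alpha>s \<subseteq> pure_states T A" "perfectly_distinguishable T A \<alpha>s"
    and Us: "length Us = length \<alpha>s" "set Us \<subseteq> reversible T B B"
  shows "\<exists>U \<in> reversible T (A * B) (A * B). \<forall>i<length \<alpha>s. \<forall>\<beta> \<in> states T B. U \<cdot> (\<alpha>s ! i \<otimes> \<beta>) = \<alpha>s ! i \<otimes> (Us ! i \<cdot> \<beta>)"
proof -
  obtain \<psi>s where \<psi>s: "pure_maximal T A (\<alpha>s @ \<psi>s)" using pure_maximal_extend[OF \<alpha>] by blast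
  let ?Us = "Us @ replicate (length \<psi>s) (\<I> B)"
  have "length ?Us = length (\<alpha>s @ \<psi>s)" "set ?Us \<subseteq> reversible T B B" using Us reversible_ident by auto
  then obtain U where U: "U \<in> reversible T (A * B) (A * B)"
    "\<forall>i<length (\<alpha>s @ \<psi>s). U \<cdot> ((\<alpha>s @ \<psi>s) ! i \<otimes> \<I> B) = (\<alpha>s @ \<psi>s) ! i \<otimes> ?Us ! i"
    using rc \<psi>s unfolding reversible_controllability_def by blast
  have "U \<cdot> (\<alpha>s ! i \<otimes> \<beta>) = \<alpha>s ! i \<otimes> (Us ! i \<cdot> \<beta>)" if i: "i < length \<alpha>s" and \<beta>: "\<beta> \<in> states T B" for i \<beta>
  proof -
    have a: "\<alpha>s ! i \<in> states T A" using \<alpha>(1) i pure_states_state nth_mem by blast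
    then have at: "\<alpha>s ! i \<in> transf T 1 A" by (simp add: states_eq)
    have ut: "Us ! i \<in> transf T B B" using Us i reversible_transf by (metis nth_mem subsetD)
    have eq: "U \<cdot> (\<alpha>s ! i \<otimes> \<I> B) = \<alpha>s ! i \<otimes> Us ! i"
      using U(2)[rule_format, of i] i Us(1) by (simp add: nth_append)
    have "U \<cdot> (\<alpha>s ! i \<otimes> \<beta>) = U \<cdot> ((\<alpha>s ! i \<otimes> \<I> B) \<cdot> \<beta>)" using append_left[OF \<beta> a] by simp
    also have "\<dots> = (U \<cdot> (\<alpha>s ! i \<otimes> \<I> B)) \<cdot> \<beta>"
      using state_assoc[OF _ reversible_transf[OF U(1)] \<beta>, of "\<alpha>s ! i \<otimes> \<I> B"] par_transf[OF at ident_transf, of B] by simp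
    also have "\<dots> = (\<alpha>s ! i \<otimes> Us ! i) \<cdot> (\<I> 1 \<otimes> \<beta>)" using eq par_unit_left[of \<beta> 1 B] \<beta> by (simp add: states_eq)
    also have "\<dots> = \<alpha>s ! i \<otimes> (Us ! i \<cdot> \<beta>)"
      using par_states[OF at ut unit_state \<beta>] seq_ident_right[OF at] by simp
    finally show ?thesis .
  qed
  then show ?thesis using U(1) by blast
qed

text \<open>With permutability this is the interchange of indices at \<open>j = 0\<close>. With
  controllability, \<open>\<alpha>s ! i\<close> controls the creation of \<open>\<beta>s ! i\<close>
  from \<open>\<beta>s ! 0\<close>, and \<open>\<beta>s ! i\<close> then controls the reset of
  \<open>\<alpha>s ! i\<close> to \<open>\<alpha>s ! 0\<close>.\<close>

lemma product_exchange:
  assumes ur: "unrestricted_reversibility T"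
    and \<alpha>: "set \<alpha>s \<subseteq> pure_states T A" "perfectly_distinguishable T A \<alpha>s" "length \<alpha>s = n"
    and \<beta>: "set \<beta>s \<subseteq> pure_states T B" "perfectly_distinguishable T B \<beta>s" "length \<beta>s = n"
    and n: "0 < n"
  shows "\<exists>W \<in> reversible T (A * B) (A * B). \<forall>i<n. W \<cdot> (\<alpha>s ! i \<otimes> \<beta>s ! 0) = \<alpha>s ! 0 \<otimes> \<beta>s ! i"
proof -
  consider "permutability T" | "reversible_controllability T"
    using ur strong_symmetry_imp_permutability by (auto simp: unrestricted_reversibility_def)
  then show ?thesis
  proof cases
    case 1
    obtain U where "U \<in> reversible T (A * B) (A * B)" "\<forall>i<n. \<forall>j<n. U \<cdot> (\<alpha>s ! i \<otimes> \<beta>s ! j) = \<alpha>s ! j \<otimes> \<beta>s ! i"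
      using permutability_product_swap[OF 1 \<alpha> \<beta>] by blast
    then show ?thesis using n by (intro bexI[of _ U]) auto
  next
    case 2
    have a: "\<alpha>s ! i \<in> pure_states T A" and b: "\<beta>s ! i \<in> pure_states T B" if "i < n" for i
      using that \<alpha>(1,3) \<beta>(1,3) by (auto simp: subset_iff)
    note as = pure_states_state[OF a] and bs = pure_states_state[OF b]
    have "\<forall>i. \<exists>U. i < n \<longrightarrow> U \<in> reversible T B B \<and> \<beta>s ! i = U \<cdot> \<beta>s ! 0" using transitivity b n by blast
    then obtain U where U: "\<And>i. i < n \<Longrightarrow> U i \<in> reversible T B B" "\<And>i. i < n \<Longrightarrow> \<beta>s ! i = U i \<cdot> \<beta>s ! 0" by metis
    have "\<forall>i. \<exists>V. i < n \<longrightarrow> V \<in> reversible T A A \<and> \<alpha>s ! 0 = V \<cdot> \<alpha>s ! i" using transitivity a n by blast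
    then obtain V where V: "\<And>i. i < n \<Longrightarrow> V i \<in> reversible T A A" "\<And>i. i < n \<Longrightarrow> \<alpha>s ! 0 = V i \<cdot> \<alpha>s ! i" by metis
    have "length (map U [0..<n]) = length \<alpha>s" "set (map U [0..<n]) \<subseteq> reversible T B B"
      "length (map V [0..<n]) = length \<beta>s" "set (map V [0..<n]) \<subseteq> reversible T A A"
      using U(1) V(1) \<alpha>(3) \<beta>(3) by auto
    note cr = controlled_reversible[OF 2 \<alpha>(1,2) this(1,2)] controlled_reversible[OF 2 \<beta>(1,2) this(3,4)]
    obtain X where X: "X \<in> reversible T (A * B) (A * B)"
      "\<forall>i<length \<alpha>s. \<forall>\<beta> \<in> states T B. X \<cdot> (\<alpha>s ! i \<otimes> \<beta>) = \<alpha>s ! i \<otimes> (map U [0..<n] ! i \<cdot> \<beta>)"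
      using cr(1) by blast
    obtain Y where Y: "Y \<in> reversible T (B * A) (B * A)"
      "\<forall>i<length \<beta>s. \<forall>\<alpha> \<in> states T A. Y \<cdot> (\<beta>s ! i \<otimes> \<alpha>) = \<beta>s ! i \<otimes> (map V [0..<n] ! i \<cdot> \<alpha>)"
      using cr(2) by blast
    let ?Z = "swap T B A \<cdot> (Y \<cdot> swap T A B)"
    have Z: "?Z \<in> reversible T (A * B) (A * B)"
      by (rule reversible_seq[OF reversible_seq[OF reversible_swap Y(1)] reversible_swap])
    have "(?Z \<cdot> X) \<cdot> (\<alpha>s ! i \<otimes> \<beta>s ! 0) = \<alpha>s ! 0 \<otimes> \<beta>s ! i" if i: "i < n" for i
    proof -
      have s: "\<alpha>s ! i \<otimes> \<beta>s ! j \<in> states T (A * B)" if "j < n" for j using as[OF i] bs[OF that] by (rule state_par)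
      have x: "X \<cdot> (\<alpha>s ! i \<otimes> \<beta>s ! 0) = \<alpha>s ! i \<otimes> \<beta>s ! i" 
        using X(2)[rule_format, of i "\<beta>s ! 0"] U(2)[OF i] i \<alpha>(3) bs[OF n] by simp
      have "(?Z \<cdot> X) \<cdot> (\<alpha>s ! i \<otimes> \<beta>s ! 0) = swap T B A \<cdot> (Y \<cdot> (swap T A B \<cdot> (\<alpha>s ! i \<otimes> \<beta>s ! i)))"
        using state_assoc[OF reversible_transf[OF X(1)] reversible_transf[OF Z] s[OF n]] x
          state_assoc[OF seq_transf[OF swap_transf reversible_transf[OF Y(1)]] swap_transf s[OF i]]
          state_assoc[OF swap_transf reversible_transf[OF Y(1)] s[OF i]] by simp
      also have "\<dots> = \<alpha>s ! 0 \<otimes> \<beta>s ! i"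
        using swap_product[OF as[OF i] bs[OF i]] Y(2)[rule_format, of i "\<alpha>s ! i"] V(2)[OF i] i \<beta>(3) as[OF i]
          swap_product[OF bs[OF i] as[OF n]] by simp
      finally show ?thesis .
    qed
    then show ?thesis using reversible_seq[OF X(1) Z] by blast
  qed
qed

lemma sum_list_scale_nth:
  fixes xs :: "'b list"
  shows "length xs = length ps \<Longrightarrow> sum_list (map2 (*\<^sub>R) ps xs) = (\<Sum>i<length ps. ps ! i *\<^sub>R xs ! i)"
  by (simp add: sum_list_sum_nth atLeast0LessThan)

text \<open>The marginals of a pure state have the same spectrum, so one reversible channel on \<open>A * B\<close>
  moves the first marginal into \<open>B\<close>; uniqueness of purification supplies the action on the
  other side.\<close>

lemma local_exchange:
  assumes ur: "unrestricted_reversibility T" and \<Psi>: "\<Psi> \<in> pure_states T (A * B)"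
  shows "\<exists>C \<in> channels T A B. \<exists>D \<in> channels T B A. (C \<otimes> D) \<cdot> \<Psi> = swap T A B \<cdot> \<Psi>"
proof -
  note s = pure_states_state[OF \<Psi>]
  obtain ps \<alpha>s \<beta>s where "schmidt A B \<Psi> ps \<alpha>s \<beta>s" using ex_schmidt[OF \<Psi>] by blast
  then have S: "length \<alpha>s = length ps" "length \<beta>s = length ps" "0 < length ps"
    "set \<alpha>s \<subseteq> pure_states T A" "set \<beta>s \<subseteq> pure_states T B" "triangular A \<alpha>s" "triangular B \<beta>s"
    "marginal1 T A B \<Psi> = (\<Sum>i<length ps. ps ! i *\<^sub>R \<alpha>s ! i)"
    "marginal2 T A B \<Psi> = (\<Sum>i<length ps. ps ! i *\<^sub>R \<beta>s ! i)"
    by (auto simp: schmidt_def sum_list_scale_nth)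
  have pd: "perfectly_distinguishable T A \<alpha>s" "perfectly_distinguishable T B \<beta>s"
    using triangular_perfectly_distinguishable S(1,2,3,6,7) by (metis length_greater_0_conv)+
  obtain W where W: "W \<in> reversible T (A * B) (A * B)"
    "\<And>i. i < length ps \<Longrightarrow> W \<cdot> (\<alpha>s ! i \<otimes> \<beta>s ! 0) = \<alpha>s ! 0 \<otimes> \<beta>s ! i"
    using product_exchange[OF ur S(4) pd(1) S(1) S(5) pd(2) S(2,3)] by blast
  define \<alpha> \<beta> where "\<alpha> = \<alpha>s ! 0" and "\<beta> = \<beta>s ! 0"
  have \<alpha>: "\<alpha> \<in> pure_states T A" and \<beta>: "\<beta> \<in> pure_states T B"
    using S(1-5) nth_mem by (auto simp: \<alpha>_def \<beta>_def subset_iff)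
  note \<alpha>s = pure_states_state[OF \<alpha>] and \<beta>s = pure_states_state[OF \<beta>]
  \<comment> \<open>Appending the pure state \<open>\<beta>\<close> and applying \<open>W\<close> is
    both deterministic and pure, so performed on \<open>A\<close> it maps \<open>\<Psi>\<close> to a
    normalised pure state.\<close>
  let ?W = "W \<cdot> (\<I> A \<otimes> \<beta>)"
  have bch: "\<I> A \<otimes> \<beta> \<in> channels T A (A * B)"
    using par_channel[OF ident_channel, of \<beta> 1 B A] pure_states_normalised[OF \<beta>] by (simp add: normalised_channel)
  have bp: "\<I> A \<otimes> \<beta> \<in> pure T A (A * B)"
    using purity_par[OF ident_pure pure_states_pure[OF \<beta>], of A] by simp
  have Wch: "?W \<in> channels T A (A * B)" by (rule seq_channel[OF bch reversible_channel[OF W(1)]])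
  have Wp: "?W \<in> pure T A (A * B)" by (rule purity_seq[OF bp reversible_pure[OF W(1)]])
  note Wt = channel_transf[OF Wch]
  define X where "X = (?W \<otimes> \<I> B) \<cdot> \<Psi>"
  have X: "X \<in> pure_states T (A * B * B)"
    unfolding X_def pure_states_iff
    using pure_left[OF Wp pure_states_pure[OF \<Psi>]] normalised_seq[OF par_channel[OF Wch ident_channel] pure_states_normalised[OF \<Psi>]]
    by blast
  \<comment> \<open>The intended result: \<open>\<Psi>\<close> with its parts exchanged, beside
    \<open>\<alpha>\<close>. It has the same marginal on \<open>A * B\<close> as \<open>X\<close>,
    so a channel on the remaining system leads from \<open>X\<close> to \<open>Z\<close>.\<close>
  define Z where "Z = \<alpha> \<otimes> (swap T A B \<cdot> \<Psi>)"
  have Z: "Z \<in> pure_states T (A * B * A)"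
    unfolding Z_def using pure_states_par[OF \<alpha> swap_pure_states[OF \<Psi>]] by (simp add: mult.assoc)
  have "marginal1 T (A * B) B X = ?W \<cdot> marginal1 T A B \<Psi>"
    unfolding X_def by (rule marginal1_par[OF Wt ident_channel s])
  also have "\<dots> = W \<cdot> (marginal1 T A B \<Psi> \<otimes> \<beta>)"
    using state_assoc[OF channel_transf[OF bch] reversible_transf[OF W(1)] marginal1_state[OF s]]
      append_right[OF marginal1_state[OF s] \<beta>s] by simp
  also have "\<dots> = (\<Sum>i<length ps. ps ! i *\<^sub>R (W \<cdot> (\<alpha>s ! i \<otimes> \<beta>s ! 0)))"
    by (simp add: S(8) par_sum_left seq_sum_right lin_simps \<beta>_def)
  also have "\<dots> = (\<Sum>i<length ps. ps ! i *\<^sub>R (\<alpha>s ! 0 \<otimes> \<beta>s ! i))" using W(2) by (intro sum.cong) auto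
  also have "\<dots> = \<alpha> \<otimes> marginal2 T A B \<Psi>" by (simp add: S(9) par_sum_right lin_simps \<alpha>_def)
  also have "\<dots> = marginal1 T (A * B) A Z"
    unfolding Z_def using marginal1_append_left[OF \<alpha>s swap_state[OF s]] marginal1_swap[OF s] by simp
  finally obtain D where D: "D \<in> channels T B A" "(\<I> (A * B) \<otimes> D) \<cdot> X = Z"
    using purification_channel[OF X Z] by blast
  note dt = channel_transf[OF D(1)]
  have uch: "\<u> A \<otimes> \<I> B \<in> channels T (A * B) B" using par_channel[OF discard_channel ident_channel, of A B] by simp
  note ut = channel_transf[OF uch]
  have "(((\<u> A \<otimes> \<I> B) \<cdot> ?W) \<otimes> D) \<cdot> \<Psi> = ((\<u> A \<otimes> \<I> B) \<otimes> \<I> A) \<cdot> ((?W \<otimes> D) \<cdot> \<Psi>)"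
    using par_seq_state[OF Wt ut dt ident_transf s] seq_ident_left[OF dt] by simp
  also have "(?W \<otimes> D) \<cdot> \<Psi> = Z" using par_right_left[OF Wt dt s] D(2) by (simp add: X_def)
  also have "((\<u> A \<otimes> \<I> B) \<otimes> \<I> A) \<cdot> Z = marginal2 T A (B * A) Z"
    unfolding marginal2_def using par_ident_assoc[OF discard_transf, of A B A] by simp
  also have "\<dots> = swap T A B \<cdot> \<Psi>"
    unfolding Z_def using marginal2_product[OF \<alpha>s swap_state[OF s]] pure_states_normalised[OF \<alpha>]
    by (simp add: normalised_weight)
  finally show ?thesis using D(1) seq_channel[OF Wch uch] by blast
qed

section \<open>Conversion of pure states\<close>

lemma test_post_conditional:
  assumes cs: "cs \<in> tests T A B" and D: "\<And>i. i < length cs \<Longrightarrow> D i \<in> channels T B C"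
  shows "map (\<lambda>i. D i \<cdot> cs ! i) [0..<length cs] \<in> tests T A C"
proof -
  let ?n = "length cs"
  have "concat (map2 (\<lambda>c. map (\<lambda>d. d \<cdot> c)) cs (map (\<lambda>i. [D i]) [0..<?n])) \<in> tests T A C"
    by (rule seq_test[OF cs]) (use D in \<open>auto simp: channels_iff\<close>)
  also have "map2 (\<lambda>c. map (\<lambda>d. d \<cdot> c)) cs (map (\<lambda>i. [D i]) [0..<?n]) = map (\<lambda>i. [D i \<cdot> cs ! i]) [0..<?n]"
    by (rule nth_equalityI) auto
  finally show ?thesis by simp
qed

lemma cone_remove:
  assumes "set zs \<subseteq> state_cone A" "y \<in> set zs"
  shows "sum_list zs - y \<in> state_cone A"
proof -
  have "sum_list ws \<in> state_cone A" if "set ws \<subseteq> state_cone A" for ws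
    using that by (induction ws) (auto intro: cone_add states_cone[OF zero_state])
  moreover have "set (remove1 y zs) \<subseteq> state_cone A"
    by (rule subset_trans[OF set_remove1_subset assms(1)])
  ultimately have "sum_list (remove1 y zs) \<in> state_cone A" by blast
  moreover have "sum_list zs - y = sum_list (remove1 y zs)"
    using sum_list_map_remove1[OF assms(2), of "\<lambda>x. x"] by simp
  ultimately show ?thesis by (simp only:)
qed

text \<open>The labels say which outcome of the original test is refined.\<close>

lemma pure_refinement:
  assumes xs: "xs \<in> tests T 1 A"
  shows "\<exists>zs. map snd zs \<in> tests T 1 A \<and> sum_list (map snd zs) = sum_list xs \<and>
    (\<forall>z \<in> set zs. fst z < length xs \<and> xs ! fst z - snd z \<in> states T A \<and>
      (\<exists>q \<phi>. 0 < q \<and> \<phi> \<in> pure_states T A \<and> snd z = q *\<^sub>R \<phi>))"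
proof -
  let ?n = "length xs"
  have xst: "xs ! i \<in> states T A" if "i < ?n" for i using transf_nth[OF xs that] by (simp add: states_eq)
  have "\<forall>i. \<exists>ys. i < ?n \<longrightarrow> (\<forall>y \<in> set ys. 0 < fst y \<and> snd y \<in> pure_states T A) \<and> xs ! i = (\<Sum>y\<leftarrow>ys. fst y *\<^sub>R snd y)"
    using pure_decomposition[OF xst] by blast
  then obtain g where g: "\<And>i y. \<lbrakk>i < ?n; y \<in> set (g i)\<rbrakk> \<Longrightarrow> 0 < fst y \<and> snd y \<in> pure_states T A"
    "\<And>i. i < ?n \<Longrightarrow> xs ! i = (\<Sum>y\<leftarrow>g i. fst y *\<^sub>R snd y)" by metis
  define zs where "zs = concat (map (\<lambda>i. map (\<lambda>y. (i, fst y *\<^sub>R snd y)) (g i)) [0..<?n])"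
  have msnd: "map snd zs = concat (map (\<lambda>i. map (\<lambda>y. fst y *\<^sub>R snd y) (g i)) [0..<?n])"
    by (simp add: zs_def map_concat comp_def)
  have sum_concat: "sum_list (concat xss) = sum_list (map sum_list xss)" for xss :: "'b list list"
    by (induction xss) auto
  have "sum_list (map snd zs) = (\<Sum>i\<leftarrow>[0..<?n]. \<Sum>y\<leftarrow>g i. fst y *\<^sub>R snd y)"
    unfolding msnd sum_concat by (simp add: comp_def)
  also have "\<dots> = (\<Sum>i\<leftarrow>[0..<?n]. xs ! i)" using g(2) by (intro arg_cong[of _ _ sum_list] map_cong) auto
  finally have sum: "sum_list (map snd zs) = sum_list xs" by (simp add: map_nth)
  have props: "fst z < ?n \<and> snd z \<in> states T A \<and> xs ! fst z - snd z \<in> states T A \<and>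
      (\<exists>q \<phi>. 0 < q \<and> \<phi> \<in> pure_states T A \<and> snd z = q *\<^sub>R \<phi>)" if z: "z \<in> set zs" for z
  proof -
    obtain i y where iy: "i < ?n" "y \<in> set (g i)" "z = (i, fst y *\<^sub>R snd y)" using z by (auto simp: zs_def)
    have y: "0 < fst y" "snd y \<in> pure_states T A" using g(1)[OF iy(1,2)] by auto
    have cone: "fst y' *\<^sub>R snd y' \<in> state_cone A" if "y' \<in> set (g i)" for y'
      using g(1)[OF iy(1) that] by (intro cone_scale states_cone pure_states_state) auto
    have "sum_list (map (\<lambda>y. fst y *\<^sub>R snd y) (g i)) - fst y *\<^sub>R snd y \<in> state_cone A"
      by (rule cone_remove) (use cone iy(2) in auto)
    then have c: "xs ! i - fst y *\<^sub>R snd y \<in> state_cone A" using g(2)[OF iy(1)] by simp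
    have w: "weight A (fst y *\<^sub>R snd y) \<le> weight A (xs ! i)" "weight A (xs ! i) \<le> 1"
      using cone_weight[OF c] weight_le_1[OF xst[OF iy(1)]] by (simp_all add: weight_simps)
    have "fst y *\<^sub>R snd y \<in> states T A" by (rule cone_state[OF cone[OF iy(2)]]) (use w in simp)
    moreover have "xs ! i - fst y *\<^sub>R snd y \<in> states T A"
      by (rule cone_state[OF c]) (use w cone_weight[OF cone[OF iy(2)]] in \<open>simp add: weight_simps\<close>)
    ultimately show ?thesis using iy y by auto
  qed
  have "map snd zs \<in> tests T 1 A"
  proof (rule prep_testI)
    show "set (map snd zs) \<subseteq> states T A" using props by auto
    show "(\<Sum>x\<leftarrow>map snd zs. weight A x) = 1"
      using weight_sum_list[of A "map snd zs"] weight_sum_list[of A xs] sum weight_test[OF xs] by simp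
  qed
  then show ?thesis using sum props by blast
qed

text \<open>A multiple of the pure state \<open>\<Phi>\<close> splits only into multiples of
  \<open>\<Phi>\<close>, so a component of \<open>x\<close> inherits the target.\<close>

lemma proportional_component:
  assumes t: "t \<in> transf T A B" and xy: "y \<in> states T A" "x - y \<in> states T A" and x: "x \<in> states T A"
    and \<Phi>: "\<Phi> \<in> pure_states T B" "t \<cdot> x = p *\<^sub>R \<Phi>"
  shows "\<exists>p'. t \<cdot> y = p' *\<^sub>R \<Phi>"
proof -
  have "weight B (t \<cdot> x) = p" using \<Phi> pure_states_normalised[OF \<Phi>(1)] by (simp add: weight_scale normalised_weight)
  then have "0 \<le> p" "p \<le> 1"
    using weight_nonneg[OF state_seq[OF t x]] weight_le_1[OF state_seq[OF t x]] by auto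
  then have "t \<cdot> x \<in> pure T 1 B" using pure_scale[OF \<Phi>(1)] \<Phi>(2) by simp
  moreover have "t \<cdot> x = t \<cdot> y + t \<cdot> (x - y)" by (simp add: lin_simps)
  ultimately obtain c where "t \<cdot> y = c *\<^sub>R (t \<cdot> x)"
    using pure_state_split[OF _ state_seq[OF t xy(1)] state_seq[OF t xy(2)]] by blast
  then have "t \<cdot> y = (c * p) *\<^sub>R \<Phi>" by (simp add: \<Phi>(2))
  then show ?thesis by blast
qed

text \<open>One round of communication, from the second party to the first: the list pairs the outcomes of
  the second party's test with the channels that the first party applies in response.\<close>

definition one_way :: "'a \<Rightarrow> 'a \<Rightarrow> 'a \<Rightarrow> 'a \<Rightarrow> 'b \<Rightarrow> 'b \<Rightarrow> bool" where
  "one_way A B A' B' \<Psi> \<Phi> \<longleftrightarrow> (\<exists>zs. map snd zs \<in> tests T B B' \<and>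
     (\<forall>z \<in> set zs. fst z \<in> channels T A A' \<and> (\<exists>p. (fst z \<otimes> snd z) \<cdot> \<Psi> = p *\<^sub>R \<Phi>)))"

lemma one_way_scale:
  assumes "one_way A B A' B' \<Psi> \<Phi>"
  shows "one_way A B A' B' (q *\<^sub>R \<Psi>) \<Phi>"
proof -
  obtain zs where zs: "map snd zs \<in> tests T B B'"
    "\<forall>z \<in> set zs. fst z \<in> channels T A A' \<and> (\<exists>p. (fst z \<otimes> snd z) \<cdot> \<Psi> = p *\<^sub>R \<Phi>)"
    using assms by (auto simp: one_way_def)
  have "\<exists>p. (fst z \<otimes> snd z) \<cdot> (q *\<^sub>R \<Psi>) = p *\<^sub>R \<Phi>" if z: "z \<in> set zs" for z
  proof -
    obtain p where "(fst z \<otimes> snd z) \<cdot> \<Psi> = p *\<^sub>R \<Phi>" using zs(2) z by blast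
    then have "(fst z \<otimes> snd z) \<cdot> (q *\<^sub>R \<Psi>) = (q * p) *\<^sub>R \<Phi>" by (simp add: lin_simps)
    then show ?thesis by blast
  qed
  then show ?thesis unfolding one_way_def using zs by blast
qed

text \<open>The first party acts by channels only, so its responses to successive rounds compose to
  a channel, while the tests of the second party compose conditionally.\<close>

lemma one_way_seq:
  assumes zs: "map snd zs \<in> tests T B B1" and \<Psi>: "\<Psi> \<in> states T (A * B)"
    and z: "\<And>z. z \<in> set zs \<Longrightarrow> fst z \<in> channels T A A1 \<and> one_way A1 B1 A' B' ((fst z \<otimes> snd z) \<cdot> \<Psi>) \<Phi>"
  shows "one_way A B A' B' \<Psi> \<Phi>"
proof -
  have "\<forall>z. \<exists>ys. z \<in> set zs \<longrightarrow> map snd ys \<in> tests T B1 B' \<and>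
     (\<forall>y \<in> set ys. fst y \<in> channels T A1 A' \<and> (\<exists>p. (fst y \<otimes> snd y) \<cdot> ((fst z \<otimes> snd z) \<cdot> \<Psi>) = p *\<^sub>R \<Phi>))"
    using z unfolding one_way_def by blast
  then obtain f where f: "\<And>z. z \<in> set zs \<Longrightarrow> map snd (f z) \<in> tests T B1 B'"
    "\<And>z y. \<lbrakk>z \<in> set zs; y \<in> set (f z)\<rbrakk> \<Longrightarrow> fst y \<in> channels T A1 A' \<and> (\<exists>p. (fst y \<otimes> snd y) \<cdot> ((fst z \<otimes> snd z) \<cdot> \<Psi>) = p *\<^sub>R \<Phi>)"
    by metis
  define ws where "ws = concat (map (\<lambda>z. map (\<lambda>y. (fst y \<cdot> fst z, snd y \<cdot> snd z)) (f z)) zs)"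
  have "concat (map2 (\<lambda>c. map (\<lambda>d. d \<cdot> c)) (map snd zs) (map (\<lambda>z. map snd (f z)) zs)) \<in> tests T B B'"
    by (rule seq_test[OF zs]) (use f(1) in auto)
  also have "concat (map2 (\<lambda>c. map (\<lambda>d. d \<cdot> c)) (map snd zs) (map (\<lambda>z. map snd (f z)) zs)) = map snd ws"
    unfolding ws_def by (induction zs) (auto simp: comp_def)
  finally have test: "map snd ws \<in> tests T B B'" .
  have "fst w \<in> channels T A A' \<and> (\<exists>p. (fst w \<otimes> snd w) \<cdot> \<Psi> = p *\<^sub>R \<Phi>)" if w: "w \<in> set ws" for w
  proof -
    obtain z' y where zy: "z' \<in> set zs" "y \<in> set (f z')" "w = (fst y \<cdot> fst z', snd y \<cdot> snd z')"
      using w by (auto simp: ws_def)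
    have t: "snd z' \<in> transf T B B1" "snd y \<in> transf T B1 B'"
      using transf_I[OF zs] transf_I[OF f(1)[OF zy(1)]] zy by auto
    have c: "fst z' \<in> channels T A A1" "fst y \<in> channels T A1 A'" using z[OF zy(1)] f(2)[OF zy(1,2)] by auto
    have "(fst w \<otimes> snd w) \<cdot> \<Psi> = (fst y \<otimes> snd y) \<cdot> ((fst z' \<otimes> snd z') \<cdot> \<Psi>)"
      unfolding zy(3) fst_conv snd_conv
      by (rule par_seq_state[symmetric, OF channel_transf[OF c(1)] channel_transf[OF c(2)] t \<Psi>])
    moreover have "fst w \<in> channels T A A'" unfolding zy(3) fst_conv by (rule seq_channel[OF c])
    ultimately show ?thesis using f(2)[OF zy(1,2)] by metis
  qed
  then show ?thesis unfolding one_way_def using test by blast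
qed

text \<open>The test \<open>cs\<close> may leave mixed states. Steering realises a pure refinement
  of its ensemble by another test on \<open>B\<close>, after which the protocol continues on each
  pure component.\<close>

lemma one_way_second_round:
  assumes \<Psi>: "\<Psi> \<in> pure_states T (A * B)" and cs: "cs \<in> tests T B B1"
    and step: "\<And>i q \<phi>. \<lbrakk>i < length cs; 0 < q; \<phi> \<in> pure_states T (A * B1); q *\<^sub>R \<phi> \<in> states T (A * B1);
      (\<I> A \<otimes> cs ! i) \<cdot> \<Psi> - q *\<^sub>R \<phi> \<in> states T (A * B1)\<rbrakk> \<Longrightarrow> one_way A B1 A' B' \<phi> \<Phi>"
  shows "one_way A B A' B' \<Psi> \<Phi>"
proof -
  note s = pure_states_state[OF \<Psi>]
  have \<Psi>c: "\<Psi> \<in> channels T 1 (A * B)" using pure_states_normalised[OF \<Psi>] by (simp add: normalised_channel)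
  let ?xs = "map (\<lambda>c. (\<I> A \<otimes> c) \<cdot> \<Psi>) cs"
  have xs: "?xs \<in> tests T 1 (A * B1)"
    using test_pre[OF \<Psi>c test_par_right[OF ident_channel cs, of A]] by (simp add: comp_def)
  obtain zs where zs: "map snd zs \<in> tests T 1 (A * B1)" "sum_list (map snd zs) = sum_list ?xs"
    "\<And>z. z \<in> set zs \<Longrightarrow> fst z < length ?xs \<and> ?xs ! fst z - snd z \<in> states T (A * B1) \<and>
      (\<exists>q \<phi>. 0 < q \<and> \<phi> \<in> pure_states T (A * B1) \<and> snd z = q *\<^sub>R \<phi>)"
    using pure_refinement[OF xs] by blast
  have "sum_list ?xs = (\<I> A \<otimes> sum_list cs) \<cdot> \<Psi>"
    by (simp add: par_sum_list_right seq_sum_list_left comp_def)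
  then have "marginal1 T A B1 (sum_list (map snd zs)) = marginal1 T A B \<Psi>"
    using zs(2) marginal1_par[OF ident_transf sum_channel[OF cs] s] ident_state[OF marginal1_state[OF s]] by simp
  from steering[OF \<Psi> zs(1) this] obtain bs where bs: "bs \<in> tests T B B1" "length bs = length zs"
    "\<forall>i<length zs. (\<I> A \<otimes> bs ! i) \<cdot> \<Psi> = snd (zs ! i)" by auto
  let ?ws = "map (\<lambda>b. (\<I> A, b)) bs"
  have "one_way A B1 A' B' ((\<I> A \<otimes> b) \<cdot> \<Psi>) \<Phi>" if b: "b \<in> set bs" for b
  proof -
    obtain k where k: "k < length zs" "b = bs ! k" using b bs(2) by (auto simp: in_set_conv_nth)
    have z: "zs ! k \<in> set zs" using k by simp
    obtain q \<phi> where q: "0 < q" "\<phi> \<in> pure_states T (A * B1)" "snd (zs ! k) = q *\<^sub>R \<phi>" using zs(3)[OF z] by blast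
    have "snd (zs ! k) \<in> states T (A * B1)" using transf_I[OF zs(1)] z by (simp add: states_eq)
    moreover have i: "fst (zs ! k) < length cs" and r: "(\<I> A \<otimes> cs ! fst (zs ! k)) \<cdot> \<Psi> - snd (zs ! k) \<in> states T (A * B1)"
      using zs(3)[OF z] by auto
    ultimately have "one_way A B1 A' B' \<phi> \<Phi>" using step[OF i q(1,2)] r q(3) by simp
    then show ?thesis using one_way_scale bs(3) k q(3) by simp
  qed
  then have "fst w \<in> channels T A A \<and> one_way A B1 A' B' ((fst w \<otimes> snd w) \<cdot> \<Psi>) \<Phi>" if "w \<in> set ?ws" for w
    using that ident_channel by auto
  moreover have "map snd ?ws \<in> tests T B B1" using bs(1) by (simp add: comp_def)
  ultimately show ?thesis using one_way_seq[OF _ s] by blast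
qed

text \<open>A round of the first party is simulated by the second one: exchange the two local states,
  let the second party perform the test, and exchange the resulting pure states back.\<close>

lemma one_way_first_round:
  assumes ur: "unrestricted_reversibility T" and \<Psi>: "\<Psi> \<in> pure_states T (A * B)" and cs: "cs \<in> tests T A A1"
    and step: "\<And>i q \<phi>. \<lbrakk>i < length cs; 0 < q; \<phi> \<in> pure_states T (A1 * B); q *\<^sub>R \<phi> \<in> states T (A1 * B);
      (cs ! i \<otimes> \<I> B) \<cdot> \<Psi> - q *\<^sub>R \<phi> \<in> states T (A1 * B)\<rbrakk> \<Longrightarrow> one_way A1 B A' B' \<phi> \<Phi>"
  shows "one_way A B A' B' \<Psi> \<Phi>"
proof -
  note s = pure_states_state[OF \<Psi>]
  have \<Psi>c: "\<Psi> \<in> channels T 1 (A * B)" using pure_states_normalised[OF \<Psi>] by (simp add: normalised_channel)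
  let ?xs = "map (\<lambda>c. (c \<otimes> \<I> B) \<cdot> \<Psi>) cs"
  have xs: "?xs \<in> tests T 1 (A1 * B)"
    using test_pre[OF \<Psi>c test_par_left[OF cs ident_channel, of B]] by (simp add: comp_def)
  obtain zs where zs: "map snd zs \<in> tests T 1 (A1 * B)" "sum_list (map snd zs) = sum_list ?xs"
    "\<And>z. z \<in> set zs \<Longrightarrow> fst z < length ?xs \<and> ?xs ! fst z - snd z \<in> states T (A1 * B) \<and>
      (\<exists>q \<phi>. 0 < q \<and> \<phi> \<in> pure_states T (A1 * B) \<and> snd z = q *\<^sub>R \<phi>)"
    using pure_refinement[OF xs] by blast
  have "sum_list ?xs = (sum_list cs \<otimes> \<I> B) \<cdot> \<Psi>"
    by (simp add: par_sum_list_left seq_sum_list_left comp_def)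
  then have "marginal2 T A1 B (sum_list (map snd zs)) = marginal2 T A B \<Psi>"
    using zs(2) marginal2_par[OF sum_channel[OF cs] ident_transf s] ident_state[OF marginal2_state[OF s]] by simp
  from steering_left[OF \<Psi> zs(1) this] obtain as where as: "as \<in> tests T A A1" "length as = length zs"
    "\<forall>i<length zs. (as ! i \<otimes> \<I> B) \<cdot> \<Psi> = snd (zs ! i)" by auto
  let ?n = "length zs"
  obtain C D where CD: "C \<in> channels T A B" "D \<in> channels T B A" "(C \<otimes> D) \<cdot> \<Psi> = swap T A B \<cdot> \<Psi>"
    using local_exchange[OF ur \<Psi>] by blast
  have "\<forall>k. \<exists>q \<phi> E F. k < ?n \<longrightarrow> 0 < q \<and> \<phi> \<in> pure_states T (A1 * B) \<and> snd (zs ! k) = q *\<^sub>R \<phi> \<and>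
      E \<in> channels T B A1 \<and> F \<in> channels T A1 B \<and> (E \<otimes> F) \<cdot> (swap T A1 B \<cdot> \<phi>) = \<phi>"
  proof
    fix k
    show "\<exists>q \<phi> E F. k < ?n \<longrightarrow> 0 < q \<and> \<phi> \<in> pure_states T (A1 * B) \<and> snd (zs ! k) = q *\<^sub>R \<phi> \<and>
      E \<in> channels T B A1 \<and> F \<in> channels T A1 B \<and> (E \<otimes> F) \<cdot> (swap T A1 B \<cdot> \<phi>) = \<phi>"
    proof (cases "k < ?n")
      case True
      then obtain q \<phi> where q: "0 < q" "\<phi> \<in> pure_states T (A1 * B)" "snd (zs ! k) = q *\<^sub>R \<phi>"
        using zs(3)[of "zs ! k"] by auto
      \<comment> \<open>The exchange is taken for the swapped state, because that is what the action
        of the second party produces.\<close>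
      obtain E F where "E \<in> channels T B A1" "F \<in> channels T A1 B"
        "(E \<otimes> F) \<cdot> (swap T A1 B \<cdot> \<phi>) = swap T B A1 \<cdot> (swap T A1 B \<cdot> \<phi>)"
        using local_exchange[OF ur swap_pure_states[OF q(2)]] by blast
      then show ?thesis using q swap_swap_state[OF pure_states_state[OF q(2)]] by metis
    qed simp
  qed
  then obtain q \<phi> E F where Q: "\<And>k. k < ?n \<Longrightarrow> 0 < q k \<and> \<phi> k \<in> pure_states T (A1 * B) \<and> snd (zs ! k) = q k *\<^sub>R \<phi> k \<and>
      E k \<in> channels T B A1 \<and> F k \<in> channels T A1 B \<and> (E k \<otimes> F k) \<cdot> (swap T A1 B \<cdot> \<phi> k) = \<phi> k"
    by metis
  let ?as = "map (\<lambda>a. a \<cdot> D) as"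
  have asD: "?as \<in> tests T B A1" by (rule test_pre[OF CD(2) as(1)])
  let ?ws = "map (\<lambda>k. (E k \<cdot> C, F k \<cdot> ?as ! k)) [0..<?n]"
  have "map (\<lambda>k. F k \<cdot> ?as ! k) [0..<length ?as] \<in> tests T B B"
    by (rule test_post_conditional[OF asD]) (use Q as(2) in auto)
  then have ws: "map snd ?ws \<in> tests T B B" using as(2) by (simp add: comp_def)
  have "fst w \<in> channels T A A1 \<and> one_way A1 B A' B' ((fst w \<otimes> snd w) \<cdot> \<Psi>) \<Phi>" if w: "w \<in> set ?ws" for w
  proof -
    obtain k where k: "k < ?n" "w = (E k \<cdot> C, F k \<cdot> (as ! k \<cdot> D))" using w as(2) by auto
    note Qk = Q[OF k(1)]
    have z: "zs ! k \<in> set zs" using k by simp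
    have at: "as ! k \<in> transf T A A1" using transf_nth[OF as(1)] k as(2) by simp
    have t: "C \<in> transf T A B" "D \<in> transf T B A" "E k \<in> transf T B A1" "F k \<in> transf T A1 B"
      using CD Qk channel_transf by auto
    have "(fst w \<otimes> snd w) \<cdot> \<Psi> = (E k \<otimes> F k) \<cdot> ((C \<otimes> (as ! k \<cdot> D)) \<cdot> \<Psi>)"
      unfolding k(2) fst_conv snd_conv
      by (rule par_seq_state[symmetric, OF t(1,3) seq_transf[OF t(2) at] t(4) s])
    also have "(C \<otimes> (as ! k \<cdot> D)) \<cdot> \<Psi> = (\<I> B \<otimes> as ! k) \<cdot> ((C \<otimes> D) \<cdot> \<Psi>)"
      using par_seq_state[OF t(1) ident_transf t(2) at s] seq_ident_left[OF t(1)] by simp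
    \<comment> \<open>Acting on the second factor after the exchange is acting on the first factor
      before it.\<close>
    also have "\<dots> = swap T A1 B \<cdot> ((as ! k \<otimes> \<I> B) \<cdot> \<Psi>)"
      unfolding CD(3) by (rule swap_par[symmetric, OF at ident_transf s])
    also have "\<dots> = q k *\<^sub>R (swap T A1 B \<cdot> \<phi> k)" using as(3) k(1) Qk by (simp add: lin_simps)
    also have "(E k \<otimes> F k) \<cdot> \<dots> = q k *\<^sub>R \<phi> k" using Qk by (simp add: lin_simps)
    finally have eq: "(fst w \<otimes> snd w) \<cdot> \<Psi> = q k *\<^sub>R \<phi> k" .
    have "snd (zs ! k) \<in> states T (A1 * B)" using transf_I[OF zs(1)] z by (simp add: states_eq)
    moreover have i: "fst (zs ! k) < length cs" and r: "(cs ! fst (zs ! k) \<otimes> \<I> B) \<cdot> \<Psi> - snd (zs ! k) \<in> states T (A1 * B)"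
      using zs(3)[OF z] by auto
    ultimately have "one_way A1 B A' B' (\<phi> k) \<Phi>" using step[OF i, of "q k" "\<phi> k"] r Qk by simp
    moreover have "fst w \<in> channels T A A1" unfolding k(2) fst_conv using seq_channel CD(1) Qk by blast
    ultimately show ?thesis using eq one_way_scale by simp
  qed
  then show ?thesis using one_way_seq[OF ws s] by blast
qed

section \<open>LOCC protocols and one-way protocols\<close>

lemma locc_test_tests: "locc_test T A B A' B' ts \<Longrightarrow> ts \<in> tests T (A * B) (A' * B')"
proof (induction rule: locc_test.induct)
  case (stop A B)
  show ?case by (rule ident_test)
next
  case (round1 cs A A1 ls B A' B')
  have "concat (map2 (\<lambda>c. map (\<lambda>d. d \<cdot> c)) (map (\<lambda>c. c \<otimes> \<I> B) cs) ls) \<in> tests T (A * B) (A' * B')"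
    by (rule seq_test[OF test_par_left[OF round1.hyps(1) ident_channel]]) (use round1 in auto)
  then show ?case by (simp add: zip_map1 case_prod_unfold comp_def)
next
  case (round2 cs B B1 ls A A' B')
  have "concat (map2 (\<lambda>c. map (\<lambda>d. d \<cdot> c)) (map (\<lambda>c. \<I> A \<otimes> c) cs) ls) \<in> tests T (A * B) (A' * B')"
    by (rule seq_test[OF test_par_right[OF ident_channel round2.hyps(1)]]) (use round2 in auto)
  then show ?case by (simp add: zip_map1 case_prod_unfold comp_def)
qed

lemma in_concat_map2:
  "\<lbrakk>i < length cs; length ls = length cs; t \<in> set (ls ! i)\<rbrakk> \<Longrightarrow> f (cs ! i) t \<in> set (concat (map2 (\<lambda>c. map (f c)) cs ls))"
  by (force simp: set_zip)

text \<open>That every history sends the state to a multiple of \<open>\<Phi>\<close> is inherited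
  by the pure components left after the first round, so it serves as the invariant. The final
  systems are separate parameters because local systems may change on the way.\<close>

lemma locc_test_one_way:
  assumes ur: "unrestricted_reversibility T"
  shows "\<lbrakk>locc_test T A B A' B' ts; \<Psi> \<in> pure_states T (A * B); \<Phi> \<in> pure_states T (A' * B');
    \<forall>t \<in> set ts. \<exists>p. t \<cdot> \<Psi> = p *\<^sub>R \<Phi>\<rbrakk> \<Longrightarrow> one_way A B A' B' \<Psi> \<Phi>"
proof (induction arbitrary: \<Psi> rule: locc_test.induct)
  case (stop A B)
  then show ?case
    unfolding one_way_def using ident_channel ident_test
    by (intro exI[of _ "[(\<I> A, \<I> B)]"]) (auto simp: par_ident)
next
  case (round1 cs A A1 ls B A' B')
  note s = pure_states_state[OF round1.prems(1)]
  show ?case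
  proof (rule one_way_first_round[OF ur round1.prems(1) round1.hyps(1)])
    fix i q \<phi>
    assume i: "i < length cs" and q: "0 < q" and \<phi>: "\<phi> \<in> pure_states T (A1 * B)" "q *\<^sub>R \<phi> \<in> states T (A1 * B)"
      and rest: "(cs ! i \<otimes> \<I> B) \<cdot> \<Psi> - q *\<^sub>R \<phi> \<in> states T (A1 * B)"
    have ls: "ls ! i \<in> set ls" using i round1.hyps(2) by simp
    have ct: "cs ! i \<otimes> \<I> B \<in> transf T (A * B) (A1 * B)"
      by (rule par_transf[OF transf_nth[OF round1.hyps(1) i] ident_transf])
    have lo: "locc_test T A1 B A' B' (ls ! i)" using round1.IH ls by blast
    have "\<exists>p. t \<cdot> \<phi> = p *\<^sub>R \<Phi>" if t: "t \<in> set (ls ! i)" for t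
    proof -
      have tt: "t \<in> transf T (A1 * B) (A' * B')" by (rule transf_I[OF locc_test_tests[OF lo] t])
      obtain p where "(t \<cdot> (cs ! i \<otimes> \<I> B)) \<cdot> \<Psi> = p *\<^sub>R \<Phi>"
        using round1.prems(3) in_concat_map2[OF i round1.hyps(2) t, of "\<lambda>c t. t \<cdot> (c \<otimes> \<I> B)"] by blast
      then have "t \<cdot> ((cs ! i \<otimes> \<I> B) \<cdot> \<Psi>) = p *\<^sub>R \<Phi>" using state_assoc[OF ct tt s] by simp
      from proportional_component[OF tt \<phi>(2) rest state_seq[OF ct s] round1.prems(2) this]
      obtain p' where "q *\<^sub>R (t \<cdot> \<phi>) = p' *\<^sub>R \<Phi>" by (auto simp: lin_simps)
      from arg_cong[OF this, of "\<lambda>x. (1 / q) *\<^sub>R x"] have "t \<cdot> \<phi> = (p' / q) *\<^sub>R \<Phi>" using q by simp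
      then show ?thesis by blast
    qed
    then show "one_way A1 B A' B' \<phi> \<Phi>" using round1.IH ls \<phi>(1) round1.prems(2) by blast
  qed
next
  case (round2 cs B B1 ls A A' B')
  note s = pure_states_state[OF round2.prems(1)]
  show ?case
  proof (rule one_way_second_round[OF round2.prems(1) round2.hyps(1)])
    fix i q \<phi>
    assume i: "i < length cs" and q: "0 < q" and \<phi>: "\<phi> \<in> pure_states T (A * B1)" "q *\<^sub>R \<phi> \<in> states T (A * B1)"
      and rest: "(\<I> A \<otimes> cs ! i) \<cdot> \<Psi> - q *\<^sub>R \<phi> \<in> states T (A * B1)"
    have ls: "ls ! i \<in> set ls" using i round2.hyps(2) by simp
    have ct: "\<I> A \<otimes> cs ! i \<in> transf T (A * B) (A * B1)"
      by (rule par_transf[OF ident_transf transf_nth[OF round2.hyps(1) i]])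
    have lo: "locc_test T A B1 A' B' (ls ! i)" using round2.IH ls by blast
    have "\<exists>p. t \<cdot> \<phi> = p *\<^sub>R \<Phi>" if t: "t \<in> set (ls ! i)" for t
    proof -
      have tt: "t \<in> transf T (A * B1) (A' * B')" by (rule transf_I[OF locc_test_tests[OF lo] t])
      obtain p where "(t \<cdot> (\<I> A \<otimes> cs ! i)) \<cdot> \<Psi> = p *\<^sub>R \<Phi>"
        using round2.prems(3) in_concat_map2[OF i round2.hyps(2) t, of "\<lambda>c t. t \<cdot> (\<I> A \<otimes> c)"] by blast
      then have "t \<cdot> ((\<I> A \<otimes> cs ! i) \<cdot> \<Psi>) = p *\<^sub>R \<Phi>" using state_assoc[OF ct tt s] by simp
      from proportional_component[OF tt \<phi>(2) rest state_seq[OF ct s] round2.prems(2) this]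
      obtain p' where "q *\<^sub>R (t \<cdot> \<phi>) = p' *\<^sub>R \<Phi>" by (auto simp: lin_simps)
      from arg_cong[OF this, of "\<lambda>x. (1 / q) *\<^sub>R x"] have "t \<cdot> \<phi> = (p' / q) *\<^sub>R \<Phi>" using q by simp
      then show ?thesis by blast
    qed
    then show "one_way A B1 A' B' \<phi> \<Phi>" using round2.IH ls \<phi>(1) round2.prems(2) by blast
  qed
qed

text \<open>The histories of the protocol decompose the pure state \<open>\<Phi>\<close>, so each of
  them yields a multiple of it.\<close>

lemma locc_imp_one_way:
  assumes ur: "unrestricted_reversibility T" and \<Psi>: "\<Psi> \<in> pure_states T (A * B)" and \<Phi>: "\<Phi> \<in> pure_states T (A * B)"
    and L: "L \<in> locc_channels T A B" "L \<cdot> \<Psi> = \<Phi>"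
  shows "one_way A B A B \<Psi> \<Phi>"
proof -
  obtain ts where ts: "L = sum_list ts" "locc_test T A B A B ts" using L(1) by (auto simp: locc_channels_def)
  have \<Psi>c: "\<Psi> \<in> channels T 1 (A * B)" using pure_states_normalised[OF \<Psi>] by (simp add: normalised_channel)
  let ?xs = "map (\<lambda>t. t \<cdot> \<Psi>) ts"
  have xs: "?xs \<in> tests T 1 (A * B)" by (rule test_pre[OF \<Psi>c locc_test_tests[OF ts(2)]])
  have sum: "\<Phi> = (\<Sum>i\<in>{..<length ?xs}. ?xs ! i)"
  proof -
    have "\<Phi> = sum_list ts \<cdot> \<Psi>" using L(2) ts(1) by simp
    also have "\<dots> = (\<Sum>i\<in>{..<length ?xs}. ?xs ! i)"
      by (simp add: sum_list_sum_nth atLeast0LessThan seq_sum_left)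
    finally show ?thesis .
  qed
  have "\<forall>i\<in>{..<length ?xs}. \<exists>c. ?xs ! i = c *\<^sub>R \<Phi>"
    using pure_states_pure[OF \<Phi>] xs sum unfolding pure_def by blast
  then have "\<forall>t \<in> set ts. \<exists>p. t \<cdot> \<Psi> = p *\<^sub>R \<Phi>" by (auto simp: in_set_conv_nth)
  then show ?thesis by (rule locc_test_one_way[OF ur ts(2) \<Psi> \<Phi>])
qed

lemma one_way_imp_locc:
  assumes \<Psi>: "\<Psi> \<in> pure_states T (A * B)" and \<Phi>: "\<Phi> \<in> pure_states T (A * B)" and ow: "one_way A B A B \<Psi> \<Phi>"
  shows "\<exists>L \<in> locc_channels T A B. L \<cdot> \<Psi> = \<Phi>"
proof -
  note s = pure_states_state[OF \<Psi>]
  obtain zs where zs: "map snd zs \<in> tests T B B"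
    "\<And>z. z \<in> set zs \<Longrightarrow> fst z \<in> channels T A A" "\<And>z. z \<in> set zs \<Longrightarrow> \<exists>p. (fst z \<otimes> snd z) \<cdot> \<Psi> = p *\<^sub>R \<Phi>"
    using ow by (auto simp: one_way_def)
  \<comment> \<open>The identity comes from the rule \<open>stop\<close>, which ends every protocol,
    and remains as a factor of each listed transformation.\<close>
  let ?ls = "map (\<lambda>z. [\<I> (A * B) \<cdot> (fst z \<otimes> \<I> B)]) zs"
  have one: "locc_test T A B A B [\<I> (A * B) \<cdot> (fst z \<otimes> \<I> B)]" if "z \<in> set zs" for z
    using locc_test.round1[of "[fst z]" T A A "[[\<I> (A * B)]]" B A B] zs(2)[OF that] locc_test.stop[of T A B]
    by (simp add: channels_iff)
  let ?ts = "concat (map2 (\<lambda>c. map (\<lambda>t. t \<cdot> (\<I> A \<otimes> c))) (map snd zs) ?ls)"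
  have lo: "locc_test T A B A B ?ts"
    by (rule locc_test.round2[OF zs(1)]) (use one in auto)
  have ts: "?ts = map (\<lambda>z. (\<I> (A * B) \<cdot> (fst z \<otimes> \<I> B)) \<cdot> (\<I> A \<otimes> snd z)) zs"
    by (induction zs) auto
  have prp: "\<exists>p. t \<cdot> \<Psi> = p *\<^sub>R \<Phi>" if t: "t \<in> set ?ts" for t
  proof -
    obtain z where z: "z \<in> set zs" "t = (\<I> (A * B) \<cdot> (fst z \<otimes> \<I> B)) \<cdot> (\<I> A \<otimes> snd z)"
      using t unfolding ts by auto
    have ft: "fst z \<in> transf T A A" and bt: "snd z \<in> transf T B B"
      using zs(2)[OF z(1)] channel_transf transf_I[OF zs(1)] z(1) by auto
    have p1: "fst z \<otimes> \<I> B \<in> transf T (A * B) (A * B)" and p2: "\<I> A \<otimes> snd z \<in> transf T (A * B) (A * B)"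
      by (rule par_transf[OF ft ident_transf], rule par_transf[OF ident_transf bt])
    have "t \<cdot> \<Psi> = (fst z \<otimes> \<I> B) \<cdot> ((\<I> A \<otimes> snd z) \<cdot> \<Psi>)"
      using state_assoc[OF p2 p1 s] seq_ident_left[OF p1] by (simp add: z(2))
    then show ?thesis using par_left_right[OF ft bt s] zs(3)[OF z(1)] by simp
  qed
  have "\<exists>p. sum_list us \<cdot> \<Psi> = p *\<^sub>R \<Phi>" if "set us \<subseteq> set ?ts" for us
    using that
  proof (induction us)
    case Nil
    show ?case by (intro exI[of _ 0]) (simp add: lin_simps)
  next
    case (Cons u us)
    have "u \<in> set ?ts" "set us \<subseteq> set ?ts" using Cons.prems by (simp_all only: list.set insert_subset)
    then obtain p q where "u \<cdot> \<Psi> = p *\<^sub>R \<Phi>" "sum_list us \<cdot> \<Psi> = q *\<^sub>R \<Phi>"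
      using prp Cons.IH by blast
    then have "sum_list (u # us) \<cdot> \<Psi> = (p + q) *\<^sub>R \<Phi>" by (simp add: lin_simps scaleR_add_left)
    then show ?case by blast
  qed
  from this[OF subset_refl] obtain p where p: "sum_list ?ts \<cdot> \<Psi> = p *\<^sub>R \<Phi>" by blast
  \<comment> \<open>So far only proportionality to \<open>\<Phi>\<close> is known; preservation of
    weight fixes the factor to 1.\<close>
  have "weight (A * B) (sum_list ?ts \<cdot> \<Psi>) = weight (A * B) \<Psi>"
    by (rule weight_channel[OF sum_channel[OF locc_test_tests[OF lo]] s])
  then have "p * weight (A * B) \<Phi> = weight (A * B) \<Psi>" unfolding p weight_scale .
  then have "p = 1"
    using pure_states_normalised[OF \<Phi>] pure_states_normalised[OF \<Psi>] by (simp add: normalised_weight)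
  then have "sum_list ?ts \<cdot> \<Psi> = \<Phi>" unfolding p by simp
  moreover have "sum_list ?ts \<in> locc_channels T A B" unfolding locc_channels_def using lo by blast
  ultimately show ?thesis by blast
qed

text \<open>The ensemble left by the second party is refined into pure branches. Their marginals on
  \<open>A\<close> add up to that of \<open>\<Psi>\<close>, so the weights of the branches serve as
  the probabilities of the mixture.\<close>

lemma one_way_imp_rare:
  assumes \<Psi>: "\<Psi> \<in> pure_states T (A * B)" and \<Phi>: "\<Phi> \<in> pure_states T (A * B)" and ow: "one_way A B A B \<Psi> \<Phi>"
  shows "\<exists>R \<in> rare_channels T A. R \<cdot> marginal1 T A B \<Phi> = marginal1 T A B \<Psi>"
proof -
  note s = pure_states_state[OF \<Psi>] and s\<Phi> = pure_states_state[OF \<Phi>]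
  have \<Psi>c: "\<Psi> \<in> channels T 1 (A * B)" using pure_states_normalised[OF \<Psi>] by (simp add: normalised_channel)
  obtain zs where zs: "map snd zs \<in> tests T B B"
    "\<And>z. z \<in> set zs \<Longrightarrow> fst z \<in> channels T A A" "\<And>z. z \<in> set zs \<Longrightarrow> \<exists>p. (fst z \<otimes> snd z) \<cdot> \<Psi> = p *\<^sub>R \<Phi>"
    using ow by (auto simp: one_way_def)
  let ?xs = "map (\<lambda>z. (\<I> A \<otimes> snd z) \<cdot> \<Psi>) zs"
  have xs: "?xs \<in> tests T 1 (A * B)"
    using test_pre[OF \<Psi>c test_par_right[OF ident_channel zs(1), of A]] by (simp add: comp_def)
  obtain ys where ys: "map snd ys \<in> tests T 1 (A * B)" "sum_list (map snd ys) = sum_list ?xs"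
    "\<And>y. y \<in> set ys \<Longrightarrow> fst y < length ?xs \<and> ?xs ! fst y - snd y \<in> states T (A * B) \<and>
      (\<exists>q \<phi>. 0 < q \<and> \<phi> \<in> pure_states T (A * B) \<and> snd y = q *\<^sub>R \<phi>)"
    using pure_refinement[OF xs] by blast
  have "sum_list ?xs = (\<I> A \<otimes> sum_list (map snd zs)) \<cdot> \<Psi>"
    by (simp add: par_sum_list_right seq_sum_list_left comp_def)
  then have m: "marginal1 T A B (sum_list (map snd ys)) = marginal1 T A B \<Psi>"
    using ys(2) marginal1_par[OF ident_transf sum_channel[OF zs(1)] s] ident_state[OF marginal1_state[OF s]] by simp
  have "\<exists>V. V \<in> reversible T A A \<and> marginal1 T A B (snd y) = weight (A * B) (snd y) *\<^sub>R (V \<cdot> marginal1 T A B \<Phi>)"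
    if y: "y \<in> set ys" for y
  proof -
    obtain q \<phi> where q: "0 < q" "\<phi> \<in> pure_states T (A * B)" "snd y = q *\<^sub>R \<phi>" using ys(3)[OF y] by blast
    note \<phi>s = pure_states_state[OF q(2)]
    have w: "weight (A * B) \<phi> = 1" using pure_states_normalised[OF q(2)] by (simp add: normalised_weight)
    have yst: "snd y \<in> states T (A * B)" using transf_I[OF ys(1)] y by (simp add: states_eq)
    define z where "z = zs ! fst y"
    have zz: "z \<in> set zs" "?xs ! fst y = (\<I> A \<otimes> snd z) \<cdot> \<Psi>" using ys(3)[OF y] by (auto simp: z_def)
    note Cc = zs(2)[OF zz(1)] note ct = channel_transf[OF Cc]
    have bt: "snd z \<in> transf T B B" using transf_I[OF zs(1)] zz(1) by simp
    have Ct: "fst z \<otimes> \<I> B \<in> transf T (A * B) (A * B)" by (rule par_transf[OF ct ident_transf])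
    have xst: "(\<I> A \<otimes> snd z) \<cdot> \<Psi> \<in> states T (A * B)" by (rule par_state[OF ident_transf bt s])
    have rest: "(\<I> A \<otimes> snd z) \<cdot> \<Psi> - snd y \<in> states T (A * B)" using ys(3)[OF y] zz(2) by simp
    obtain p where "(fst z \<otimes> \<I> B) \<cdot> ((\<I> A \<otimes> snd z) \<cdot> \<Psi>) = p *\<^sub>R \<Phi>"
      using zs(3)[OF zz(1)] par_left_right[OF ct bt s] by auto
    from proportional_component[OF Ct yst rest xst \<Phi> this]
    obtain p' where p': "q *\<^sub>R ((fst z \<otimes> \<I> B) \<cdot> \<phi>) = p' *\<^sub>R \<Phi>" by (auto simp: q(3) lin_simps)
    \<comment> \<open>The response \<open>fst z\<close> is a channel, so no weight is lost and the
      pure branch is mapped to \<open>\<Phi>\<close> itself.\<close>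
    have "weight (A * B) ((fst z \<otimes> \<I> B) \<cdot> \<phi>) = 1"
      using weight_channel[OF par_channel[OF Cc ident_channel] \<phi>s] w by simp
    then have "q = p'"
      using arg_cong[OF p', of "weight (A * B)"] pure_states_normalised[OF \<Phi>] by (simp add: weight_scale normalised_weight)
    then have eq: "(fst z \<otimes> \<I> B) \<cdot> \<phi> = \<Phi>" using p' q(1) by simp
    have "marginal2 T A B \<Phi> = marginal2 T A B \<phi>"
      unfolding eq[symmetric]
      using marginal2_par[OF Cc ident_transf \<phi>s] ident_state[OF marginal2_state[OF \<phi>s]] by simp
    then obtain V where V: "V \<in> reversible T A A" "\<phi> = (V \<otimes> \<I> B) \<cdot> \<Phi>"
      using purification_unique_left[OF \<Phi> q(2)] by blast
    have "marginal1 T A B \<phi> = V \<cdot> marginal1 T A B \<Phi>"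
      unfolding V(2) by (rule marginal1_par[OF reversible_transf[OF V(1)] ident_channel s\<Phi>])
    then show ?thesis using V(1) q(3) w by (intro exI[of _ V]) (simp add: marginal_simps weight_scale)
  qed
  then obtain V where V: "\<And>y. y \<in> set ys \<Longrightarrow> V y \<in> reversible T A A"
    "\<And>y. y \<in> set ys \<Longrightarrow> marginal1 T A B (snd y) = weight (A * B) (snd y) *\<^sub>R (V y \<cdot> marginal1 T A B \<Phi>)"
    by metis
  let ?ps = "map (\<lambda>y. weight (A * B) (snd y)) ys" and ?Us = "map V ys"
  let ?R = "sum_list (map2 (*\<^sub>R) ?ps ?Us)"
  have ps: "\<forall>p\<in>set ?ps. 0 \<le> p" "sum_list ?ps = 1"
    using transf_I[OF ys(1)] weight_nonneg weight_test[OF ys(1)] by (auto simp: states_eq comp_def)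
  have Us: "set ?Us \<subseteq> reversible T A A" using V(1) by auto
  have "map2 (\<lambda>p C. p *\<^sub>R C) ?ps ?Us \<in> tests T A A"
    by (rule random_channels) (use ps Us reversible_channel in auto)
  then have "?R \<in> channels T A A" by (rule sum_channel)
  moreover have "?R = (\<Sum>i<length ?Us. ?ps ! i *\<^sub>R ?Us ! i)"
    using sum_list_scale_nth[of ?Us ?ps] by simp
  ultimately have "?R \<in> rare_channels T A"
    unfolding rare_channels_def using ps Us by (intro CollectI conjI exI[of _ ?ps] exI[of _ ?Us]) auto
  moreover have "?R \<cdot> marginal1 T A B \<Phi> = marginal1 T A B \<Psi>"
  proof -
    have "?R \<cdot> X = (\<Sum>y\<leftarrow>ys. weight (A * B) (snd y) *\<^sub>R (V y \<cdot> X))" for X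
      by (induction ys) (auto simp: lin_simps)
    then have "?R \<cdot> marginal1 T A B \<Phi> = (\<Sum>y\<leftarrow>ys. weight (A * B) (snd y) *\<^sub>R (V y \<cdot> marginal1 T A B \<Phi>))" .
    also have "\<dots> = (\<Sum>y\<leftarrow>ys. marginal1 T A B (snd y))"
      using V(2) by (intro arg_cong[of _ _ sum_list] map_cong) auto
    also have "\<dots> = marginal1 T A B (sum_list (map snd ys))" by (simp add: marginal_sum_list comp_def)
    finally show ?thesis using m by simp
  qed
  ultimately show ?thesis by blast
qed

text \<open>The ensemble of the states \<open>(Us ! i \<otimes> \<I> B) \<cdot> \<Phi>\<close> with
  probabilities \<open>ps ! i\<close> has the marginal of \<open>\<Psi>\<close> on \<open>A\<close>,
  so the second party can prepare it; the first party then undoes \<open>Us ! i\<close>.\<close>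

lemma rare_imp_one_way:
  assumes \<Psi>: "\<Psi> \<in> pure_states T (A * B)" and \<Phi>: "\<Phi> \<in> pure_states T (A * B)"
    and R: "R \<in> rare_channels T A" "R \<cdot> marginal1 T A B \<Phi> = marginal1 T A B \<Psi>"
  shows "one_way A B A B \<Psi> \<Phi>"
proof -
  note s = pure_states_state[OF \<Psi>] and s\<Phi> = pure_states_state[OF \<Phi>]
  obtain ps Us where ps: "length ps = length Us" "\<forall>p\<in>set ps. 0 \<le> p" "sum_list ps = 1"
    and Us: "set Us \<subseteq> reversible T A A" and Req: "R = (\<Sum>i<length Us. ps ! i *\<^sub>R Us ! i)"
    using R(1) by (auto simp: rare_channels_def)
  let ?n = "length Us"
  let ?xs = "map (\<lambda>i. ps ! i *\<^sub>R ((Us ! i \<otimes> \<I> B) \<cdot> \<Phi>)) [0..<?n]"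
  have U: "Us ! i \<in> reversible T A A" if "i < ?n" for i using Us that by (auto simp: subset_iff)
  have st: "(Us ! i \<otimes> \<I> B) \<cdot> \<Phi> \<in> normalised T (A * B)" if "i < ?n" for i
    by (rule normalised_seq[OF par_channel[OF reversible_channel[OF U[OF that]] ident_channel] pure_states_normalised[OF \<Phi>]])
  have \<Psi>c: "map2 (\<lambda>p C. p *\<^sub>R C) ps (map (\<lambda>i. (Us ! i \<otimes> \<I> B) \<cdot> \<Phi>) [0..<?n]) \<in> tests T 1 (A * B)"
    by (rule random_channels) (use ps st in \<open>auto simp: normalised_channel\<close>)
  have "map2 (\<lambda>p C. p *\<^sub>R C) ps (map (\<lambda>i. (Us ! i \<otimes> \<I> B) \<cdot> \<Phi>) [0..<?n]) = ?xs"
    by (rule nth_equalityI) (use ps(1) in auto)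
  with \<Psi>c have xs: "?xs \<in> tests T 1 (A * B)" by simp
  have "marginal1 T A B (sum_list ?xs) = (\<Sum>i\<leftarrow>[0..<?n]. ps ! i *\<^sub>R (Us ! i \<cdot> marginal1 T A B \<Phi>))"
  proof -
    have "marginal1 T A B (ps ! i *\<^sub>R ((Us ! i \<otimes> \<I> B) \<cdot> \<Phi>)) = ps ! i *\<^sub>R (Us ! i \<cdot> marginal1 T A B \<Phi>)" if "i < ?n" for i
      using marginal1_par[OF reversible_transf[OF U[OF that]] ident_channel s\<Phi>] by (simp add: marginal_simps)
    then show ?thesis
      unfolding marginal_sum_list map_map by (intro arg_cong[of _ _ sum_list] map_cong) auto
  qed
  also have "\<dots> = R \<cdot> marginal1 T A B \<Phi>"
    by (simp add: Req seq_sum_left lin_simps sum_list_sum_nth atLeast0LessThan)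
  finally have "marginal1 T A B (sum_list ?xs) = marginal1 T A B \<Psi>" using R(2) by simp
  from steering[OF \<Psi> xs this] obtain bs where bs: "bs \<in> tests T B B" "length bs = ?n"
    "\<forall>i<?n. (\<I> A \<otimes> bs ! i) \<cdot> \<Psi> = ps ! i *\<^sub>R ((Us ! i \<otimes> \<I> B) \<cdot> \<Phi>)" by auto
  have "\<forall>i. \<exists>V. i < ?n \<longrightarrow> V \<in> reversible T A A \<and> V \<cdot> Us ! i = \<I> A" using reversible_inverse[OF U] by blast
  then obtain V where V: "\<And>i. i < ?n \<Longrightarrow> V i \<in> reversible T A A" "\<And>i. i < ?n \<Longrightarrow> V i \<cdot> Us ! i = \<I> A" by metis
  let ?zs = "map (\<lambda>i. (V i, bs ! i)) [0..<?n]"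
  have "map snd ?zs = bs" using bs(2) map_nth[of bs] by (simp add: comp_def)
  then have "map snd ?zs \<in> tests T B B" using bs(1) by simp
  moreover have "fst z \<in> channels T A A \<and> (\<exists>p. (fst z \<otimes> snd z) \<cdot> \<Psi> = p *\<^sub>R \<Phi>)" if z: "z \<in> set ?zs" for z
  proof -
    obtain i where i: "i < ?n" "z = (V i, bs ! i)" using z by auto
    have bt: "bs ! i \<in> transf T B B" using transf_nth[OF bs(1)] i bs(2) by simp
    note vt = reversible_transf[OF V(1)[OF i(1)]] and ut = reversible_transf[OF U[OF i(1)]]
    have "(V i \<otimes> bs ! i) \<cdot> \<Psi> = (V i \<otimes> \<I> B) \<cdot> ((\<I> A \<otimes> bs ! i) \<cdot> \<Psi>)"
      by (rule par_left_right[symmetric, OF vt bt s])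
    also have "\<dots> = ps ! i *\<^sub>R ((V i \<otimes> \<I> B) \<cdot> ((Us ! i \<otimes> \<I> B) \<cdot> \<Phi>))" using bs(3) i(1) by (simp add: lin_simps)
    also have "(V i \<otimes> \<I> B) \<cdot> ((Us ! i \<otimes> \<I> B) \<cdot> \<Phi>) = \<Phi>"
      using seq_par_left[OF ut vt s\<Phi>] V(2)[OF i(1)] ident_state[OF s\<Phi>] by (simp add: par_ident)
    finally show ?thesis using i V(1) reversible_channel by auto
  qed
  ultimately show ?thesis unfolding one_way_def by blast
qed

text \<open>An exchange before the protocol and one after it let the parties trade roles; both are
  local channels, so the one-way form is kept.\<close>

lemma one_way_swap:
  assumes ur: "unrestricted_reversibility T"
    and \<Psi>: "\<Psi> \<in> pure_states T (A * B)" and \<Phi>: "\<Phi> \<in> pure_states T (A' * B')" and ow: "one_way A B A' B' \<Psi> \<Phi>"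
  shows "one_way B A B' A' (swap T A B \<cdot> \<Psi>) (swap T A' B' \<cdot> \<Phi>)"
proof -
  obtain zs where zs: "map snd zs \<in> tests T B B'"
    "\<And>z. z \<in> set zs \<Longrightarrow> fst z \<in> channels T A A'" "\<And>z. z \<in> set zs \<Longrightarrow> \<exists>p. (fst z \<otimes> snd z) \<cdot> \<Psi> = p *\<^sub>R \<Phi>"
    using ow by (auto simp: one_way_def)
  note s\<Psi> = swap_state[OF pure_states_state[OF \<Psi>]]
  obtain C D where CD: "C \<in> channels T B A" "D \<in> channels T A B" "(C \<otimes> D) \<cdot> (swap T A B \<cdot> \<Psi>) = \<Psi>"
    using local_exchange[OF ur swap_pure_states[OF \<Psi>]] swap_swap_state[OF pure_states_state[OF \<Psi>]] by auto
  obtain E F where EF: "E \<in> channels T A' B'" "F \<in> channels T B' A'" "(E \<otimes> F) \<cdot> \<Phi> = swap T A' B' \<cdot> \<Phi>"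
    using local_exchange[OF ur \<Phi>] by blast
  let ?ws = "map (\<lambda>z. (E \<cdot> (fst z \<cdot> C), F \<cdot> (snd z \<cdot> D))) zs"
  have "map (\<lambda>c. F \<cdot> c) (map (\<lambda>d. d \<cdot> D) (map snd zs)) \<in> tests T A A'"
    by (rule test_post[OF test_pre[OF CD(2) zs(1)] EF(2)])
  then have "map snd ?ws \<in> tests T A A'" by (simp add: comp_def)
  moreover have "fst w \<in> channels T B B' \<and> (\<exists>p. (fst w \<otimes> snd w) \<cdot> (swap T A B \<cdot> \<Psi>) = p *\<^sub>R (swap T A' B' \<cdot> \<Phi>))"
    if w: "w \<in> set ?ws" for w
  proof -
    obtain z where z: "z \<in> set zs" "w = (E \<cdot> (fst z \<cdot> C), F \<cdot> (snd z \<cdot> D))" using w by auto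
    note fc = zs(2)[OF z(1)]
    have t: "C \<in> transf T B A" "D \<in> transf T A B" "E \<in> transf T A' B'" "F \<in> transf T B' A'"
      "fst z \<in> transf T A A'" "snd z \<in> transf T B B'"
      using CD EF fc channel_transf transf_I[OF zs(1)] z(1) by auto
    obtain p where p: "(fst z \<otimes> snd z) \<cdot> \<Psi> = p *\<^sub>R \<Phi>" using zs(3)[OF z(1)] by blast
    have "(fst w \<otimes> snd w) \<cdot> (swap T A B \<cdot> \<Psi>) = (E \<otimes> F) \<cdot> (((fst z \<cdot> C) \<otimes> (snd z \<cdot> D)) \<cdot> (swap T A B \<cdot> \<Psi>))"
      unfolding z(2) fst_conv snd_conv
      by (rule par_seq_state[symmetric, OF seq_transf[OF t(1,5)] t(3) seq_transf[OF t(2,6)] t(4) s\<Psi>])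
    also have "((fst z \<cdot> C) \<otimes> (snd z \<cdot> D)) \<cdot> (swap T A B \<cdot> \<Psi>) = p *\<^sub>R \<Phi>"
      using par_seq_state[OF t(1,5,2,6) s\<Psi>] CD(3) p by simp
    also have "(E \<otimes> F) \<cdot> (p *\<^sub>R \<Phi>) = p *\<^sub>R (swap T A' B' \<cdot> \<Phi>)" using EF(3) by (simp add: lin_simps)
    finally show ?thesis using seq_channel[OF seq_channel[OF CD(1) fc] EF(1)] z(2) by auto
  qed
  ultimately show ?thesis unfolding one_way_def by blast
qed

section \<open>The RaRe criteria on the two sides\<close>

lemma one_way_iff_rare:
  assumes "\<Psi> \<in> pure_states T (A * B)" "\<Phi> \<in> pure_states T (A * B)"
  shows "one_way A B A B \<Psi> \<Phi> \<longleftrightarrow> (\<exists>R \<in> rare_channels T A. R \<cdot> marginal1 T A B \<Phi> = marginal1 T A B \<Psi>)"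
  using one_way_imp_rare[OF assms] rare_imp_one_way[OF assms] by blast

lemma one_way_iff_rare_second:
  assumes ur: "unrestricted_reversibility T" and \<Psi>: "\<Psi> \<in> pure_states T (A * B)" and \<Phi>: "\<Phi> \<in> pure_states T (A * B)"
  shows "one_way A B A B \<Psi> \<Phi> \<longleftrightarrow> (\<exists>R \<in> rare_channels T B. R \<cdot> marginal2 T A B \<Phi> = marginal2 T A B \<Psi>)"
proof -
  note s = pure_states_state[OF \<Psi>] pure_states_state[OF \<Phi>]
  have "one_way A B A B \<Psi> \<Phi> \<longleftrightarrow> one_way B A B A (swap T A B \<cdot> \<Psi>) (swap T A B \<cdot> \<Phi>)"
    using one_way_swap[OF ur \<Psi> \<Phi>] one_way_swap[OF ur swap_pure_states[OF \<Psi>] swap_pure_states[OF \<Phi>]]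
      swap_swap_state[OF s(1)] swap_swap_state[OF s(2)] by auto
  also have "\<dots> \<longleftrightarrow> (\<exists>R \<in> rare_channels T B. R \<cdot> marginal2 T A B \<Phi> = marginal2 T A B \<Psi>)"
    using one_way_iff_rare[OF swap_pure_states[OF \<Psi>] swap_pure_states[OF \<Phi>]]
      marginal1_swap[OF s(1)] marginal1_swap[OF s(2)] by simp
  finally show ?thesis .
qed

end

theorem mainTheorem7:
  fixes T :: "('s::monoid_mult, 't::real_normed_vector) op_theory"
    and A B :: 's and \<Phi> \<Psi> :: 't
  assumes "sharp_theory_with_purification T"
    and "unrestricted_reversibility T"
    and "\<Phi> \<in> pure_states T (A * B)"
    and "\<Psi> \<in> pure_states T (A * B)"
  shows "((\<exists>L \<in> locc_channels T A B. seq T L \<Psi> = \<Phi>) \<longleftrightarrow>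
            (\<exists>R \<in> rare_channels T A. seq T R (marginal1 T A B \<Phi>) = marginal1 T A B \<Psi>)) \<and>
         ((\<exists>R \<in> rare_channels T A. seq T R (marginal1 T A B \<Phi>) = marginal1 T A B \<Psi>) \<longleftrightarrow>
            (\<exists>R \<in> rare_channels T B. seq T R (marginal2 T A B \<Phi>) = marginal2 T A B \<Psi>))"
proof -
  interpret sharp_theory_with_purification T by (rule assms(1))
  have "(\<exists>L \<in> locc_channels T A B. seq T L \<Psi> = \<Phi>) \<longleftrightarrow> one_way A B A B \<Psi> \<Phi>"
    using locc_imp_one_way[OF assms(2,4,3)] one_way_imp_locc[OF assms(4,3)] by blast
  then show ?thesis
    using one_way_iff_rare[OF assms(4,3)] one_way_iff_rare_second[OF assms(2,4,3)] by blast
qed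

end
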